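(* Let $N,n,m\ge 1$ be integers, let $1<p<+\infty$, let $\Omega\subset\mathbb R^N$ be a bounded open set, and let $f:\Omega\times\mathbb R^n\times\mathbb R^m\times\mathbb R^{n\times N}\to[0,+\infty)$ be a continuous function such that $(v,\xi)\mapsto f(x,u,v,\xi)$ is convex-quasiconvex for every $(x,u)\in\Omega\times\mathbb R^n$, and such that: (i) there exists a constant $C>0$ such that for every $(x,u,v,\xi)\in\Omega\times\mathbb R^n\times\mathbb R^m\times\mathbb R^{n\times N}$, $$\frac1C(|v|^p+|\xi|)-C\le f(x,u,v,\xi)\le C(1+|v|^p+|\xi|);$$ (ii) for every compact set $K\subset\Omega\times\mathbb R^n$ there exists a continuous function $\omega_K:\mathbb R\to[0,+\infty)$ with $\omega_K(0)=0$ such that, for all $(x,u),(x',u')\in K$ and all $(v,\xi)\in\mathbb R^m\times\mathbb R^{n\times N}$, $$|f(x,u,v,\xi)-f(x',u',v,\xi)|\le\omega_K(|x-x'|+|u-u'|)(1+|v|^p+|\xi|);$$ (iii) for every $x_0\in\Omega$ and $\varepsilon>0$ there exists $\delta>0$ such that, for all $x\in\Omega$ with $|x-x_0|\le\delta$ and all $(u,v,\xi)\in\mathbb R^n\times\mathbb R^m\times\mathbb R^{n\times N}$, $$f(x,u,v,\xi)-f(x_0,u,v,\xi)\ge-\varepsilon(1+|v|^p+|\xi|).$$ Then the functional $(u,v)\mapsto\int_\Omega f(x,u(x),v(x),\nabla u(x))\,dx$ is lower semicontinuous on $W^{1,1}(\Omega;\mathbb R^n)\times L^p(\Omega;\mathbb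 R^m)$ with respect to ($L^1$-strong $\times$ $L^p$-weak) convergence; that is, for all $(u,v)$ and all sequences $(u_k,v_k)$ in $W^{1,1}(\Omega;\mathbb R^n)\times L^p(\Omega;\mathbb R^m)$ with $u_k\to u$ strongly in $L^1(\Omega;\mathbb R^n)$ and $v_k\rightharpoonup v$ weakly in $L^p(\Omega;\mathbb R^m)$, $$\int_\Omega f(x,u(x),v(x),\nabla u(x))\,dx\le\liminf_{k\to\infty}\int_\Omega f(x,u_k(x),v_k(x),\nabla u_k(x))\,dx.$$
   Context: A Borel measurable function $h:\mathbb R^m\times\mathbb R^{n\times N}\to\mathbb R$ is called convex-quasiconvex if there exists a (nonempty) bounded open set $D\subset\mathbb R^N$ such that $$h(v,\xi)\le\frac1{|D|}\int_D h(v+\eta(x),\xi+\nabla\varphi(x))\,dx$$ for every $(v,\xi)\in\mathbb R^m\times\mathbb R^{n\times N}$, every $\eta\in L^\infty(D;\mathbb R^m)$ with $\int_D\eta\,dx=0$, and every $\varphi\in W^{1,\infty}_0(D;\mathbb R^n)$. *)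

theory Defs
  imports "HOL-Analysis.Analysis"
begin

text \<open>
  Elements of \<open>\<real>\<^sup>n\<^sup>\<times>\<^sup>N\<close> are the matrices \<open>real^'N^'n\<close> (row index in \<open>'n\<close>, column index in \<open>'N\<close>),
  whose norm is the Frobenius norm.  Functions on an open set are total functions of which only the
  restriction to that set matters; measurability is with respect to \<open>lebesgue_on\<close>.
\<close>

subsection \<open>Test functions\<close>

definition partial_deriv :: "'N::finite \<Rightarrow> (real^'N \<Rightarrow> real) \<Rightarrow> real^'N \<Rightarrow> real" where
  "partial_deriv i \<phi> x = frechet_derivative \<phi> (at x) (axis i 1)"

primrec Ck_fun :: "nat \<Rightarrow> (real^'N::finite \<Rightarrow> real) \<Rightarrow> bool" where
  "Ck_fun 0 \<phi> \<longleftrightarrow> continuous_on UNIV \<phi>"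
| "Ck_fun (Suc k) \<phi> \<longleftrightarrow> (\<forall>x. \<phi> differentiable (at x)) \<and> (\<forall>i. Ck_fun k (partial_deriv i \<phi>))"

definition test_functions :: "(real^'N::finite) set \<Rightarrow> (real^'N \<Rightarrow> real) set" where
  "test_functions \<Omega> = {\<phi>. (\<forall>k. Ck_fun k \<phi>) \<and>
     compact (closure {x. \<phi> x \<noteq> 0}) \<and> closure {x. \<phi> x \<noteq> 0} \<subseteq> \<Omega>}"

definition vector_test_functions :: "(real^'N::finite) set \<Rightarrow> (real^'N \<Rightarrow> real^'n::finite) set" where
  "vector_test_functions \<Omega> = {\<psi>. \<forall>j. (\<lambda>x. \<psi> x $ j) \<in> test_functions \<Omega>}"

subsection \<open>Lebesgue spaces\<close>

definition L1_space :: "'a::euclidean_space set \<Rightarrow> ('a \<Rightarrow> 'b::euclidean_space) set" where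
  "L1_space \<Omega> = {u. integrable (lebesgue_on \<Omega>) u}"

definition Lp_space :: "real \<Rightarrow> 'a::euclidean_space set \<Rightarrow> ('a \<Rightarrow> 'b::euclidean_space) set" where
  "Lp_space p \<Omega> = {v. v \<in> borel_measurable (lebesgue_on \<Omega>) \<and>
     integrable (lebesgue_on \<Omega>) (\<lambda>x. norm (v x) powr p)}"

definition Linf_space :: "'a::euclidean_space set \<Rightarrow> ('a \<Rightarrow> 'b::euclidean_space) set" where
  "Linf_space \<Omega> = {v. v \<in> borel_measurable (lebesgue_on \<Omega>) \<and>
     (\<exists>c. AE x in lebesgue_on \<Omega>. norm (v x) \<le> c)}"

definition L1_converges ::
  "'a::euclidean_space set \<Rightarrow> (nat \<Rightarrow> 'a \<Rightarrow> 'b::euclidean_space) \<Rightarrow> ('a \<Rightarrow> 'b) \<Rightarrow> bool" where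
  "L1_converges \<Omega> w u \<longleftrightarrow> (\<lambda>k. LINT x|lebesgue_on \<Omega>. norm (w k x - u x)) \<longlonglongrightarrow> 0"

text \<open>The dual of \<open>L\<^sup>p\<close>, \<open>1 < p < \<infinity>\<close>, is \<open>L\<^sup>q\<close> with the conjugate exponent \<open>q = p / (p - 1)\<close>.\<close>

definition Lp_weakly_converges ::
  "real \<Rightarrow> 'a::euclidean_space set \<Rightarrow> (nat \<Rightarrow> 'a \<Rightarrow> 'b::euclidean_space) \<Rightarrow> ('a \<Rightarrow> 'b) \<Rightarrow> bool" where
  "Lp_weakly_converges p \<Omega> w v \<longleftrightarrow> (\<forall>g \<in> Lp_space (p / (p - 1)) \<Omega>.
     (\<lambda>k. LINT x|lebesgue_on \<Omega>. w k x \<bullet> g x) \<longlonglongrightarrow> (LINT x|lebesgue_on \<Omega>. v x \<bullet> g x))"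

subsection \<open>Weak gradients and Sobolev spaces\<close>

definition locally_integrable_on ::
  "('a::euclidean_space \<Rightarrow> 'b::euclidean_space) \<Rightarrow> 'a set \<Rightarrow> bool" where
  "locally_integrable_on u \<Omega> \<longleftrightarrow> (\<forall>K. compact K \<and> K \<subseteq> \<Omega> \<longrightarrow> integrable (lebesgue_on K) u)"

definition has_weak_gradient ::
  "(real^'N::finite) set \<Rightarrow> (real^'N \<Rightarrow> real^'n::finite) \<Rightarrow> (real^'N \<Rightarrow> real^'N^'n) \<Rightarrow> bool" where
  "has_weak_gradient \<Omega> u G \<longleftrightarrow> locally_integrable_on u \<Omega> \<and> locally_integrable_on G \<Omega> \<and>
     (\<forall>\<phi> \<in> test_functions \<Omega>. \<forall>i j.
       (LINT x|lebesgue_on \<Omega>. u x $ j * partial_deriv i \<phi> x)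
         = - (LINT x|lebesgue_on \<Omega>. G x $ j $ i * \<phi> x))"

text \<open>A representative of the weak gradient, which on an open set is unique up to null sets.\<close>

definition weak_gradient ::
  "(real^'N::finite) set \<Rightarrow> (real^'N \<Rightarrow> real^'n::finite) \<Rightarrow> real^'N \<Rightarrow> real^'N^'n" where
  "weak_gradient \<Omega> u = (SOME G. has_weak_gradient \<Omega> u G)"

definition W11_space :: "(real^'N::finite) set \<Rightarrow> (real^'N \<Rightarrow> real^'n::finite) set" where
  "W11_space \<Omega> = {u \<in> L1_space \<Omega>. \<exists>G \<in> L1_space \<Omega>. has_weak_gradient \<Omega> u G}"

definition W1inf_space :: "(real^'N::finite) set \<Rightarrow> (real^'N \<Rightarrow> real^'n::finite) set" where
  "W1inf_space \<Omega> = {u \<in> Linf_space \<Omega>. \<exists>G \<in> Linf_space \<Omega>. has_weak_gradient \<Omega> u G}"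

text \<open>The closure of the test functions in the norm of \<open>W\<^sup>1\<^sup>,\<^sup>1\<close>.\<close>

definition W11_zero_space :: "(real^'N::finite) set \<Rightarrow> (real^'N \<Rightarrow> real^'n::finite) set" where
  "W11_zero_space \<Omega> = {u \<in> W11_space \<Omega>. \<exists>\<psi>. (\<forall>k. \<psi> k \<in> vector_test_functions \<Omega>) \<and>
     L1_converges \<Omega> \<psi> u \<and> L1_converges \<Omega> (\<lambda>k. weak_gradient \<Omega> (\<psi> k)) (weak_gradient \<Omega> u)}"

text \<open>
  As usual in the calculus of variations, \<open>W\<^sub>0\<^sup>1\<^sup>,\<^sup>\<infinity> = W\<^sup>1\<^sup>,\<^sup>\<infinity> \<inter> W\<^sub>0\<^sup>1\<^sup>,\<^sup>1\<close> on a bounded open set; this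
  is not the closure of the test functions in the norm of \<open>W\<^sup>1\<^sup>,\<^sup>\<infinity>\<close>.
\<close>

definition W1inf_zero_space :: "(real^'N::finite) set \<Rightarrow> (real^'N \<Rightarrow> real^'n::finite) set" where
  "W1inf_zero_space \<Omega> = W1inf_space \<Omega> \<inter> W11_zero_space \<Omega>"

subsection \<open>Convex-quasiconvex functions\<close>

text \<open>
  The integrability requirement only rules out the default value \<open>0\<close> of a divergent Bochner integral.
  It is automatic for locally bounded \<open>h\<close>, since the arguments of \<open>h\<close> are essentially bounded.
\<close>

definition convex_quasiconvex ::
  "(real^'m::finite \<Rightarrow> real^'N::finite^'n::finite \<Rightarrow> real) \<Rightarrow> bool" where
  "convex_quasiconvex h \<longleftrightarrow> case_prod h \<in> borel_measurable borel \<and>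
     (\<exists>D :: (real^'N) set. D \<noteq> {} \<and> bounded D \<and> open D \<and>
       (\<forall>v \<xi>. \<forall>\<eta> \<in> Linf_space D. (LINT x|lebesgue_on D. \<eta> x) = 0 \<longrightarrow>
         (\<forall>\<phi> \<in> W1inf_zero_space D.
           integrable (lebesgue_on D) (\<lambda>x. h (v + \<eta> x) (\<xi> + weak_gradient D \<phi> x)) \<and>
           h v \<xi> \<le> 1 / measure lebesgue D *
             (LINT x|lebesgue_on D. h (v + \<eta> x) (\<xi> + weak_gradient D \<phi> x)))))"

subsection \<open>The integral functional\<close>

definition energy ::
  "(real^'N::finite \<Rightarrow> real^'n::finite \<Rightarrow> real^'m::finite \<Rightarrow> real^'N^'n \<Rightarrow> real) \<Rightarrow> (real^'N) set \<Rightarrow>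
    (real^'N \<Rightarrow> real^'n) \<Rightarrow> (real^'N \<Rightarrow> real^'m) \<Rightarrow> ennreal" where
  "energy f \<Omega> u v = (\<integral>\<^sup>+ x. ennreal (f x (u x) (v x) (weak_gradient \<Omega> u x)) \<partial>lebesgue_on \<Omega>)"

end

theory Submission
  imports Defs
begin

text \<open>
  Blow-up without measures.  For a radius \<open>r\<close>, the integral of a nonnegative function equals the
  integral over all centres \<open>x\<close> of its averages over the balls \<open>B(x, r)\<close>.  Applying this to the energy
  densities of \<open>(u\<^sub>k, v\<^sub>k)\<close> and Fatou's lemma, first for \<open>k \<rightarrow> \<infinity>\<close> and then along radii
  \<open>r\<^sub>j \<rightarrow> 0\<close>, reduces the theorem to a pointwise lower bound at almost every centre \<open>x\<close>.  The radii
  are chosen such that at almost every \<open>x\<close> the affine expansion \<open>l\<close> of \<open>u\<close> at \<open>x\<close> satisfies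
  \<open>\<integral>\<^bsub>B(x,r)\<^esub> |u - l| = o(r |B(x,r)|)\<close>, and similarly for \<open>v\<close>; this follows from the continuity of
  translations in \<open>L\<^sup>1\<close> and replaces Lebesgue points.

  On a single ball, \<open>u\<^sub>k - l\<close> is small in \<open>L\<^sup>1\<close> only.  It is truncated in its values and cut off in space at a
  level that is selected by the pigeonhole principle so that the transition region carries little
  energy, and \<open>v\<^sub>k\<close> is set to \<open>0\<close> outside of the good set.  Convex-quasiconvexity at the mean of the
  modified \<open>v\<^sub>k\<close> then gives the bound.  Since \<open>p > 1\<close>, this mean changes little.
\<close>

text \<open>The growth is only linear in the gradient, so bounded energy gives no weak compactness
  of the gradients. The bound on one ball is therefore proved by contradiction: energy below the
  claimed value bounds the integral of |v_k|^p + |grad u_k| on that ball by a multiple of its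
  volume. A cutoff in space costs |u_k - l| / r, which is harmless because the expansion error is
  o(r) in mean. Truncation in values is forced by the dependence of f on u: f can be frozen at (x,
  u(x)) only where u_k is uniformly close to u(x), and L1 convergence does not give that. Truncating
  |u_k - l|^2 between A and 2A costs a multiple of |grad (u_k - l)| that does not depend on A, so
  levels can be compared and a cheap one picked. In the transition region |v_k|^p would be paid as
  well; setting v_k to 0 there avoids it and shifts the mean only by the integral of |v_k| over a
  small set. The u_k are first replaced by C1 maps of almost equal energy, so that the truncation
  needs only the classical chain rule.\<close>

section \<open>Affine changes of variables for Lebesgue measure\<close>

lemma nn_integral_lborel_affine:
  fixes f :: "'a::euclidean_space \<Rightarrow> ennreal"
  assumes [measurable]: "f \<in> borel_measurable borel" and c: "c \<noteq> 0"
  shows "(\<integral>\<^sup>+x. f x \<partial>lborel) = ennreal (\<bar>c\<bar> ^ DIM('a)) * (\<integral>\<^sup>+x. f (t + c *\<^sub>R x) \<partial>lborel)"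
  by (subst lborel_affine[OF c, of t]) (simp add: nn_integral_density nn_integral_distr nn_integral_cmult)

lemma integrable_lborel_affine:
  fixes f :: "'a::euclidean_space \<Rightarrow> 'b::{banach, second_countable_topology}"
  assumes "integrable lborel f" "c \<noteq> 0"
  shows "integrable lborel (\<lambda>x. f (t + c *\<^sub>R x))"
proof -
  have [measurable]: "f \<in> borel_measurable borel"
    using borel_measurable_integrable[OF assms(1)] by simp
  have "(\<integral>\<^sup>+x. ennreal (norm (f x)) \<partial>lborel) < \<infinity>"
    using assms(1) by (simp add: integrable_iff_bounded)
  then have "(\<integral>\<^sup>+x. ennreal (norm (f (t + c *\<^sub>R x))) \<partial>lborel) < \<infinity>"
    using assms(2) by (subst (asm) nn_integral_lborel_affine[where c=c and t=t])
      (auto simp: ennreal_mult_less_top)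
  then show ?thesis by (simp add: integrable_iff_bounded)
qed

lemma integral_lborel_affine:
  fixes f :: "'a::euclidean_space \<Rightarrow> 'b::{banach, second_countable_topology}"
  assumes [measurable]: "f \<in> borel_measurable borel" and c: "c \<noteq> 0"
  shows "(LBINT x. f x) = (\<bar>c\<bar> ^ DIM('a)) *\<^sub>R (LBINT x. f (t + c *\<^sub>R x))"
proof -
  have "(LBINT x. f x) =
      (\<integral>x. f x \<partial>density (distr lborel borel (\<lambda>x. t + c *\<^sub>R x)) (\<lambda>_. ennreal (\<bar>c\<bar> ^ DIM('a))))"
    using lborel_affine[OF c, of t] by simp
  also have "\<dots> = (\<bar>c\<bar> ^ DIM('a)) *\<^sub>R (LBINT x. f (t + c *\<^sub>R x))"
    by (subst integral_density) (auto simp: integral_distr)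
  finally show ?thesis .
qed

lemma integrable_lborel_translate:
  fixes f :: "'a::euclidean_space \<Rightarrow> 'b::{banach, second_countable_topology}"
  assumes "integrable lborel f"
  shows "integrable lborel (\<lambda>x. f (x + h))" "integrable lborel (\<lambda>x. f (x - h))"
    "integrable lborel (\<lambda>x. f (h - x))"
  using integrable_lborel_affine[OF assms, of 1 h] integrable_lborel_affine[OF assms, of 1 "-h"]
    integrable_lborel_affine[OF assms, of "-1" h] by (auto simp: algebra_simps)

lemma integral_lborel_translate:
  fixes f :: "'a::euclidean_space \<Rightarrow> 'b::{banach, second_countable_topology}"
  assumes [measurable]: "f \<in> borel_measurable borel"
  shows "(LBINT x. f (x + h)) = (LBINT x. f x)"
    and "(LBINT x. f (h - x)) = (LBINT x. f x)"
  using integral_lborel_affine[OF assms, of 1 h] integral_lborel_affine[OF assms, of "-1" h]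
  by (auto simp: algebra_simps)

lemma nn_integral_lborel_translate:
  fixes f :: "'a::euclidean_space \<Rightarrow> ennreal"
  assumes [measurable]: "f \<in> borel_measurable borel"
  shows "(\<integral>\<^sup>+x. f (x + h) \<partial>lborel) = (\<integral>\<^sup>+x. f x \<partial>lborel)"
    and "(\<integral>\<^sup>+x. f (h - x) \<partial>lborel) = (\<integral>\<^sup>+x. f x \<partial>lborel)"
  using nn_integral_lborel_affine[OF assms, of 1 h] nn_integral_lborel_affine[OF assms, of "-1" h]
  by (auto simp: algebra_simps)

section \<open>Regularity of Lebesgue measure and continuity of translations in L1\<close>

text \<open>Inner regularity concerns finite measures, so it is applied to Lebesgue measure
  concentrated on \<open>A\<close>, in the form of
  \<open>density lborel (indicator A)\<close>.\<close>

lemma lborel_inner_compact: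
  fixes A :: "'a::euclidean_space set"
  assumes A: "A \<in> sets borel" "emeasure lborel A < \<infinity>" and e: "e > 0"
  obtains K where "compact K" "K \<subseteq> A" "measure lborel K > measure lborel A - e"
proof -
  let ?M = "density lborel (indicator A)"
  have M: "emeasure ?M B = emeasure lborel (A \<inter> B)" if "B \<in> sets borel" for B
    using A that by (subst emeasure_density)
      (auto simp: indicator_inter_arith[symmetric] simp flip: nn_integral_indicator)
  have "emeasure ?M A = (SUP K \<in> {K. K \<subseteq> A \<and> compact K}. emeasure ?M K)"
    by (rule inner_regular) (use A M[of UNIV] in \<open>auto simp: less_top\<close>)
  moreover have "emeasure ?M A = ennreal (measure lborel A)"
    using A M[of A] by (auto simp: emeasure_eq_ennreal_measure)
  ultimately have sup: "ennreal (measure lborel A) = (SUP K \<in> {K. K \<subseteq> A \<and> compact K}. emeasure ?M K)"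
    by simp
  show thesis
  \<comment> \<open>Only for \<open>e \<le> measure lborel A\<close> does \<open>ennreal\<close>
    represent \<open>measure lborel A - e\<close> faithfully; in the other case the empty set
    serves.\<close>
  proof (cases "measure lborel A < e")
    case True
    then show thesis by (intro that[of "{}"]) auto
  next
    case False
    then have "ennreal (measure lborel A - e) < ennreal (measure lborel A)"
      using e by (auto simp: ennreal_less_iff)
    then obtain K where K: "K \<subseteq> A" "compact K" "ennreal (measure lborel A - e) < emeasure ?M K"
      unfolding sup less_SUP_iff by blast
    have "emeasure ?M K = emeasure lborel K"
      using K M[of K] by (simp add: Int_absorb1 borel_compact)
    also have "\<dots> = ennreal (measure lborel K)"
      using K(2) emeasure_compact_finite[OF K(2)] by (auto simp: emeasure_eq_ennreal_measure)
    finally have "measure lborel A - e < measure lborel K"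
      using K(3) False by (auto simp: ennreal_less_iff)
    then show thesis using K by (intro that[of K])
  qed
qed

lemma lborel_outer_open:
  fixes A :: "'a::euclidean_space set"
  assumes A: "A \<in> sets borel" "emeasure lborel A < \<infinity>" and e: "e > 0"
  obtains U where "open U" "A \<subseteq> U" "emeasure lborel U < \<infinity>" "measure lborel U < measure lborel A + e"
proof -
  have "A \<in> sets lebesgue" using A by simp
  then obtain U where U: "open U" "A \<subseteq> U" "emeasure lebesgue (U - A) < ennreal e"
    using sets_lebesgue_outer_open[OF _ e] by metis
  have UA: "emeasure lborel (U - A) < ennreal e"
    using U A by simp
  have eq: "emeasure lborel U = emeasure lborel A + emeasure lborel (U - A)"
    using U A by (subst plus_emeasure) (auto simp: Un_absorb1)
  have fU: "emeasure lborel U < \<infinity>"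
    unfolding eq using A(2) less_trans[OF UA ennreal_less_top] by simp
  have "measure lborel U = measure lborel A + measure lborel (U - A)"
    using U A fU by (subst measure_Diff) (auto simp: fmeasurable_def)
  moreover have "measure lborel (U - A) < e"
    using UA less_trans[OF UA ennreal_less_top]
    by (subst (asm) (1) emeasure_eq_ennreal_measure) (auto simp: ennreal_less_iff)
  ultimately show thesis using U fU by (intro that[of U]) auto
qed

text \<open>Density argument along \<open>integrable_induct\<close>: multiples of indicators, sums,
  dominated limits. For an indicator, a compact \<open>K\<close> inside and an open \<open>U\<close>
  around \<open>A\<close> leave a gap \<open>d\<close> between \<open>K\<close> and the complement
  of \<open>U\<close>, and a shift by less than \<open>d\<close> keeps \<open>K\<close> inside
  \<open>U\<close>. In the limit step the approximation error is paid twice, once in translated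
  form.\<close>

lemma L1_translation_continuous:
  fixes g :: "'a::euclidean_space \<Rightarrow> 'b::{banach, second_countable_topology}"
  assumes g: "integrable lborel g" and e: "e > 0"
  shows "\<exists>d>0. \<forall>h. norm h < d \<longrightarrow> (LBINT x. norm (g (x + h) - g x)) < e"
  using g e
proof (induction arbitrary: e rule: integrable_induct)
  case (base A c)
  have A: "A \<in> sets borel" "emeasure lborel A < \<infinity>" using base by auto
  \<comment> \<open>The three differences used below have total measure at most
    \<open>4 * e'\<close>; the factor 5 makes the final inequality strict, and the summand 1 covers
    \<open>c = 0\<close>.\<close>
  define e' where "e' = e / (5 * (norm c + 1))"
  have e': "e' > 0" using base by (auto simp: e'_def divide_simps add_nonneg_pos)
  obtain K where K: "compact K" "K \<subseteq> A" "measure lborel K > measure lborel A - e'"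
    using lborel_inner_compact[OF A e'] .
  obtain U where U: "open U" "A \<subseteq> U" "emeasure lborel U < \<infinity>" "measure lborel U < measure lborel A + e'"
    using lborel_outer_open[OF A e'] .
  have KB: "K \<in> sets borel" using K(1) by (simp add: borel_compact)
  have UB: "U \<in> sets borel" using U(1) by simp
  have "K \<subseteq> U" using K U by auto
  obtain d where d: "d > 0" "\<forall>x\<in>K. ball x d \<subseteq> U"
    using compact_subset_open_imp_ball_epsilon_subset[OF K(1) U(1) \<open>K \<subseteq> U\<close>]
    by (metis UN_subset_iff)
  have intK: "integrable lborel (indicator K :: 'a \<Rightarrow> real)"
    using K KB emeasure_compact_finite[OF K(1)] by simp
  have intA: "integrable lborel (indicator A :: 'a \<Rightarrow> real)" using A by simp
  have intU: "integrable lborel (indicator U :: 'a \<Rightarrow> real)" using U UB by simp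
  have "(LBINT x. norm (indicator A (x + h) *\<^sub>R c - indicator A x *\<^sub>R c)) < e" if h: "norm h < d" for h
  proof -
    have iA: "integrable lborel (\<lambda>x. indicator A (x + h) :: real)"
      by (rule integrable_lborel_translate[OF intA])
    have iK: "integrable lborel (\<lambda>x. indicator K (x + h) :: real)"
      by (rule integrable_lborel_translate[OF intK])
    have "norm (indicator A (x + h) *\<^sub>R c - indicator A x *\<^sub>R c)
        \<le> norm c * (((indicator A (x + h) - indicator K (x + h)) + (indicator U x - indicator K (x + h)))
            + (indicator U x - indicator A x))" for x
    proof -
      have "x \<in> U" if "x + h \<in> K"
        using d(2) that h by (force simp: dist_norm norm_minus_commute)
      \<comment> \<open>A point that enters or leaves \<open>A\<close> under the shift is charged to
        \<open>A - K\<close> at \<open>x + h\<close>, to \<open>U\<close> at \<open>x\<close> with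
        \<open>x + h\<close> outside of \<open>K\<close>, or to \<open>U - A\<close> at
        \<open>x\<close>. The second difference is nonnegative because \<open>x + h \<in> K\<close>
        implies \<open>x \<in> U\<close>, which is where \<open>norm h < d\<close> enters.\<close>
      then have *: "\<bar>indicator A (x + h) - indicator A x :: real\<bar>
          \<le> ((indicator A (x + h) - indicator K (x + h)) + (indicator U x - indicator K (x + h)))
            + (indicator U x - indicator A x)"
        using K(2) U(2) by (auto simp: indicator_def)
      have "norm (indicator A (x + h) *\<^sub>R c - indicator A x *\<^sub>R c)
          = norm c * \<bar>indicator A (x + h) - indicator A x :: real\<bar>"
        by (simp flip: scaleR_left_diff_distrib)
      also have "\<dots> \<le> norm c * (((indicator A (x + h) - indicator K (x + h)) + (indicator U x - indicator K (x + h)))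
            + (indicator U x - indicator A x))"
        using * by (intro mult_left_mono) auto
      finally show ?thesis .
    qed
    then have "(LBINT x. norm (indicator A (x + h) *\<^sub>R c - indicator A x *\<^sub>R c))
      \<le> (LBINT x. norm c * (((indicator A (x + h) - indicator K (x + h)) + (indicator U x - indicator K (x + h)))
            + (indicator U x - indicator A x)))"
      using iA iK intA intU by (intro integral_mono) auto
    also have "\<dots> = norm c * (((measure lborel A - measure lborel K) + (measure lborel U - measure lborel K))
            + (measure lborel U - measure lborel A))"
      using iA iK intA intU intK A KB UB integral_lborel_translate(1)[of "indicator A :: 'a \<Rightarrow> real" h]
        integral_lborel_translate(1)[of "indicator K :: 'a \<Rightarrow> real" h]
      by simp
    also have "\<dots> \<le> norm c * (4 * e')"
      using K(3) U(4) by (intro mult_left_mono) auto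
    also have "\<dots> \<le> (norm c + 1) * (4 * e')" using e' by (intro mult_right_mono) auto
    also have "\<dots> < (norm c + 1) * (5 * e')" using e' by (intro mult_strict_left_mono) (auto simp: add_nonneg_pos)
    also have "\<dots> = e" using norm_ge_zero[of c] by (simp add: e'_def field_simps del: norm_ge_zero)
    finally show ?thesis .
  qed
  then show ?case using d(1) by blast
next
  case (add f g)
  have [measurable]: "f \<in> borel_measurable borel" "g \<in> borel_measurable borel"
    using borel_measurable_integrable[OF add(1)] borel_measurable_integrable[OF add(2)] by auto
  obtain d1 where d1: "d1 > 0" "\<And>h. norm h < d1 \<Longrightarrow> (LBINT x. norm (f (x + h) - f x)) < e / 2"
    using add.IH(1)[of "e/2"] add.prems by auto
  obtain d2 where d2: "d2 > 0" "\<And>h. norm h < d2 \<Longrightarrow> (LBINT x. norm (g (x + h) - g x)) < e / 2"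
    using add.IH(2)[of "e/2"] add.prems by auto
  have "(LBINT x. norm (f (x + h) + g (x + h) - (f x + g x))) < e" if h: "norm h < min d1 d2" for h
  proof -
    have i: "integrable lborel (\<lambda>x. f (x + h) - f x)" "integrable lborel (\<lambda>x. g (x + h) - g x)"
      using integrable_lborel_translate(1)[OF add(1), of h] integrable_lborel_translate(1)[OF add(2), of h] add(1,2)
      by auto
    have "(LBINT x. norm (f (x + h) + g (x + h) - (f x + g x)))
        \<le> (LBINT x. norm (f (x + h) - f x) + norm (g (x + h) - g x))"
    proof (rule integral_mono)
      have "integrable lborel (\<lambda>x. (f (x + h) - f x) + (g (x + h) - g x))" using i by auto
      then have "integrable lborel (\<lambda>x. norm ((f (x + h) - f x) + (g (x + h) - g x)))" by (rule integrable_norm)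
      then show "integrable lborel (\<lambda>x. norm (f (x + h) + g (x + h) - (f x + g x)))"
        by (simp add: algebra_simps)
      show "norm (f (x + h) + g (x + h) - (f x + g x)) \<le> norm (f (x + h) - f x) + norm (g (x + h) - g x)" for x
        by (metis add_diff_add norm_triangle_ineq)
    qed (use i in auto)
    also have "\<dots> = (LBINT x. norm (f (x + h) - f x)) + (LBINT x. norm (g (x + h) - g x))"
      using i by (intro Bochner_Integration.integral_add) auto
    also have "\<dots> < e" using d1(2)[of h] d2(2)[of h] h by auto
    finally show ?thesis .
  qed
  then show ?case using d1(1) d2(1) by (intro exI[of _ "min d1 d2"]) auto
next
  case (lim f s)
  have "(\<lambda>i. \<integral>x. norm (s i x - f x) \<partial>lborel) \<longlonglongrightarrow> (\<integral>x. 0 \<partial>(lborel :: 'a measure))"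
  proof (rule integral_dominated_convergence[where w="\<lambda>x. 3 * norm (f x)"])
    show "AE x in lborel. (\<lambda>i. norm (s i x - f x)) \<longlonglongrightarrow> 0"
    proof (rule AE_I2)
      fix x :: 'a
      have "(\<lambda>i. s i x) \<longlonglongrightarrow> f x" using lim by auto
      then show "(\<lambda>i. norm (s i x - f x)) \<longlonglongrightarrow> 0" by (metis LIM_zero tendsto_norm_zero)
    qed
    show "AE x in lborel. norm (norm (s i x - f x)) \<le> 3 * norm (f x)" for i
    proof (rule AE_I2)
      fix x :: 'a
      have "norm (s i x) \<le> 2 * norm (f x)" using lim by auto
      then show "norm (norm (s i x - f x)) \<le> 3 * norm (f x)" using norm_triangle_ineq4[of "s i x" "f x"] by auto
    qed
  qed (use lim in \<open>auto intro: borel_measurable_integrable\<close>)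
  then have "\<forall>\<^sub>F i in sequentially. (LBINT x. norm (s i x - f x)) < e / 3"
    using lim.prems by (intro order_tendstoD(2)) auto
  then obtain i where i: "(LBINT x. norm (s i x - f x)) < e / 3"
    by (auto simp: eventually_sequentially)
  have si: "integrable lborel (s i)" "integrable lborel f" using lim by auto
  have [measurable]: "s i \<in> borel_measurable borel" "f \<in> borel_measurable borel"
    using borel_measurable_integrable[OF si(1)] borel_measurable_integrable[OF si(2)] by auto
  obtain d where d: "d > 0" "\<And>h. norm h < d \<Longrightarrow> (LBINT x. norm (s i (x + h) - s i x)) < e / 3"
    using lim.IH[of "e / 3" i] lim.prems by auto
  have "(LBINT x. norm (f (x + h) - f x)) < e" if h: "norm h < d" for h
  proof -
    have ii: "integrable lborel (\<lambda>x. s i (x + h) - s i x)" "integrable lborel (\<lambda>x. f (x + h) - f x)"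
      using integrable_lborel_translate(1)[OF si(1), of h] integrable_lborel_translate(1)[OF si(2), of h] si by auto
    have id: "integrable lborel (\<lambda>x. norm (s i x - f x))" using si by auto
    have id': "integrable lborel (\<lambda>x. norm (s i (x + h) - f (x + h)))"
      using integrable_lborel_translate(1)[OF id, of h] by simp
    have "(LBINT x. norm (f (x + h) - f x))
      \<le> (LBINT x. norm (s i (x + h) - f (x + h)) + norm (s i (x + h) - s i x) + norm (s i x - f x))"
    proof (rule integral_mono)
      show "norm (f (x + h) - f x) \<le> norm (s i (x + h) - f (x + h)) + norm (s i (x + h) - s i x) + norm (s i x - f x)" for x
      proof -
        have "f (x + h) - f x = - (s i (x + h) - f (x + h)) + (s i (x + h) - s i x) + (s i x - f x)" by simp
        also have "norm \<dots> \<le> norm (- (s i (x + h) - f (x + h))) + norm (s i (x + h) - s i x) + norm (s i x - f x)"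
          by (meson norm_triangle_ineq norm_triangle_mono order_refl)
        finally show ?thesis by (simp only: norm_minus_cancel)
      qed
    qed (use ii id id' in auto)
    also have "\<dots> = (LBINT x. norm (s i (x + h) - f (x + h))) + (LBINT x. norm (s i (x + h) - s i x))
        + (LBINT x. norm (s i x - f x))"
      using id id' ii by auto
    also have "(LBINT x. norm (s i (x + h) - f (x + h))) = (LBINT x. norm (s i x - f x))"
      by (rule integral_lborel_translate(1)[of "\<lambda>x. norm (s i x - f x)"]) measurable
    finally show ?thesis using i d(2)[OF h] by simp
  qed
  then show ?case using d(1) by blast
qed

section \<open>Convolution and approximation of the identity in L1\<close>

definition conv :: "('a::euclidean_space \<Rightarrow> real) \<Rightarrow> ('a \<Rightarrow> 'b::euclidean_space) \<Rightarrow> 'a \<Rightarrow> 'b" where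
  "conv \<rho> g x = (LBINT y. \<rho> (x - y) *\<^sub>R g y)"

lemma integrable_bounded_scaleR:
  fixes g :: "'a \<Rightarrow> 'b::{banach, second_countable_topology}"
  assumes "integrable M g" "k \<in> borel_measurable M" "\<And>x. \<bar>k x\<bar> \<le> B"
  shows "integrable M (\<lambda>x. k x *\<^sub>R g x)"
proof (rule Bochner_Integration.integrable_bound[of M "\<lambda>x. B * norm (g x)"])
  show "(\<lambda>x. k x *\<^sub>R g x) \<in> borel_measurable M" using assms(1,2) by measurable
  have "\<bar>k x\<bar> * norm (g x) \<le> \<bar>B\<bar> * norm (g x)" for x
    using assms(3)[of x] by (intro mult_right_mono) auto
  then show "AE x in M. norm (k x *\<^sub>R g x) \<le> norm (B * norm (g x))" by (auto simp: abs_mult)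
qed (use assms in auto)

text \<open>\<open>conv \<rho> g x\<close> averages the translates \<open>g (x - z)\<close> with
  weights \<open>\<rho> z\<close>, so Tonelli bounds its L1 distance from \<open>g\<close> by the
  average of the translation errors. Only shifts with \<open>norm z < d\<close> carry
  weight.\<close>

lemma L1_mollify:
  fixes g :: "'a::euclidean_space \<Rightarrow> 'b::euclidean_space"
  assumes g: "integrable lborel g" and \<rho>: "integrable lborel \<rho>" "\<And>x. 0 \<le> \<rho> x" "(LBINT x. \<rho> x) = 1"
    and B: "\<And>x. \<rho> x \<le> B"
    and supp: "\<And>x. d \<le> norm x \<Longrightarrow> \<rho> x = 0"
    and d: "\<And>h. norm h < d \<Longrightarrow> (LBINT x. norm (g (x + h) - g x)) \<le> e"
  shows "conv \<rho> g \<in> borel_measurable borel"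
    and "(\<integral>\<^sup>+x. norm (conv \<rho> g x - g x) \<partial>lborel) \<le> ennreal e"
proof -
  have [measurable]: "g \<in> borel_measurable borel" "\<rho> \<in> borel_measurable borel"
    using borel_measurable_integrable[OF g] borel_measurable_integrable[OF \<rho>(1)] by auto
  show [measurable]: "conv \<rho> g \<in> borel_measurable borel"
  proof -
    have "(\<lambda>x. \<integral>y. \<rho> (x - y) *\<^sub>R g y \<partial>lborel) \<in> borel_measurable borel"
      by measurable
    then show ?thesis by (simp add: conv_def[abs_def])
  qed
  have pt: "ennreal (norm (conv \<rho> g x - g x)) \<le> (\<integral>\<^sup>+z. \<rho> z * norm (g (x - z) - g x) \<partial>lborel)" for x
  proof -
    \<comment> \<open>Boundedness of \<open>\<rho>\<close> makes this integrable for every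
      \<open>x\<close>, not merely for almost every one.\<close>
    have ig: "integrable lborel (\<lambda>z. \<rho> z *\<^sub>R g (x - z))"
      by (rule integrable_bounded_scaleR[where B=B]) (use B \<rho>(2) integrable_lborel_translate(3)[OF g] in auto)
    have "conv \<rho> g x = (LBINT z. \<rho> (x - (x - z)) *\<^sub>R g (x - z))"
      unfolding conv_def by (subst integral_lborel_translate(2)[symmetric, of "\<lambda>y. \<rho> (x - y) *\<^sub>R g y" x]) auto
    then have "conv \<rho> g x - g x = (LBINT z. \<rho> z *\<^sub>R g (x - z)) - (LBINT z. \<rho> z *\<^sub>R g x)"
      using \<rho> by simp
    also have "\<dots> = (LBINT z. \<rho> z *\<^sub>R (g (x - z) - g x))"
      using ig \<rho> by (subst Bochner_Integration.integral_diff[symmetric]) (auto simp: scaleR_diff_right)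
    finally have eq: "conv \<rho> g x - g x = (LBINT z. \<rho> z *\<^sub>R (g (x - z) - g x))" .
    have "integrable lborel (\<lambda>z. \<rho> z *\<^sub>R (g (x - z) - g x))"
      using ig \<rho> by (simp add: scaleR_diff_right)
    then have "ennreal (norm (conv \<rho> g x - g x)) \<le> (\<integral>\<^sup>+z. norm (\<rho> z *\<^sub>R (g (x - z) - g x)) \<partial>lborel)"
      unfolding eq by (rule integral_norm_bound_ennreal)
    then show ?thesis using \<rho>(2) by simp
  qed
  have inner: "(\<integral>\<^sup>+x. \<rho> z * norm (g (x - z) - g x) \<partial>lborel) \<le> ennreal e * ennreal (\<rho> z)" for z
  proof (cases "norm z < d")
    case True
    have i: "integrable lborel (\<lambda>x. norm (g (x + - z) - g x))"
      using integrable_lborel_translate(1)[OF g, of "-z"] g by auto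
    have "(\<integral>\<^sup>+x. \<rho> z * norm (g (x - z) - g x) \<partial>lborel) = ennreal (\<rho> z) * (\<integral>\<^sup>+x. norm (g (x + - z) - g x) \<partial>lborel)"
      using \<rho>(2) by (simp add: ennreal_mult nn_integral_cmult)
    also have "(\<integral>\<^sup>+x. norm (g (x + - z) - g x) \<partial>lborel) = ennreal (LBINT x. norm (g (x + - z) - g x))"
      by (rule nn_integral_eq_integral[OF i]) auto
    also have "ennreal (\<rho> z) * \<dots> \<le> ennreal (\<rho> z) * ennreal e"
      using d[of "-z"] True by (intro mult_left_mono ennreal_leI) auto
    finally show ?thesis by (simp add: mult.commute)
  next
    case False
    then show ?thesis using supp[of z] by simp
  qed
  have "(\<integral>\<^sup>+x. norm (conv \<rho> g x - g x) \<partial>lborel) \<le> (\<integral>\<^sup>+x. (\<integral>\<^sup>+z. \<rho> z * norm (g (x - z) - g x) \<partial>lborel) \<partial>lborel)"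
    by (intro nn_integral_mono pt)
  also have "\<dots> = (\<integral>\<^sup>+z. (\<integral>\<^sup>+x. \<rho> z * norm (g (x - z) - g x) \<partial>lborel) \<partial>lborel)"
    by (rule lborel_pair.Fubini') measurable
  also have "\<dots> \<le> (\<integral>\<^sup>+z. ennreal e * ennreal (\<rho> z) \<partial>lborel)"
    by (intro nn_integral_mono inner)
  also have "\<dots> = ennreal e * (\<integral>\<^sup>+z. \<rho> z \<partial>lborel)" by (subst nn_integral_cmult) auto
  also have "(\<integral>\<^sup>+z. \<rho> z \<partial>lborel) = 1" using \<rho> by (subst nn_integral_eq_integral) auto
  finally show "(\<integral>\<^sup>+x. norm (conv \<rho> g x - g x) \<partial>lborel) \<le> ennreal e" by simp
qed

section \<open>Gradients of real functions and differentiation of convolutions\<close>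

definition grad :: "(real^'N::finite \<Rightarrow> real) \<Rightarrow> real^'N \<Rightarrow> real^'N" where
  "grad \<phi> x = (\<chi> i. partial_deriv i \<phi> x)"

definition C1_fun :: "(real^'N::finite \<Rightarrow> real) \<Rightarrow> bool" where
  "C1_fun \<phi> \<longleftrightarrow> Ck_fun (Suc 0) \<phi>"

lemma has_derivative_grad:
  assumes "\<phi> differentiable (at x)"
  shows "(\<phi> has_derivative (\<lambda>h. grad \<phi> x \<bullet> h)) (at x)"
proof -
  have d: "(\<phi> has_derivative frechet_derivative \<phi> (at x)) (at x)"
    using assms by (simp add: frechet_derivative_works)
  then have lin: "linear (frechet_derivative \<phi> (at x))" by (rule has_derivative_linear)
  have "frechet_derivative \<phi> (at x) h = grad \<phi> x \<bullet> h" for h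
  proof -
    have "h = (\<Sum>i\<in>UNIV. (h $ i) *\<^sub>R axis i 1)"
      using basis_expansion[of h] by (simp add: scalar_mult_eq_scaleR)
    then have "frechet_derivative \<phi> (at x) h
        = frechet_derivative \<phi> (at x) (\<Sum>i\<in>UNIV. (h $ i) *\<^sub>R axis i 1)" by simp
    also have "\<dots> = (\<Sum>i\<in>UNIV. (h $ i) *\<^sub>R frechet_derivative \<phi> (at x) (axis i 1))"
      by (simp add: linear_sum[OF lin] linear_scale[OF lin])
    also have "\<dots> = grad \<phi> x \<bullet> h"
      by (simp add: grad_def inner_vec_def partial_deriv_def mult.commute)
    finally show ?thesis .
  qed
  then have "frechet_derivative \<phi> (at x) = (\<lambda>h. grad \<phi> x \<bullet> h)" by (rule ext)
  then show ?thesis using d by simp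
qed

lemma grad_unique:
  assumes "(\<phi> has_derivative (\<lambda>h. a \<bullet> h)) (at x)"
  shows "grad \<phi> x = a" "partial_deriv i \<phi> x = a $ i"
  unfolding grad_def partial_deriv_def frechet_derivative_at[OF assms, symmetric]
  by (auto simp: inner_axis vec_eq_iff)

lemma Ck_fun_continuous: "Ck_fun k \<phi> \<Longrightarrow> continuous_on UNIV \<phi>"
  by (cases k) (auto simp: continuous_on_eq_continuous_at differentiable_imp_continuous_within)

lemma Ck_fun_C1: "Ck_fun (Suc k) \<phi> \<Longrightarrow> C1_fun \<phi>"
  by (auto simp: C1_fun_def intro: Ck_fun_continuous)

lemma C1_funD:
  assumes "C1_fun \<phi>"
  shows "(\<phi> has_derivative (\<lambda>h. grad \<phi> x \<bullet> h)) (at x)"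
    "continuous_on UNIV (grad \<phi>)" "continuous_on UNIV (partial_deriv i \<phi>)" "continuous_on UNIV \<phi>"
  using assms has_derivative_grad[of \<phi> x] Ck_fun_continuous[of "Suc 0" \<phi>]
  by (auto simp: C1_fun_def grad_def[abs_def] intro!: continuous_on_vec_lambda)

lemma C1_funI:
  assumes "\<And>x. (\<phi> has_derivative (\<lambda>h. a x \<bullet> h)) (at x)" "continuous_on UNIV a"
  shows "C1_fun \<phi>" "grad \<phi> = a" "partial_deriv i \<phi> = (\<lambda>x. a x $ i)"
proof -
  show "grad \<phi> = a" by (intro ext grad_unique assms)
  show pd: "partial_deriv i \<phi> = (\<lambda>x. a x $ i)" for i by (intro ext grad_unique assms)
  show "C1_fun \<phi>" unfolding C1_fun_def Ck_fun.simps pd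
    using assms by (auto simp: differentiable_def intro!: continuous_intros)
qed

lemma partial_deriv_eq_0_outside:
  fixes \<phi> :: "real^'N::finite \<Rightarrow> real"
  assumes "closed S" "\<And>x. x \<notin> S \<Longrightarrow> \<phi> x = 0" "x \<notin> S"
  shows "partial_deriv i \<phi> x = 0" "grad \<phi> x = 0"
proof -
  have "((\<lambda>x. 0 :: real) has_derivative (\<lambda>h. (0 :: real^'N) \<bullet> h)) (at x)" by simp
  then have "(\<phi> has_derivative (\<lambda>h. (0 :: real^'N) \<bullet> h)) (at x)"
    by (rule has_derivative_transform_within_open[where s="-S"]) (use assms in auto)
  from grad_unique[OF this] show "partial_deriv i \<phi> x = 0" "grad \<phi> x = 0" by auto
qed

lemma uniformly_continuous_compact_support:
  fixes g :: "'a::euclidean_space \<Rightarrow> 'b::real_normed_vector"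
  assumes "continuous_on UNIV g" "\<And>x. x \<notin> cball 0 R \<Longrightarrow> g x = 0" "e > 0"
  shows "\<exists>d>0. \<forall>x h. norm h < d \<longrightarrow> norm (g (x + h) - g x) < e"
proof -
  have "uniformly_continuous_on (cball 0 (R + 1)) g"
    using assms(1) by (intro compact_uniformly_continuous) (auto intro: continuous_on_subset)
  then obtain d where d: "d > 0" "\<And>x y. x \<in> cball 0 (R + 1) \<Longrightarrow> y \<in> cball 0 (R + 1) \<Longrightarrow> dist y x < d \<Longrightarrow> dist (g y) (g x) < e"
    using assms(3) unfolding uniformly_continuous_on_def by metis
  have "norm (g (x + h) - g x) < e" if h: "norm h < min d 1" for x h
  proof (cases "norm x \<le> R + 1 \<and> norm (x + h) \<le> R + 1")
    case True
    then have "dist (g (x + h)) (g x) < e"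
      using h True by (intro d(2)) (simp_all only: mem_cball_0, simp_all add: dist_norm)
    then show ?thesis by (simp add: dist_norm)
  next
    case False
    have "norm x > R" "norm (x + h) > R"
      using False h norm_triangle_ineq[of x h] norm_triangle_ineq4[of "x + h" h] by auto
    then show ?thesis using assms(2,3) by auto
  qed
  then show ?thesis using d(1) by (intro exI[of _ "min d 1"]) auto
qed

lemma bounded_compact_support:
  fixes g :: "'a::euclidean_space \<Rightarrow> 'b::real_normed_vector"
  assumes "continuous_on UNIV g" "\<And>x. x \<notin> cball 0 R \<Longrightarrow> g x = 0"
  shows "\<exists>B\<ge>0. \<forall>x. norm (g x) \<le> B"
proof -
  have "bounded (g ` cball 0 R)"
    using assms(1) by (intro compact_imp_bounded compact_continuous_image) (auto intro: continuous_on_subset)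
  then obtain B where "\<forall>x\<in>cball 0 R. norm (g x) \<le> B" by (auto simp: bounded_iff)
  then have "norm (g x) \<le> max B 0" for x using assms(2)[of x] by (cases "x \<in> cball 0 R") (auto intro: max.coboundedI1)
  then show ?thesis by (intro exI[of _ "max B 0"]) auto
qed

lemma integrable_compact_support:
  fixes g :: "'a::euclidean_space \<Rightarrow> 'b::{banach, second_countable_topology}"
  assumes "continuous_on UNIV g" "\<And>x. x \<notin> cball 0 R \<Longrightarrow> g x = 0"
  shows "integrable lborel g"
proof -
  have "integrable lborel (\<lambda>x. indicator (cball 0 R) x *\<^sub>R g x)"
    using assms(1) by (intro borel_integrable_compact) (auto intro: continuous_on_subset)
  moreover have "(\<lambda>x. indicator (cball 0 R) x *\<^sub>R g x) = g"
    using assms(2) by (auto simp: indicator_def fun_eq_iff)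
  ultimately show ?thesis by simp
qed

text \<open>Mean value inequality for \<open>\<phi>\<close> minus its linearisation on
  \<open>cball x (norm h)\<close>. A continuous gradient with bounded support is uniformly
  continuous, so the remainder is small uniformly in \<open>x\<close>; this uniformity is what
  allows differentiation under the integral.\<close>

lemma uniform_taylor:
  fixes \<phi> :: "real^'N::finite \<Rightarrow> real"
  assumes "C1_fun \<phi>" "\<And>x. x \<notin> cball 0 R \<Longrightarrow> \<phi> x = 0" "e > 0"
  shows "\<exists>d>0. \<forall>x h. norm h < d \<longrightarrow> \<bar>\<phi> (x + h) - \<phi> x - grad \<phi> x \<bullet> h\<bar> \<le> e * norm h"
proof -
  obtain d where d: "d > 0" "\<And>x h. norm h < d \<Longrightarrow> norm (grad \<phi> (x + h) - grad \<phi> x) < e"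
    using uniformly_continuous_compact_support[OF C1_funD(2)[OF assms(1)] _ assms(3), of R]
      partial_deriv_eq_0_outside(2)[of "cball 0 R" \<phi>] assms(2) by (metis closed_cball)
  have "norm (\<phi> (x + h) - \<phi> x - grad \<phi> x \<bullet> ((x + h) - x)) \<le> norm ((x + h) - x) * e" if h: "norm h < d" for x h
  proof (rule differentiable_bound_linearization[where S="cball x (norm h)" and f'="\<lambda>x h. grad \<phi> x \<bullet> h"])
    show "x + t *\<^sub>R (x + h - x) \<in> cball x (norm h)" if "t \<in> {0..1}" for t
      using that by (auto simp: dist_norm mult_left_le_one_le)
    show "(\<phi> has_derivative (\<bullet>) (grad \<phi> y)) (at y within cball x (norm h))" for y
      using C1_funD(1)[OF assms(1), of y] by (rule has_derivative_at_withinI)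
    show "onorm ((\<bullet>) (grad \<phi> y) - (\<bullet>) (grad \<phi> x)) \<le> e" if y: "y \<in> cball x (norm h)" for y
    proof -
      have *: "norm (grad \<phi> y - grad \<phi> x) < e"
        using d(2)[of "y - x" x] y h by (auto simp: dist_norm norm_minus_commute)
      show ?thesis
      proof (rule onorm_le)
        fix z
        have "norm (((\<bullet>) (grad \<phi> y) - (\<bullet>) (grad \<phi> x)) z) = \<bar>(grad \<phi> y - grad \<phi> x) \<bullet> z\<bar>"
          by (simp add: inner_diff_left)
        also have "\<dots> \<le> norm (grad \<phi> y - grad \<phi> x) * norm z" by (rule Cauchy_Schwarz_ineq2)
        also have "\<dots> \<le> e * norm z" using * by (intro mult_right_mono) auto
        finally show "norm (((\<bullet>) (grad \<phi> y) - (\<bullet>) (grad \<phi> x)) z) \<le> e * norm z" .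
      qed
    qed
  qed auto
  then show ?thesis using d(1) by (intro exI[of _ d]) (auto simp: mult.commute)
qed

lemma conv_integrable:
  fixes g :: "'a::euclidean_space \<Rightarrow> 'b::euclidean_space"
  assumes "continuous_on UNIV \<phi>" "\<And>x. x \<notin> cball 0 R \<Longrightarrow> \<phi> x = 0" "integrable lborel g"
  shows "integrable lborel (\<lambda>y. \<phi> (x - y) *\<^sub>R g y)"
proof -
  obtain B where B: "\<And>x. norm (\<phi> x) \<le> B" using bounded_compact_support[OF assms(1,2)] by auto
  have [measurable]: "\<phi> \<in> borel_measurable borel" by (rule borel_measurable_continuous_onI[OF assms(1)])
  show ?thesis
    by (rule integrable_bounded_scaleR[where B=B]) (use B assms(3) in auto)
qed

lemma conv_diff_bound:
  fixes g :: "'a::euclidean_space \<Rightarrow> 'b::euclidean_space"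
  assumes "\<And>y. \<bar>\<phi> y\<bar> \<le> e" "integrable lborel g" "integrable lborel (\<lambda>y. \<phi> y *\<^sub>R g y)"
  shows "norm (LBINT y. \<phi> y *\<^sub>R g y) \<le> e * (LBINT y. norm (g y))"
proof -
  have "norm (LBINT y. \<phi> y *\<^sub>R g y) \<le> (LBINT y. norm (\<phi> y *\<^sub>R g y))"
    by (rule integral_norm_bound)
  also have "\<dots> \<le> (LBINT y. e * norm (g y))"
    using assms by (intro integral_mono integrable_norm) (auto intro!: mult_right_mono)
  finally show ?thesis by simp
qed

lemma conv_continuous:
  fixes g :: "'a::euclidean_space \<Rightarrow> 'b::euclidean_space"
  assumes "continuous_on UNIV \<phi>" "\<And>x. x \<notin> cball 0 R \<Longrightarrow> \<phi> x = 0" "integrable lborel g"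
  shows "continuous_on UNIV (conv \<phi> g)"
proof -
  have "\<exists>d>0. \<forall>x'. dist x' x < d \<longrightarrow> dist (conv \<phi> g x') (conv \<phi> g x) \<le> e" if e: "e > 0" for x e
  proof -
    define G where "G = (LBINT y. norm (g y))"
    have G: "G \<ge> 0" by (auto simp: G_def)
    have "e / (G + 1) > 0" using e G by auto
    then obtain d where d: "d > 0" "\<And>x h. norm h < d \<Longrightarrow> norm (\<phi> (x + h) - \<phi> x) < e / (G + 1)"
      using uniformly_continuous_compact_support[OF assms(1,2)] by metis
    have "dist (conv \<phi> g x') (conv \<phi> g x) \<le> e" if x': "dist x' x < d" for x'
    proof -
      have i: "integrable lborel (\<lambda>y. \<phi> (z - y) *\<^sub>R g y)" for z
        by (rule conv_integrable[OF assms])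
      have "conv \<phi> g x' - conv \<phi> g x = (LBINT y. (\<phi> (x' - y) - \<phi> (x - y)) *\<^sub>R g y)"
        using i by (simp add: conv_def scaleR_diff_left)
      also have "norm \<dots> \<le> e / (G + 1) * G"
        unfolding G_def
      proof (rule conv_diff_bound)
        show "\<bar>\<phi> (x' - y) - \<phi> (x - y)\<bar> \<le> e / ((LBINT y. norm (g y)) + 1)" for y
          using d(2)[of "x' - x" "x - y"] x' by (auto simp: dist_norm G_def less_imp_le)
      qed (use Bochner_Integration.integrable_diff[OF i i] assms(3) in \<open>simp_all add: scaleR_diff_left\<close>)
      also have "\<dots> \<le> e" using e G by (simp add: field_simps)
      finally show ?thesis by (simp add: dist_norm)
    qed
    then show ?thesis using d(1) by blast
  qed
  then show ?thesis
    by (auto simp: continuous_on_eq_continuous_at continuous_at_eps_delta intro: le_less_trans dense)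
      (metis dense le_less_trans)
qed

text \<open>The Taylor remainder of the kernel is at most \<open>e / (G + 1) * norm h\<close> at
  every point, where \<open>G\<close> is the L1 norm of \<open>g\<close>; integrated against
  \<open>g\<close> it stays below \<open>e * norm h\<close>. No regularity of \<open>g\<close> is
  involved, all derivatives fall on the kernel.\<close>

lemma conv_has_derivative:
  fixes \<phi> :: "real^'N::finite \<Rightarrow> real" and g :: "real^'N \<Rightarrow> real"
  assumes \<phi>: "C1_fun \<phi>" and supp: "\<And>x. x \<notin> cball 0 R \<Longrightarrow> \<phi> x = 0" and g: "integrable lborel g"
  shows "(conv \<phi> g has_derivative (\<lambda>h. (\<chi> i. conv (partial_deriv i \<phi>) g x) \<bullet> h)) (at x)"
  unfolding has_derivative_at_alt
proof (intro conjI allI impI)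
  show "bounded_linear (\<lambda>h. (\<chi> i. conv (partial_deriv i \<phi>) g x) \<bullet> h)" by (rule bounded_linear_inner_right)
  fix e :: real assume e: "e > 0"
  define G where "G = (LBINT y. norm (g y))"
  have G: "G \<ge> 0" by (auto simp: G_def)
  have "e / (G + 1) > 0" using e G by auto
  then obtain d where d: "d > 0"
      "\<And>x h. norm h < d \<Longrightarrow> \<bar>\<phi> (x + h) - \<phi> x - grad \<phi> x \<bullet> h\<bar> \<le> e / (G + 1) * norm h"
    using uniform_taylor[OF \<phi> supp] by metis
  have supp': "partial_deriv i \<phi> x = 0" if "x \<notin> cball 0 R" for i x
    using partial_deriv_eq_0_outside(1)[of "cball 0 R" \<phi>] supp that by blast
  have "norm (conv \<phi> g x' - conv \<phi> g x - (\<chi> i. conv (partial_deriv i \<phi>) g x) \<bullet> (x' - x)) \<le> e * norm (x' - x)"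
    if x': "norm (x' - x) < d" for x'
  proof -
    have i: "integrable lborel (\<lambda>y. \<phi> (z - y) *\<^sub>R g y)" for z
      by (rule conv_integrable[OF C1_funD(4)[OF \<phi>] supp g])
    have ii: "integrable lborel (\<lambda>y. partial_deriv i \<phi> (x - y) *\<^sub>R g y)" for i
      by (rule conv_integrable[OF C1_funD(3)[OF \<phi>] supp' g])
    have eq: "(\<Sum>i\<in>UNIV. (partial_deriv i \<phi> (x - y) *\<^sub>R g y) * (x' - x) $ i) = (grad \<phi> (x - y) \<bullet> (x' - x)) *\<^sub>R g y" for y
      by (auto simp: grad_def inner_vec_def sum_distrib_left sum_distrib_right mult_ac intro!: sum.cong)
    have iii: "integrable lborel (\<lambda>y. (grad \<phi> (x - y) \<bullet> (x' - x)) *\<^sub>R g y)"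
      unfolding eq[symmetric] by (intro Bochner_Integration.integrable_sum integrable_mult_left impI ii)
    have "(\<chi> i. conv (partial_deriv i \<phi>) g x) \<bullet> (x' - x)
        = (\<Sum>i\<in>UNIV. (LBINT y. (partial_deriv i \<phi> (x - y) *\<^sub>R g y) * (x' - x) $ i))"
      using ii by (simp add: inner_vec_def conv_def)
    also have "\<dots> = (LBINT y. (\<Sum>i\<in>UNIV. (partial_deriv i \<phi> (x - y) *\<^sub>R g y) * (x' - x) $ i))"
      using ii by (intro Bochner_Integration.integral_sum[symmetric] integrable_mult_left) auto
    also have "\<dots> = (LBINT y. (grad \<phi> (x - y) \<bullet> (x' - x)) *\<^sub>R g y)"
      by (simp only: eq)
    finally have "conv \<phi> g x' - conv \<phi> g x - (\<chi> i. conv (partial_deriv i \<phi>) g x) \<bullet> (x' - x)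
        = (LBINT y. (\<phi> (x' - y) - \<phi> (x - y) - grad \<phi> (x - y) \<bullet> (x' - x)) *\<^sub>R g y)"
      using i iii by (simp add: conv_def left_diff_distrib)
    also have "norm \<dots> \<le> (e / (G + 1) * norm (x' - x)) * G"
      unfolding G_def
    proof (rule conv_diff_bound)
      show "\<bar>\<phi> (x' - y) - \<phi> (x - y) - grad \<phi> (x - y) \<bullet> (x' - x)\<bar> \<le> e / ((LBINT y. norm (g y)) + 1) * norm (x' - x)" for y
        using d(2)[of "x' - x" "x - y"] x' by (auto simp: G_def)
    qed (use Bochner_Integration.integrable_diff[OF Bochner_Integration.integrable_diff[OF i i] iii] g in \<open>simp_all add: left_diff_distrib\<close>)
    also have "\<dots> = e * norm (x' - x) * (G / (G + 1))" by simp
    also have "\<dots> \<le> e * norm (x' - x) * 1" using e G by (intro mult_left_mono) auto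
    finally show ?thesis by simp
  qed
  then show "\<exists>d>0. \<forall>x'. norm (x' - x) < d \<longrightarrow>
      norm (conv \<phi> g x' - conv \<phi> g x - (\<chi> i. conv (partial_deriv i \<phi>) g x) \<bullet> (x' - x)) \<le> e * norm (x' - x)"
    using d(1) by blast
qed

lemma conv_C1:
  fixes \<phi> :: "real^'N::finite \<Rightarrow> real" and g :: "real^'N \<Rightarrow> real"
  assumes \<phi>: "C1_fun \<phi>" and supp: "\<And>x. x \<notin> cball 0 R \<Longrightarrow> \<phi> x = 0" and g: "integrable lborel g"
  shows "C1_fun (conv \<phi> g)" "partial_deriv i (conv \<phi> g) = conv (partial_deriv i \<phi>) g"
proof -
  have "continuous_on UNIV (\<lambda>x. \<chi> i. conv (partial_deriv i \<phi>) g x)"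
    using partial_deriv_eq_0_outside(1)[of "cball 0 R" \<phi>] supp
    by (intro continuous_on_vec_lambda conv_continuous[OF C1_funD(3)[OF \<phi>] _ g, where R=R]) auto
  from C1_funI[OF conv_has_derivative[OF assms] this]
  show "C1_fun (conv \<phi> g)" "partial_deriv i (conv \<phi> g) = conv (partial_deriv i \<phi>) g" by auto
qed

text \<open>The partial derivatives of the kernel again vanish outside \<open>cball 0 R\<close>, so
  they are moved onto the kernel one after another.\<close>

lemma conv_Ck:
  fixes \<phi> :: "real^'N::finite \<Rightarrow> real" and g :: "real^'N \<Rightarrow> real"
  assumes "Ck_fun k \<phi>" "\<And>x. x \<notin> cball 0 R \<Longrightarrow> \<phi> x = 0" "integrable lborel g"
  shows "Ck_fun k (conv \<phi> g)"
  using assms(1,2)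
proof (induction k arbitrary: \<phi>)
  case 0
  then show ?case using conv_continuous[of \<phi> R g] assms(3) by auto
next
  case (Suc k)
  have c1: "C1_fun \<phi>" using Suc.prems(1) by (rule Ck_fun_C1)
  have "\<forall>x. conv \<phi> g differentiable (at x)"
    using conv_has_derivative[OF c1 Suc.prems(2) assms(3)] by (auto simp: differentiable_def)
  moreover have "Ck_fun k (conv (partial_deriv i \<phi>) g)" for i
    using Suc.prems(1) partial_deriv_eq_0_outside(1)[of "cball 0 R" \<phi>] Suc.prems(2) by (intro Suc.IH) auto
  ultimately show ?case using conv_C1(2)[OF c1 Suc.prems(2) assms(3)] by auto
qed

lemma Ck_fun_affine:
  fixes \<phi> :: "real^'N::finite \<Rightarrow> real"
  assumes "Ck_fun k \<phi>"
  shows "Ck_fun k (\<lambda>x. d * \<phi> (a + c *\<^sub>R x))"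
  using assms
proof (induction k arbitrary: \<phi> d)
  case 0
  then have "continuous_on UNIV \<phi>" by simp
  then have "continuous_on UNIV (\<lambda>x. \<phi> (a + c *\<^sub>R x))"
    by (rule continuous_on_compose2) (auto intro!: continuous_intros)
  then show ?case by (auto intro!: continuous_intros)
next
  case (Suc k)
  have "((\<lambda>x. d * \<phi> (a + c *\<^sub>R x)) has_derivative (\<lambda>h. ((d * c) *\<^sub>R grad \<phi> (a + c *\<^sub>R x)) \<bullet> h)) (at x)" for x
  proof -
    have "((\<lambda>x. \<phi> (a + c *\<^sub>R x)) has_derivative (\<lambda>h. grad \<phi> (a + c *\<^sub>R x) \<bullet> (c *\<^sub>R h))) (at x)"
      using Suc.prems by (intro has_derivative_compose[OF _ has_derivative_grad]) (auto intro!: derivative_eq_intros)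
    from has_derivative_mult_right[OF this, of d] show ?thesis by (simp add: mult.assoc)
  qed
  note d = this
  have "partial_deriv i (\<lambda>x. d * \<phi> (a + c *\<^sub>R x)) = (\<lambda>x. (d * c) * partial_deriv i \<phi> (a + c *\<^sub>R x))" for i
    using grad_unique(2)[OF d] by (auto simp: grad_def fun_eq_iff)
  moreover have "\<forall>x. (\<lambda>x. d * \<phi> (a + c *\<^sub>R x)) differentiable (at x)"
    unfolding differentiable_def using d by blast
  ultimately show ?case using Suc by auto
qed

lemma partial_deriv_affine:
  fixes \<phi> :: "real^'N::finite \<Rightarrow> real"
  assumes "C1_fun \<phi>"
  shows "partial_deriv i (\<lambda>x. d * \<phi> (a + c *\<^sub>R x)) x = d * c * partial_deriv i \<phi> (a + c *\<^sub>R x)"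
proof -
  have "((\<lambda>x. \<phi> (a + c *\<^sub>R x)) has_derivative (\<lambda>h. grad \<phi> (a + c *\<^sub>R x) \<bullet> (c *\<^sub>R h))) (at x)"
    using C1_funD(1)[OF assms] by (rule has_derivative_compose[rotated]) (auto intro!: derivative_eq_intros)
  from has_derivative_mult_right[OF this, of d]
  have "((\<lambda>x. d * \<phi> (a + c *\<^sub>R x)) has_derivative (\<lambda>h. ((d * c) *\<^sub>R grad \<phi> (a + c *\<^sub>R x)) \<bullet> h)) (at x)"
    by (simp add: mult.assoc)
  from grad_unique(2)[OF this] show ?thesis by (simp add: grad_def)
qed

subsection \<open>Mollifiers\<close>

text \<open>The powers of \<open>t\<close> in the denominator close the family under
  differentiation: the derivative of index \<open>n\<close> combines the indices
  \<open>n + 1\<close> and \<open>n + 2\<close>. Hence one differentiability proof yields smoothness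
  of the case \<open>n = 0\<close>, which is the standard flat function.\<close>

definition bump_profile :: "nat \<Rightarrow> real \<Rightarrow> real" where
  "bump_profile n t = (if t \<le> 0 then 0 else exp (- (1 / t)) / t ^ n)"

text \<open>In the variable \<open>s = 1 / t\<close> the right-hand limit is that of
  \<open>s ^ n / exp s\<close> at infinity.\<close>

lemma bump_profile_tendsto_0: "(bump_profile n \<longlongrightarrow> 0) (at 0)"
proof -
  have "((\<lambda>t. (1 / t) ^ n / exp (1 / t)) \<longlongrightarrow> (0::real)) (at_right 0)"
    by (rule filterlim_compose[OF tendsto_power_div_exp_0[of n]])
      (auto simp: filterlim_inverse_at_top_right simp flip: inverse_eq_divide)
  then have "(bump_profile n \<longlongrightarrow> 0) (at_right 0)"
    by (rule tendsto_cong[THEN iffD1, rotated])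
      (auto simp: eventually_at_right_less bump_profile_def exp_minus field_simps
        intro!: eventually_mono[OF eventually_at_right_less[of 0]])
  moreover have "(bump_profile n \<longlongrightarrow> 0) (at_left 0)"
    by (rule tendsto_cong[THEN iffD1, OF _ tendsto_const])
      (auto simp: bump_profile_def intro!: eventually_mono[OF eventually_at_left_real[of "-1" 0]])
  ultimately show ?thesis using filterlim_split_at by blast
qed

lemma bump_profile_deriv:
  "(bump_profile n has_real_derivative (bump_profile (n + 2) t - n * bump_profile (n + 1) t)) (at t)"
proof (cases t "0 :: real" rule: linorder_cases)
  case less
  have "((\<lambda>t. 0) has_real_derivative 0) (at t)" by simp
  then have "(bump_profile n has_real_derivative 0) (at t)"
    by (rule has_field_derivative_transform_within_open[where S="{..<0}"]) (use less in \<open>auto simp: bump_profile_def\<close>)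
  then show ?thesis using less by (simp add: bump_profile_def)
next
  case equal
  \<comment> \<open>The difference quotient of index \<open>n\<close> at 0 is the profile of index
    \<open>Suc n\<close>, whose limit is known.\<close>
  have "((\<lambda>y. (bump_profile n y - bump_profile n 0) / (y - 0)) \<longlongrightarrow> 0) (at 0)"
    by (rule tendsto_cong[THEN iffD2, OF _ bump_profile_tendsto_0[of "Suc n"]])
      (auto simp: bump_profile_def eventually_at_filter)
  then have "(bump_profile n has_real_derivative 0) (at 0)" by (simp add: has_field_derivative_iff)
  then show ?thesis using equal by (simp add: bump_profile_def)
next
  case greater
  have "((\<lambda>t. exp (- (1 / t)) / t ^ n) has_real_derivative (bump_profile (n + 2) t - n * bump_profile (n + 1) t)) (at t)"
  proof (cases n)
    case 0
    then show ?thesis using greater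
      by (auto intro!: derivative_eq_intros simp: bump_profile_def power2_eq_square field_simps)
  next
    case (Suc m)
    then show ?thesis using greater
      by (auto intro!: derivative_eq_intros simp: bump_profile_def field_simps) (cases m; simp)
  qed
  then show ?thesis
    by (rule has_field_derivative_transform_within_open[where S="{0<..}"])
      (use greater in \<open>auto simp: bump_profile_def\<close>)
qed

text \<open>An algebra of differentiable functions that contains the bump functions and is closed under
  partial derivatives; hence its members are smooth.\<close>

inductive bump_algebra :: "real \<Rightarrow> (real^'N::finite \<Rightarrow> real) \<Rightarrow> bool" for a where
  bump: "bump_algebra a (\<lambda>x. bump_profile n (a - x \<bullet> x))"
| const: "bump_algebra a (\<lambda>x. c)"
| coord: "bump_algebra a (\<lambda>x. x $ i)"
| add: "bump_algebra a f \<Longrightarrow> bump_algebra a g \<Longrightarrow> bump_algebra a (\<lambda>x. f x + g x)"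
| mult: "bump_algebra a f \<Longrightarrow> bump_algebra a g \<Longrightarrow> bump_algebra a (\<lambda>x. f x * g x)"

lemma bump_algebra_deriv:
  assumes "bump_algebra a f"
  shows "\<exists>D. (\<forall>x. (f has_derivative (\<lambda>h. D x \<bullet> h)) (at x)) \<and> (\<forall>i. bump_algebra a (\<lambda>x. D x $ i))"
  using assms
proof induction
  case (bump n)
  let ?D = "\<lambda>x :: real^'N. ((bump_profile (n + 2) (a - x \<bullet> x) + (- real n) * bump_profile (n + 1) (a - x \<bullet> x)) * (- 2)) *\<^sub>R x"
  have "((\<lambda>x. bump_profile n (a - x \<bullet> x)) has_derivative (\<lambda>h. ?D x \<bullet> h)) (at x)" for x :: "real^'N"
  proof -
    have "((\<lambda>x. a - x \<bullet> x) has_derivative (\<lambda>h. - 2 * (x \<bullet> h))) (at x)"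
      by (auto intro!: derivative_eq_intros simp: inner_commute)
    from has_derivative_compose[OF this bump_profile_deriv[of n "a - x \<bullet> x", unfolded has_field_derivative_def]]
    show ?thesis by (rule has_derivative_eq_rhs) (auto simp: algebra_simps)
  qed
  moreover have "bump_algebra a (\<lambda>x. ?D x $ i)" for i
    unfolding vector_scaleR_component real_scaleR_def
    by (intro bump_algebra.intros)
  ultimately show ?case by (intro exI[of _ ?D] conjI allI)
next
  case (const c)
  show ?case by (rule exI[of _ "\<lambda>x. 0"]) (auto intro: bump_algebra.const)
next
  case (coord i)
  have "((\<lambda>x. x $ i) has_derivative (\<lambda>h. axis i 1 \<bullet> h)) (at x)" for x
    using bounded_linear_imp_has_derivative[OF bounded_linear_vec_nth[of i], of "at x"]
    by (simp add: inner_axis inner_commute[of "axis _ _"])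
  then show ?case by (intro exI[of _ "\<lambda>x. axis i 1"]) (auto intro: bump_algebra.const)
next
  case (add f g)
  then obtain D E where DE: "\<And>x. (f has_derivative (\<lambda>h. D x \<bullet> h)) (at x)" "\<And>i. bump_algebra a (\<lambda>x. D x $ i)"
    "\<And>x. (g has_derivative (\<lambda>h. E x \<bullet> h)) (at x)" "\<And>i. bump_algebra a (\<lambda>x. E x $ i)" by blast
  show ?case
    by (intro exI[of _ "\<lambda>x. D x + E x"])
      (auto intro!: has_derivative_eq_rhs[OF has_derivative_add[OF DE(1,3)]] bump_algebra.add DE
        simp: inner_add_left)
next
  case (mult f g)
  then obtain D E where DE: "\<And>x. (f has_derivative (\<lambda>h. D x \<bullet> h)) (at x)" "\<And>i. bump_algebra a (\<lambda>x. D x $ i)"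
    "\<And>x. (g has_derivative (\<lambda>h. E x \<bullet> h)) (at x)" "\<And>i. bump_algebra a (\<lambda>x. E x $ i)" by blast
  show ?case
    by (intro exI[of _ "\<lambda>x. f x *\<^sub>R E x + g x *\<^sub>R D x"])
      (auto intro!: has_derivative_eq_rhs[OF has_derivative_mult[OF DE(1,3)]] bump_algebra.intros DE mult
        simp: inner_add_left mult_ac)
qed

lemma bump_algebra_Ck: "bump_algebra a f \<Longrightarrow> Ck_fun k f"
proof (induction k arbitrary: f)
  case 0
  then show ?case using bump_algebra_deriv[OF 0]
    by (auto simp: continuous_on_eq_continuous_at intro: has_derivative_continuous)
next
  case (Suc k)
  from bump_algebra_deriv[OF Suc.prems] obtain D where
    D: "\<And>x. (f has_derivative (\<lambda>h. D x \<bullet> h)) (at x)" "\<And>i. bump_algebra a (\<lambda>x. D x $ i)" by blast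
  then have "partial_deriv i f = (\<lambda>x. D x $ i)" for i using grad_unique(2)[OF D(1)] by auto
  then show ?case using D Suc.IH by (auto simp: differentiable_def)
qed

text \<open>A predicate rather than one rescaled kernel: approximation results hold for every
  mollifier of sufficiently small scale \<open>\<epsilon>\<close>, and existence at each scale
  suffices.\<close>

definition mollifier :: "real \<Rightarrow> (real^'N::finite \<Rightarrow> real) \<Rightarrow> bool" where
  "mollifier \<epsilon> \<rho> \<longleftrightarrow> (\<forall>k. Ck_fun k \<rho>) \<and> (\<forall>x. 0 \<le> \<rho> x) \<and> (\<forall>x. \<epsilon> \<le> norm x \<longrightarrow> \<rho> x = 0)
     \<and> integrable lborel \<rho> \<and> (LBINT x. \<rho> x) = 1"

lemma mollifier_exists:
  assumes "\<epsilon> > 0"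
  shows "\<exists>\<rho> :: real^'N::finite \<Rightarrow> real. mollifier \<epsilon> \<rho>"
proof -
  define b where "b = (\<lambda>x :: real^'N. bump_profile 0 (\<epsilon>\<^sup>2 - x \<bullet> x))"
  have alg: "bump_algebra (\<epsilon>\<^sup>2) b" unfolding b_def by (rule bump_algebra.bump)
  have cont: "continuous_on UNIV b" using bump_algebra_Ck[OF alg, of 0] by simp
  have nonneg: "b x \<ge> 0" for x by (auto simp: b_def bump_profile_def)
  have pos: "b x > 0" if "x \<in> ball 0 \<epsilon>" for x
    using that assms by (auto simp: b_def bump_profile_def dot_square_norm power_strict_mono)
  have zero: "b x = 0" if "\<epsilon> \<le> norm x" for x
    using that assms by (auto simp: b_def bump_profile_def dot_square_norm power_mono)
  have int: "integrable lborel b"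
    by (rule integrable_compact_support[OF cont, of \<epsilon>]) (auto intro: zero)
  \<comment> \<open>A vanishing integral would force \<open>b = 0\<close> almost everywhere,
    although \<open>b\<close> is positive on a ball of positive measure.\<close>
  have "(LBINT x. b x) \<noteq> 0"
  proof
    assume "(LBINT x. b x) = 0"
    then have "AE x in lborel. b x = 0"
      using integral_nonneg_eq_0_iff_AE[OF int] nonneg by auto
    then have "AE x in lborel. x \<notin> ball (0 :: real^'N) \<epsilon>" by (rule eventually_mono) (use pos in force)
    then have "emeasure lborel (ball (0 :: real^'N) \<epsilon>) = 0"
      by (subst (asm) AE_iff_measurable[of "ball 0 \<epsilon>"]) auto
    then show False using assms emeasure_lborel_ball_finite[of "0 :: real^'N" \<epsilon>]
      content_ball_pos[OF assms, of "0 :: real^'N"] by (simp add: measure_def)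
  qed
  then have I: "(LBINT x. b x) > 0"
    using Bochner_Integration.integral_nonneg[of lborel b] nonneg by (simp add: less_le)
  define \<rho> where "\<rho> = (\<lambda>x. (1 / (LBINT x. b x)) * b x)"
  have "bump_algebra (\<epsilon>\<^sup>2) \<rho>" unfolding \<rho>_def by (intro bump_algebra.mult bump_algebra.const alg)
  then have "mollifier \<epsilon> \<rho>"
    using bump_algebra_Ck I nonneg zero int by (auto simp: mollifier_def \<rho>_def)
  then show ?thesis by blast
qed

subsection \<open>Borel representatives\<close>

text \<open>The coordinates are replaced one by one; the finitely many exceptional null sets are
  united.\<close>

lemma lebesgue_borel_representative:
  fixes f :: "'a::euclidean_space \<Rightarrow> 'b::euclidean_space"
  assumes "f \<in> borel_measurable lebesgue"
  shows "\<exists>f'\<in>borel_measurable borel. AE x in lborel. f' x = f x"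
proof -
  have "\<exists>g\<in>borel_measurable lborel. AE x in lborel. f x \<bullet> b = g x" for b
    by (rule completion_ex_borel_measurable_real) (use assms in measurable)
  then have "\<forall>b. \<exists>g. g \<in> borel_measurable borel \<and> (AE x in lborel. f x \<bullet> b = g x)" by auto
  from choice[OF this] obtain g where g: "\<And>b. g b \<in> borel_measurable borel" "\<And>b. AE x in lborel. f x \<bullet> b = g b x"
    by blast
  have "AE x in lborel. \<forall>b\<in>Basis. f x \<bullet> b = g b x"
    by (intro AE_finite_allI g) auto
  then have "AE x in lborel. (\<Sum>b\<in>Basis. g b x *\<^sub>R b) = f x"
  proof eventually_elim
    case (elim x)
    then have "(\<Sum>b\<in>Basis. g b x *\<^sub>R b) = (\<Sum>b\<in>Basis. (f x \<bullet> b) *\<^sub>R b)" by (intro sum.cong) auto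
    then show ?case by (simp add: euclidean_representation)
  qed
  moreover have "(\<lambda>x. \<Sum>b\<in>Basis. g b x *\<^sub>R b) \<in> borel_measurable borel" using g(1) by measurable
  ultimately show ?thesis by (rule bexI)
qed

text \<open>Extension by zero turns a function on \<Omega> into a Borel function on the whole space.
  Translations and Tonelli are then carried out on \<open>lborel\<close>, with the domain visible
  only as an indicator.\<close>

lemma lebesgue_on_borel_representative:
  fixes f :: "'a::euclidean_space \<Rightarrow> 'b::euclidean_space"
  assumes f: "f \<in> borel_measurable (lebesgue_on \<Omega>)" and \<Omega>: "\<Omega> \<in> sets borel"
  obtains f' where "f' \<in> borel_measurable borel" "AE x in lborel. x \<in> \<Omega> \<longrightarrow> f' x = f x" "\<forall>x. x \<notin> \<Omega> \<longrightarrow> f' x = 0"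
proof -
  have "(\<lambda>x. indicator \<Omega> x *\<^sub>R f x) \<in> borel_measurable lebesgue"
    using f \<Omega> by (subst (asm) borel_measurable_restrict_space_iff) auto
  from lebesgue_borel_representative[OF this] obtain g
    where g: "g \<in> borel_measurable borel" "AE x in lborel. g x = indicator \<Omega> x *\<^sub>R f x" by blast
  show thesis
  proof (rule that[of "\<lambda>x. indicator \<Omega> x *\<^sub>R g x"])
    show "(\<lambda>x. indicator \<Omega> x *\<^sub>R g x) \<in> borel_measurable borel" using g \<Omega> by measurable
    show "AE x in lborel. x \<in> \<Omega> \<longrightarrow> indicator \<Omega> x *\<^sub>R g x = f x" using g(2) by eventually_elim auto
  qed auto
qed

lemma lebesgue_on_representative_measurable:
  fixes f :: "'a::euclidean_space \<Rightarrow> 'b::euclidean_space"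
  assumes "f' \<in> borel_measurable borel" "AE x in lborel. x \<in> \<Omega> \<longrightarrow> f' x = f x" "\<Omega> \<in> sets borel"
  shows "f \<in> borel_measurable (lebesgue_on \<Omega>)" "(\<lambda>x. indicator \<Omega> x *\<^sub>R f x) \<in> borel_measurable lebesgue"
proof -
  have "(\<lambda>x. indicator \<Omega> x *\<^sub>R f' x) \<in> borel_measurable lebesgue"
    using assms by (intro measurable_completion) simp
  moreover have "AE x in lebesgue. indicator \<Omega> x *\<^sub>R f' x = indicator \<Omega> x *\<^sub>R f x"
    using AE_completion[OF assms(2)] by eventually_elim (auto simp: indicator_def)
  ultimately show *: "(\<lambda>x. indicator \<Omega> x *\<^sub>R f x) \<in> borel_measurable lebesgue"
    by (rule borel_measurable_AE)
  then show "f \<in> borel_measurable (lebesgue_on \<Omega>)"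
    using assms(3) by (subst borel_measurable_restrict_space_iff) auto
qed

lemma lebesgue_on_integral_representative:
  fixes f :: "'a::euclidean_space \<Rightarrow> 'b::euclidean_space"
  assumes "f' \<in> borel_measurable borel" "AE x in lborel. x \<in> \<Omega> \<longrightarrow> f' x = f x" "\<Omega> \<in> sets borel"
  shows "integrable (lebesgue_on \<Omega>) f \<longleftrightarrow> integrable lborel (\<lambda>x. indicator \<Omega> x *\<^sub>R f' x)"
    and "(LINT x|lebesgue_on \<Omega>. f x) = (LBINT x. indicator \<Omega> x *\<^sub>R f' x)"
proof -
  have ae: "AE x in lebesgue. indicator \<Omega> x *\<^sub>R f x = indicator \<Omega> x *\<^sub>R f' x"
    using AE_completion[OF assms(2)] by eventually_elim (auto simp: indicator_def)
  have m: "(\<lambda>x. indicator \<Omega> x *\<^sub>R f' x) \<in> borel_measurable lebesgue"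
    using assms by (intro measurable_completion) simp
  have m': "(\<lambda>x. indicator \<Omega> x *\<^sub>R f' x) \<in> borel_measurable lborel" using assms by simp
  have "integrable (lebesgue_on \<Omega>) f \<longleftrightarrow> integrable lebesgue (\<lambda>x. indicator \<Omega> x *\<^sub>R f x)"
    using assms(3) by (subst integrable_restrict_space) auto
  also have "\<dots> \<longleftrightarrow> integrable lebesgue (\<lambda>x. indicator \<Omega> x *\<^sub>R f' x)"
    by (rule integrable_cong_AE[OF lebesgue_on_representative_measurable(2)[OF assms] m ae])
  also have "\<dots> \<longleftrightarrow> integrable lborel (\<lambda>x. indicator \<Omega> x *\<^sub>R f' x)"
    by (rule integrable_completion[OF m'])
  finally show "integrable (lebesgue_on \<Omega>) f \<longleftrightarrow> integrable lborel (\<lambda>x. indicator \<Omega> x *\<^sub>R f' x)" .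
  have "(LINT x|lebesgue_on \<Omega>. f x) = (LINT x|lebesgue. indicator \<Omega> x *\<^sub>R f x)"
    using assms(3) by (subst integral_restrict_space) auto
  also have "\<dots> = (LINT x|lebesgue. indicator \<Omega> x *\<^sub>R f' x)"
    by (rule integral_cong_AE[OF lebesgue_on_representative_measurable(2)[OF assms] m ae])
  also have "\<dots> = (LBINT x. indicator \<Omega> x *\<^sub>R f' x)" by (rule integral_completion[OF m'])
  finally show "(LINT x|lebesgue_on \<Omega>. f x) = (LBINT x. indicator \<Omega> x *\<^sub>R f' x)" .
qed

lemma integrable_lebesgue_on_representative:
  fixes f :: "'a::euclidean_space \<Rightarrow> 'b::euclidean_space"
  assumes f: "integrable (lebesgue_on \<Omega>) f" and \<Omega>: "\<Omega> \<in> sets borel"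
  obtains f' where "f' \<in> borel_measurable borel" "integrable lborel f'"
    "AE x in lborel. x \<in> \<Omega> \<longrightarrow> f' x = f x" "\<forall>x. x \<notin> \<Omega> \<longrightarrow> f' x = 0"
proof -
  obtain f' where f': "f' \<in> borel_measurable borel" "AE x in lborel. x \<in> \<Omega> \<longrightarrow> f' x = f x" "\<forall>x. x \<notin> \<Omega> \<longrightarrow> f' x = 0"
    using lebesgue_on_borel_representative[OF borel_measurable_integrable[OF f] \<Omega>] by blast
  moreover have "(\<lambda>x. indicator \<Omega> x *\<^sub>R f' x) = f'" using f'(3) by (auto simp: indicator_def fun_eq_iff)
  ultimately show thesis using lebesgue_on_integral_representative(1)[OF f'(1,2) \<Omega>] f that by auto
qed

lemma borel_measurable_vec_nth [measurable (raw)]: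
  fixes w :: "'a \<Rightarrow> ('b::euclidean_space)^'n::finite"
  assumes "w \<in> borel_measurable M"
  shows "(\<lambda>x. w x $ j) \<in> borel_measurable M"
  using assms by (rule measurable_compose)
    (intro borel_measurable_continuous_onI linear_continuous_on bounded_linear_vec_nth)

subsection \<open>Continuously differentiable maps\<close>

definition C1_map :: "(real^'N::finite \<Rightarrow> real^'n::finite) \<Rightarrow> (real^'N \<Rightarrow> real^'N^'n) \<Rightarrow> bool" where
  "C1_map w Dw \<longleftrightarrow> (\<forall>x. (w has_derivative (\<lambda>h. Dw x *v h)) (at x)) \<and> continuous_on UNIV Dw"

lemma matrix_vector_mult_nth: "(A *v h) $ j = A $ j \<bullet> h"
  by (simp add: matrix_vector_mult_def inner_vec_def)

lemma has_derivative_vec_nth_iff: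
  fixes w :: "'a::real_normed_vector \<Rightarrow> real^'n::finite"
  shows "(w has_derivative D) F \<longleftrightarrow> (\<forall>j. ((\<lambda>x. w x $ j) has_derivative (\<lambda>h. D h $ j)) F)"
proof
  assume "(w has_derivative D) F"
  then show "\<forall>j. ((\<lambda>x. w x $ j) has_derivative (\<lambda>h. D h $ j)) F"
    by (auto intro: bounded_linear.has_derivative[OF bounded_linear_vec_nth])
next
  assume *: "\<forall>j. ((\<lambda>x. w x $ j) has_derivative (\<lambda>h. D h $ j)) F"
  have "((\<lambda>x. \<Sum>j\<in>UNIV. (w x $ j) *\<^sub>R (axis j 1 :: real^'n)) has_derivative
      (\<lambda>h. \<Sum>j\<in>UNIV. (D h $ j) *\<^sub>R axis j 1)) F"
    using * by (intro has_derivative_sum) (auto intro: has_derivative_scaleR_left)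
  moreover have "(\<Sum>j\<in>UNIV. (v $ j) *\<^sub>R (axis j 1 :: real^'n)) = v" for v
    using basis_expansion[of v] by (simp add: scalar_mult_eq_scaleR)
  ultimately show "(w has_derivative D) F" by simp
qed

lemma C1_map_iff: "C1_map w Dw \<longleftrightarrow> (\<forall>j. C1_fun (\<lambda>x. w x $ j) \<and> grad (\<lambda>x. w x $ j) = (\<lambda>x. Dw x $ j))"
proof
  assume w: "C1_map w Dw"
  show "\<forall>j. C1_fun (\<lambda>x. w x $ j) \<and> grad (\<lambda>x. w x $ j) = (\<lambda>x. Dw x $ j)"
  proof
    fix j
    have d: "((\<lambda>x. w x $ j) has_derivative (\<lambda>h. Dw x $ j \<bullet> h)) (at x)" for x
      using w by (auto simp: C1_map_def has_derivative_vec_nth_iff[of w] matrix_vector_mult_nth)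
    have "continuous_on UNIV (\<lambda>x. Dw x $ j)" using w by (auto simp: C1_map_def intro!: continuous_intros)
    from C1_funI[OF d this] show "C1_fun (\<lambda>x. w x $ j) \<and> grad (\<lambda>x. w x $ j) = (\<lambda>x. Dw x $ j)" by auto
  qed
next
  assume *: "\<forall>j. C1_fun (\<lambda>x. w x $ j) \<and> grad (\<lambda>x. w x $ j) = (\<lambda>x. Dw x $ j)"
  have "continuous_on UNIV (\<lambda>x. \<chi> j. Dw x $ j)"
  proof (rule continuous_on_vec_lambda)
    show "continuous_on UNIV (\<lambda>x. Dw x $ j)" for j
      using * C1_funD(2)[of "\<lambda>x. w x $ j"] by simp
  qed
  moreover have "((\<lambda>x. w x $ j) has_derivative (\<lambda>h. Dw x $ j \<bullet> h)) (at x)" for j x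
    using C1_funD(1)[of "\<lambda>x. w x $ j" x] * by simp
  ultimately show "C1_map w Dw"
    by (auto simp: C1_map_def has_derivative_vec_nth_iff[of w] matrix_vector_mult_nth)
qed

lemma C1_map_continuous:
  assumes "C1_map w Dw"
  shows "continuous_on UNIV w" "continuous_on UNIV Dw"
  using assms by (auto simp: C1_map_def continuous_on_eq_continuous_at intro: has_derivative_continuous)

lemma norm_matrix_le_sum:
  fixes A :: "real^'N::finite^'n::finite"
  shows "norm A \<le> (\<Sum>j\<in>UNIV. \<Sum>i\<in>UNIV. \<bar>A $ j $ i\<bar>)"
proof -
  have "norm A \<le> (\<Sum>j\<in>UNIV. norm (A $ j))" unfolding norm_vec_def[of A] by (rule L2_set_le_sum) auto
  also have "\<dots> \<le> (\<Sum>j\<in>UNIV. \<Sum>i\<in>UNIV. \<bar>A $ j $ i\<bar>)" by (intro sum_mono norm_le_l1_cart)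
  finally show ?thesis .
qed

lemma norm_matrix_vector_mult_le:
  fixes A :: "real^'N::finite^'n::finite"
  shows "norm (A *v h) \<le> norm A * norm h"
proof -
  have "norm (A *v h) \<le> L2_set (\<lambda>j. norm (A $ j) * norm h) UNIV"
    unfolding norm_vec_def[of "A *v h"]
    by (rule L2_set_mono) (auto simp: matrix_vector_mult_nth Cauchy_Schwarz_ineq2)
  also have "\<dots> = norm A * norm h" by (simp add: norm_vec_def[of A] L2_set_left_distrib)
  finally show ?thesis .
qed

subsection \<open>Integration by parts and weak gradients\<close>

text \<open>No iterated integration: convolving \<psi> with the indicator of
  \<open>cball 0 (R + 1)\<close> gives, near 0, the constant \<integral>\<psi>, because the
  indicator is 1 on the support of the shifted kernel. Its derivative there is 0, and it is also the
  convolution of \<open>partial_deriv i \<psi>\<close> with the same indicator, that is, the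
  integral in question.\<close>

lemma integral_partial_deriv_eq_0:
  fixes \<psi> :: "real^'N::finite \<Rightarrow> real"
  assumes \<psi>: "C1_fun \<psi>" "\<And>x. x \<notin> cball 0 R \<Longrightarrow> \<psi> x = 0"
  shows "(LBINT x. partial_deriv i \<psi> x) = 0"
proof -
  define g :: "real^'N \<Rightarrow> real" where "g = indicator (cball 0 (R + 1))"
  have g: "integrable lborel g"
    using emeasure_compact_finite[of "cball 0 (R + 1) :: (real^'N) set"] by (simp add: g_def)
  have [measurable]: "\<psi> \<in> borel_measurable borel" "partial_deriv i \<psi> \<in> borel_measurable borel"
    by (rule borel_measurable_continuous_onI[OF C1_funD(4)[OF \<psi>(1)]]
        borel_measurable_continuous_onI[OF C1_funD(3)[OF \<psi>(1)]])+
  have const: "conv k g x = (LBINT y. k y)"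
    if "x \<in> ball 0 1" "k \<in> borel_measurable borel" "\<And>x. x \<notin> cball 0 R \<Longrightarrow> k x = 0" for x and k :: "real^'N \<Rightarrow> real"
  proof -
    have "k (x - y) *\<^sub>R g y = k (x - y)" for y
    proof (cases "y \<in> cball 0 (R + 1)")
      case False
      then have "x - y \<notin> cball 0 R" using that(1) norm_triangle_ineq4[of x "x - y"] by auto
      then show ?thesis using that(3) by simp
    qed (simp add: g_def)
    then have "conv k g x = (LBINT y. k (x - y))" unfolding conv_def by (rule Bochner_Integration.integral_cong[OF refl])
    also have "\<dots> = (LBINT y. k y)" by (rule integral_lborel_translate(2)) fact
    finally show ?thesis .
  qed
  have "((\<lambda>x. (LBINT y. \<psi> y)) has_derivative (\<lambda>h. (0 :: real^'N) \<bullet> h)) (at 0)" by simp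
  then have "(conv \<psi> g has_derivative (\<lambda>h. 0 \<bullet> h)) (at 0)"
    by (rule has_derivative_transform_within_open[where s="ball 0 1"]) (use const \<psi>(2) in auto)
  then have "partial_deriv i (conv \<psi> g) 0 = 0" using grad_unique(2) by fastforce
  then have "conv (partial_deriv i \<psi>) g 0 = 0" using conv_C1(2)[OF \<psi> g] by simp
  then show ?thesis
    using const[of 0 "partial_deriv i \<psi>"] partial_deriv_eq_0_outside(1)[of "cball 0 R" \<psi>] \<psi>(2) by auto
qed

text \<open>The product has bounded support as soon as one factor has, so the integral of its
  partial derivative vanishes; the product rule splits it.\<close>

lemma integration_by_parts:
  fixes \<phi> \<psi> :: "real^'N::finite \<Rightarrow> real"
  assumes \<phi>: "C1_fun \<phi>" and \<psi>: "C1_fun \<psi>" "\<And>x. x \<notin> cball 0 R \<Longrightarrow> \<psi> x = 0"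
  shows "(LBINT x. \<phi> x * partial_deriv i \<psi> x) = - (LBINT x. partial_deriv i \<phi> x * \<psi> x)"
proof -
  have d: "((\<lambda>x. \<phi> x * \<psi> x) has_derivative (\<lambda>h. (\<phi> x *\<^sub>R grad \<psi> x + \<psi> x *\<^sub>R grad \<phi> x) \<bullet> h)) (at x)" for x
    by (rule has_derivative_eq_rhs[OF has_derivative_mult[OF C1_funD(1)[OF \<phi>] C1_funD(1)[OF \<psi>(1)]]])
      (simp add: inner_add_left mult_ac)
  have "C1_fun (\<lambda>x. \<phi> x * \<psi> x)" and pd: "partial_deriv i (\<lambda>x. \<phi> x * \<psi> x) = (\<lambda>x. (\<phi> x *\<^sub>R grad \<psi> x + \<psi> x *\<^sub>R grad \<phi> x) $ i)"
    by (rule C1_funI[OF d], intro continuous_intros C1_funD \<phi> \<psi>)+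
  then have "0 = (LBINT x. (\<phi> x *\<^sub>R grad \<psi> x + \<psi> x *\<^sub>R grad \<phi> x) $ i)"
    using integral_partial_deriv_eq_0[of "\<lambda>x. \<phi> x * \<psi> x" R i] \<psi>(2) by simp
  also have "\<dots> = (LBINT x. \<phi> x * partial_deriv i \<psi> x + partial_deriv i \<phi> x * \<psi> x)"
    by (simp add: grad_def mult_ac)
  also have "\<dots> = (LBINT x. \<phi> x * partial_deriv i \<psi> x) + (LBINT x. partial_deriv i \<phi> x * \<psi> x)"
    by (intro Bochner_Integration.integral_add integrable_compact_support[where R=R]
        continuous_intros C1_funD \<phi> \<psi>)
      (use \<psi>(2) partial_deriv_eq_0_outside(1)[of "cball 0 R" \<psi>] in auto)
  finally show ?thesis by simp
qed

lemma test_functionsI: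
  assumes "\<And>k. Ck_fun k \<phi>" "\<And>x. x \<notin> K \<Longrightarrow> \<phi> x = 0" "compact K" "K \<subseteq> \<Omega>"
  shows "\<phi> \<in> test_functions \<Omega>"
proof -
  have "closure {x. \<phi> x \<noteq> 0} \<subseteq> K"
    using assms by (intro closure_minimal compact_imp_closed) auto
  moreover have "compact (closure {x. \<phi> x \<noteq> 0})"
    using bounded_subset[OF compact_imp_bounded[OF assms(3)] \<open>closure _ \<subseteq> K\<close>] by (simp add: compact_eq_bounded_closed)
  ultimately show ?thesis using assms by (auto simp: test_functions_def)
qed

lemma test_functionsD:
  assumes "\<phi> \<in> test_functions \<Omega>"
  shows "Ck_fun k \<phi>" "C1_fun \<phi>" "\<exists>R. \<forall>x. x \<notin> cball 0 R \<longrightarrow> \<phi> x = 0" "x \<notin> \<Omega> \<Longrightarrow> \<phi> x = 0"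
    "x \<notin> \<Omega> \<Longrightarrow> partial_deriv i \<phi> x = 0"
proof -
  show "Ck_fun k \<phi>" for k using assms by (simp add: test_functions_def)
  then show "C1_fun \<phi>" by (simp add: C1_fun_def del: Ck_fun.simps)
  let ?S = "closure {x. \<phi> x \<noteq> 0}"
  have S: "compact ?S" "?S \<subseteq> \<Omega>" using assms by (auto simp: test_functions_def)
  have z: "\<phi> x = 0" if "x \<notin> ?S" for x using that closure_subset by force
  obtain R where "?S \<subseteq> cball 0 R" using bounded_subset_ballD[OF compact_imp_bounded[OF S(1)], of 0] ball_subset_cball by blast
  then show "\<exists>R. \<forall>x. x \<notin> cball 0 R \<longrightarrow> \<phi> x = 0" using z by blast
  show "x \<notin> \<Omega> \<Longrightarrow> \<phi> x = 0" using z S by blast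
  assume "x \<notin> \<Omega>"
  then have x: "x \<notin> ?S" using S(2) by blast
  show "partial_deriv i \<phi> x = 0"
    by (rule partial_deriv_eq_0_outside(1)[where S="?S" and \<phi>=\<phi>, OF closed_closure _ x]) (rule z)
qed

lemma integral_lebesgue_on_eq_lborel:
  fixes f :: "'a::euclidean_space \<Rightarrow> 'b::euclidean_space"
  assumes "f \<in> borel_measurable borel" "\<Omega> \<in> sets borel" "\<And>x. x \<notin> \<Omega> \<Longrightarrow> f x = 0"
  shows "(LINT x|lebesgue_on \<Omega>. f x) = (LBINT x. f x)"
    "integrable (lebesgue_on \<Omega>) f \<longleftrightarrow> integrable lborel f"
proof -
  have "(\<lambda>x. indicator \<Omega> x *\<^sub>R f x) = f" using assms(3) by (auto simp: indicator_def fun_eq_iff)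
  then show "(LINT x|lebesgue_on \<Omega>. f x) = (LBINT x. f x)"
    "integrable (lebesgue_on \<Omega>) f \<longleftrightarrow> integrable lborel f"
    using lebesgue_on_integral_representative[OF assms(1) _ assms(2), of f] by auto
qed

lemma continuous_locally_integrable:
  fixes w :: "'a::euclidean_space \<Rightarrow> 'b::euclidean_space"
  assumes "continuous_on UNIV w"
  shows "locally_integrable_on w \<Omega>"
proof -
  have "integrable (lebesgue_on K) w" if "compact K" for K
    using borel_integrable_compact[OF that continuous_on_subset[OF assms, of K]] that
      lebesgue_on_integral_representative(1)[of w K w] borel_measurable_continuous_onI[OF assms]
    by (auto simp: borel_compact)
  then show ?thesis by (auto simp: locally_integrable_on_def)
qed

lemma C1_map_has_weak_gradient:
  assumes w: "C1_map w Dw" and \<Omega>: "open \<Omega>"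
  shows "has_weak_gradient \<Omega> w Dw"
  unfolding has_weak_gradient_def
proof (intro conjI ballI allI continuous_locally_integrable C1_map_continuous[OF w])
  fix \<phi> i j assume \<phi>: "\<phi> \<in> test_functions \<Omega>"
  have wj: "C1_fun (\<lambda>x. w x $ j)" "grad (\<lambda>x. w x $ j) = (\<lambda>x. Dw x $ j)" using w C1_map_iff by auto
  then have pd: "partial_deriv i (\<lambda>x. w x $ j) x = Dw x $ j $ i" for x
    by (metis grad_def vec_lambda_beta)
  note t = test_functionsD[OF \<phi>]
  obtain R where R: "\<And>x. x \<notin> cball 0 R \<Longrightarrow> \<phi> x = 0" using t(3) by blast
  have [measurable]: "w \<in> borel_measurable borel" "Dw \<in> borel_measurable borel"
      "\<phi> \<in> borel_measurable borel" "partial_deriv i \<phi> \<in> borel_measurable borel"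
    by (intro borel_measurable_continuous_onI C1_map_continuous[OF w] C1_funD t)+
  show "(LINT x|lebesgue_on \<Omega>. w x $ j * partial_deriv i \<phi> x) = - (LINT x|lebesgue_on \<Omega>. Dw x $ j $ i * \<phi> x)"
    using integration_by_parts[OF wj(1) t(2) R, where i=i] \<Omega> t(4,5)
    by (subst (1 2) integral_lebesgue_on_eq_lborel) (simp_all add: pd)
qed

text \<open>A function with a weak gradient is only locally integrable. Cutting it down to a set
  \<open>S\<close> on which it is integrable gives functions on the whole space, and the defining
  identity survives for those test functions that vanish off \<open>S\<close> together with their
  derivatives. Used with \<open>S\<close> compact, and with \<open>S = \<Omega>\<close> for
  W11.\<close>

lemma has_weak_gradient_local_representative:
  fixes u :: "real^'N::finite \<Rightarrow> real^'n::finite"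
  assumes h: "has_weak_gradient \<Omega> u G" and \<Omega>: "open \<Omega>"
    and S: "S \<in> sets borel" "S \<subseteq> \<Omega>" "integrable (lebesgue_on S) u" "integrable (lebesgue_on S) G"
  obtains U V where "U \<in> borel_measurable borel" "V \<in> borel_measurable borel"
    "integrable lborel U" "integrable lborel V"
    "AE x in lborel. x \<in> S \<longrightarrow> U x = u x" "AE x in lborel. x \<in> S \<longrightarrow> V x = G x"
    "\<forall>x. x \<notin> S \<longrightarrow> U x = 0" "\<forall>x. x \<notin> S \<longrightarrow> V x = 0"
    "\<forall>\<phi> i j. \<phi> \<in> test_functions \<Omega> \<longrightarrow> (\<forall>x. x \<notin> S \<longrightarrow> \<phi> x = 0 \<and> partial_deriv i \<phi> x = 0) \<longrightarrow>
      (LBINT x. U x $ j * partial_deriv i \<phi> x) = - (LBINT x. V x $ j $ i * \<phi> x)"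
proof -
  obtain U where U: "U \<in> borel_measurable borel" "integrable lborel U" "AE x in lborel. x \<in> S \<longrightarrow> U x = u x" "\<forall>x. x \<notin> S \<longrightarrow> U x = 0"
    using integrable_lebesgue_on_representative[OF S(3,1)] .
  obtain V where V: "V \<in> borel_measurable borel" "integrable lborel V" "AE x in lborel. x \<in> S \<longrightarrow> V x = G x" "\<forall>x. x \<notin> S \<longrightarrow> V x = 0"
    using integrable_lebesgue_on_representative[OF S(4,1)] .
  have "(LBINT x. U x $ j * partial_deriv i \<phi> x) = - (LBINT x. V x $ j $ i * \<phi> x)"
    if \<phi>: "\<phi> \<in> test_functions \<Omega>" and z: "\<And>x. x \<notin> S \<Longrightarrow> \<phi> x = 0 \<and> partial_deriv i \<phi> x = 0" for \<phi> i j
  proof -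
    note [measurable] = U(1) V(1)
    have [measurable]: "\<phi> \<in> borel_measurable borel" "partial_deriv i \<phi> \<in> borel_measurable borel"
      by (intro borel_measurable_continuous_onI C1_funD test_functionsD(2)[OF \<phi>])+
    have "(LINT x|lebesgue_on \<Omega>. u x $ j * partial_deriv i \<phi> x)
        = (LBINT x. indicator \<Omega> x *\<^sub>R (U x $ j * partial_deriv i \<phi> x))"
    proof (rule lebesgue_on_integral_representative(2))
      show "AE x in lborel. x \<in> \<Omega> \<longrightarrow> U x $ j * partial_deriv i \<phi> x = u x $ j * partial_deriv i \<phi> x"
        using U(3) by eventually_elim (use z in auto)
    qed (use \<Omega> in auto)
    also have "(\<lambda>x. indicator \<Omega> x *\<^sub>R (U x $ j * partial_deriv i \<phi> x)) = (\<lambda>x. U x $ j * partial_deriv i \<phi> x)"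
      using U(4) S(2) by (auto simp: fun_eq_iff indicator_def)
    finally have 1: "(LINT x|lebesgue_on \<Omega>. u x $ j * partial_deriv i \<phi> x) = (LBINT x. U x $ j * partial_deriv i \<phi> x)" .
    have "(LINT x|lebesgue_on \<Omega>. G x $ j $ i * \<phi> x)
        = (LBINT x. indicator \<Omega> x *\<^sub>R (V x $ j $ i * \<phi> x))"
    proof (rule lebesgue_on_integral_representative(2))
      show "AE x in lborel. x \<in> \<Omega> \<longrightarrow> V x $ j $ i * \<phi> x = G x $ j $ i * \<phi> x"
        using V(3) by eventually_elim (use z in auto)
    qed (use \<Omega> in auto)
    also have "(\<lambda>x. indicator \<Omega> x *\<^sub>R (V x $ j $ i * \<phi> x)) = (\<lambda>x. V x $ j $ i * \<phi> x)"
      using V(4) S(2) by (auto simp: fun_eq_iff indicator_def)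
    finally have 2: "(LINT x|lebesgue_on \<Omega>. G x $ j $ i * \<phi> x) = (LBINT x. V x $ j $ i * \<phi> x)" .
    show ?thesis using h \<phi> 1 2 by (auto simp: has_weak_gradient_def)
  qed
  then show thesis using that U V by blast
qed

lemma mollifier_bounded:
  assumes "mollifier \<epsilon> \<rho>"
  shows "\<exists>B. \<forall>x. \<rho> x \<le> B"
proof -
  have "continuous_on UNIV \<rho>" "\<And>x. x \<notin> cball 0 \<epsilon> \<Longrightarrow> \<rho> x = 0"
    using assms Ck_fun_continuous[of 0 \<rho>] by (auto simp: mollifier_def)
  from bounded_compact_support[OF this] show ?thesis by (metis abs_le_D1 real_norm_def)
qed

lemma mollify_L1:
  fixes g :: "real^'N::finite \<Rightarrow> 'b::euclidean_space"
  assumes g: "integrable lborel g" and e: "e > 0"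
  shows "\<exists>d>0. \<forall>\<epsilon> \<rho>. \<epsilon> \<le> d \<and> mollifier \<epsilon> \<rho> \<longrightarrow>
    conv \<rho> g \<in> borel_measurable borel \<and> (\<integral>\<^sup>+x. norm (conv \<rho> g x - g x) \<partial>lborel) \<le> ennreal e"
proof -
  obtain d where d: "d > 0" "\<And>h. norm h < d \<Longrightarrow> (LBINT x. norm (g (x + h) - g x)) < e"
    using L1_translation_continuous[OF g e] by blast
  have "conv \<rho> g \<in> borel_measurable borel \<and> (\<integral>\<^sup>+x. norm (conv \<rho> g x - g x) \<partial>lborel) \<le> ennreal e"
    if \<epsilon>: "\<epsilon> \<le> d" and \<rho>: "mollifier \<epsilon> \<rho>" for \<epsilon> \<rho>
  proof -
    obtain B where B: "\<And>x. \<rho> x \<le> B" using mollifier_bounded[OF \<rho>] by blast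
    have "(LBINT x. norm (g (x + h) - g x)) \<le> e" if "norm h < \<epsilon>" for h
      using d(2)[of h] that \<epsilon> by auto
    then show ?thesis using L1_mollify[OF g _ _ _ B, where d=\<epsilon> and e=e] \<rho> by (auto simp: mollifier_def)
  qed
  then show ?thesis using d(1) by blast
qed

lemma mollifier_test_function:
  assumes \<rho>: "mollifier \<epsilon> \<rho>" and "cball x \<epsilon> \<subseteq> \<Omega>"
  shows "(\<lambda>y. \<rho> (x - y)) \<in> test_functions \<Omega>"
    "y \<notin> cball x \<epsilon> \<Longrightarrow> \<rho> (x - y) = 0"
    "partial_deriv i (\<lambda>y. \<rho> (x - y)) y = - partial_deriv i \<rho> (x - y)"
    "y \<notin> cball x \<epsilon> \<Longrightarrow> partial_deriv i (\<lambda>y. \<rho> (x - y)) y = 0"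
proof -
  have Ck: "Ck_fun k (\<lambda>y. \<rho> (x - y))" for k
    using Ck_fun_affine[of k \<rho> 1 x "-1"] \<rho> by (simp add: mollifier_def)
  show z: "\<rho> (x - y) = 0" if "y \<notin> cball x \<epsilon>" for y
    using \<rho> that by (auto simp: mollifier_def dist_norm)
  show "(\<lambda>y. \<rho> (x - y)) \<in> test_functions \<Omega>"
    by (rule test_functionsI[OF Ck z]) (use assms in auto)
  have "C1_fun \<rho>" using \<rho> Ck_fun_C1[of 0 \<rho>] by (auto simp only: mollifier_def)
  then show "partial_deriv i (\<lambda>y. \<rho> (x - y)) y = - partial_deriv i \<rho> (x - y)"
    using partial_deriv_affine[of \<rho> i 1 x "-1" y] by simp
  show "y \<notin> cball x \<epsilon> \<Longrightarrow> partial_deriv i (\<lambda>y. \<rho> (x - y)) y = 0"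
    using partial_deriv_eq_0_outside(1)[of "cball x \<epsilon>" "\<lambda>y. \<rho> (x - y)"] z by auto
qed

text \<open>Vanishing against the shifted mollifiers says that \<open>conv \<rho> g = 0\<close> on
  \<open>K\<close>. Since \<open>conv \<rho> g\<close> is L1-close to \<open>g\<close>, the integral
  of the modulus of \<open>g\<close> over \<open>K\<close> is below every
  \<open>e > 0\<close>.\<close>

lemma fundamental_lemma:
  fixes g :: "real^'N::finite \<Rightarrow> real"
  assumes g: "integrable lborel g" and d: "d > 0" and K: "K \<in> sets borel"
    and zero: "\<And>x \<epsilon> \<rho>. x \<in> K \<Longrightarrow> \<epsilon> \<le> d \<Longrightarrow> mollifier \<epsilon> \<rho> \<Longrightarrow> (LBINT y. g y * \<rho> (x - y)) = 0"
  shows "AE x in lborel. x \<in> K \<longrightarrow> g x = 0"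
proof -
  have [measurable]: "g \<in> borel_measurable borel" "K \<in> sets borel" using borel_measurable_integrable[OF g] K by auto
  have "(\<integral>\<^sup>+x. indicator K x * ennreal (norm (g x)) \<partial>lborel) \<le> 0 + ennreal e" if e: "e > 0" for e
  proof -
    obtain \<delta> where \<delta>: "\<delta> > 0" "\<And>\<epsilon> \<rho>. \<epsilon> \<le> \<delta> \<Longrightarrow> mollifier \<epsilon> \<rho> \<Longrightarrow> (\<integral>\<^sup>+x. norm (conv \<rho> g x - g x) \<partial>lborel) \<le> ennreal e"
      using mollify_L1[OF g e] by blast
    obtain \<rho> :: "real^'N \<Rightarrow> real" where \<rho>: "mollifier (min \<delta> d) \<rho>" using mollifier_exists[of "min \<delta> d"] \<delta>(1) d by auto
    have "conv \<rho> g x = 0" if "x \<in> K" for x using zero[OF that _ \<rho>] by (simp add: conv_def mult.commute)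
    then have "(\<integral>\<^sup>+x. indicator K x * ennreal (norm (g x)) \<partial>lborel) \<le> (\<integral>\<^sup>+x. norm (conv \<rho> g x - g x) \<partial>lborel)"
      by (intro nn_integral_mono) (auto simp: indicator_def)
    also have "\<dots> \<le> ennreal e" using \<delta>(2)[OF _ \<rho>] by simp
    finally show ?thesis by simp
  qed
  then have "(\<integral>\<^sup>+x. indicator K x * ennreal (norm (g x)) \<partial>lborel) \<le> 0" by (rule ennreal_le_epsilon)
  then have "AE x in lborel. indicator K x * ennreal (norm (g x)) = 0"
    by (subst (asm) le_zero_eq, subst (asm) nn_integral_0_iff_AE) auto
  then show ?thesis by eventually_elim (auto simp: indicator_def)
qed

lemma compact_cball_nbhd:
  fixes K :: "'a::euclidean_space set"
  assumes "compact K" "open \<Omega>" "K \<subseteq> \<Omega>"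
  obtains d where "d > 0" "compact (\<Union>x\<in>K. cball x d)" "(\<Union>x\<in>K. cball x d) \<subseteq> \<Omega>"
proof -
  obtain e where e: "e > 0" "(\<Union>x\<in>K. cball x e) \<subseteq> \<Omega>"
    using compact_subset_open_imp_cball_epsilon_subset[OF assms] by blast
  have "(\<Union>x\<in>K. cball x e) = {x + y |x y. x \<in> K \<and> y \<in> cball 0 e}"
    by (auto simp: dist_norm) (metis add.commute diff_add_cancel norm_minus_commute)
  then show thesis using that[of e] e compact_sums[OF assms(1) compact_cball, of 0 e] by simp
qed

lemma compact_exhaustion:
  fixes \<Omega> :: "'a::euclidean_space set"
  assumes "open \<Omega>"
  shows "\<exists>C :: nat \<Rightarrow> 'a set. (\<forall>n. compact (C n)) \<and> (\<forall>n. C n \<subseteq> \<Omega>) \<and> (\<forall>n. C n \<subseteq> C (Suc n)) \<and> \<Union>(range C) = \<Omega>"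
proof (rule open_Union_compact_subsets[OF assms])
  fix C :: "nat \<Rightarrow> 'a set"
  assume C: "\<And>n. compact (C n)" "\<And>n. C n \<subseteq> \<Omega>" "\<And>n. C n \<subseteq> interior (C (Suc n))" "\<Union>(range C) = \<Omega>"
  have "C n \<subseteq> C (Suc n)" for n using C(3)[of n] interior_subset by blast
  then show ?thesis using C(1,2,4) by (intro exI[of _ C]) simp
qed

text \<open>\<open>weak_gradient\<close> is a choice, so every statement on it passes through this
  lemma. On a compact \<open>K\<close> the fundamental lemma applies, because for
  \<open>\<epsilon> \<le> d\<close> the kernels centred in \<open>K\<close> live in the compact
  neighbourhood \<open>S\<close>, where everything is integrable. An exhaustion by compact sets
  combines the null sets.\<close>

lemma weak_gradient_unique:
  fixes u :: "real^'N::finite \<Rightarrow> real^'n::finite"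
  assumes 1: "has_weak_gradient \<Omega> u G" and 2: "has_weak_gradient \<Omega> u H" and \<Omega>: "open \<Omega>"
  shows "AE x in lborel. x \<in> \<Omega> \<longrightarrow> G x = H x"
proof -
  have K: "AE x in lborel. x \<in> K \<longrightarrow> G x = H x" if K: "compact K" "K \<subseteq> \<Omega>" for K
  proof -
    obtain d where d: "d > 0" "compact (\<Union>x\<in>K. cball x d)" "(\<Union>x\<in>K. cball x d) \<subseteq> \<Omega>"
      using compact_cball_nbhd[OF K(1) \<Omega> K(2)] .
    define S where "S = (\<Union>x\<in>K. cball x d)"
    have S: "S \<in> sets borel" "S \<subseteq> \<Omega>" "integrable (lebesgue_on S) u" "integrable (lebesgue_on S) G" "integrable (lebesgue_on S) H"
      using 1 2 d by (auto simp: S_def has_weak_gradient_def locally_integrable_on_def borel_compact)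
    obtain U G' where G: "U \<in> borel_measurable borel" "G' \<in> borel_measurable borel" "integrable lborel U" "integrable lborel G'"
      "AE x in lborel. x \<in> S \<longrightarrow> U x = u x" "AE x in lborel. x \<in> S \<longrightarrow> G' x = G x"
      "\<forall>x. x \<notin> S \<longrightarrow> U x = 0" "\<forall>x. x \<notin> S \<longrightarrow> G' x = 0"
      "\<forall>\<phi> i j. \<phi> \<in> test_functions \<Omega> \<longrightarrow> (\<forall>x. x \<notin> S \<longrightarrow> \<phi> x = 0 \<and> partial_deriv i \<phi> x = 0) \<longrightarrow>
        (LBINT x. U x $ j * partial_deriv i \<phi> x) = - (LBINT x. G' x $ j $ i * \<phi> x)"
      using has_weak_gradient_local_representative[OF 1 \<Omega> S(1-4)] .
    obtain V H' where H: "V \<in> borel_measurable borel" "H' \<in> borel_measurable borel" "integrable lborel V" "integrable lborel H'"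
      "AE x in lborel. x \<in> S \<longrightarrow> V x = u x" "AE x in lborel. x \<in> S \<longrightarrow> H' x = H x"
      "\<forall>x. x \<notin> S \<longrightarrow> V x = 0" "\<forall>x. x \<notin> S \<longrightarrow> H' x = 0"
      "\<forall>\<phi> i j. \<phi> \<in> test_functions \<Omega> \<longrightarrow> (\<forall>x. x \<notin> S \<longrightarrow> \<phi> x = 0 \<and> partial_deriv i \<phi> x = 0) \<longrightarrow>
        (LBINT x. V x $ j * partial_deriv i \<phi> x) = - (LBINT x. H' x $ j $ i * \<phi> x)"
      using has_weak_gradient_local_representative[OF 2 \<Omega> S(1-3) S(5)] .
    note [measurable] = G(1,2) H(1,2)
    have UV: "AE x in lborel. U x = V x" using G(5) H(5) by eventually_elim (use G(7) H(7) in force)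
    have "AE x in lborel. x \<in> K \<longrightarrow> G' x $ j $ i - H' x $ j $ i = 0" for i j
    proof (rule fundamental_lemma[OF _ d(1)])
      have i: "integrable lborel (\<lambda>x. G' x $ j $ i)" "integrable lborel (\<lambda>x. H' x $ j $ i)"
        by (intro integrable_bounded_linear[OF bounded_linear_vec_nth] G H)+
      then show "integrable lborel (\<lambda>x. G' x $ j $ i - H' x $ j $ i)" by simp
      show "K \<in> sets borel" using K by (simp add: borel_compact)
      fix x \<epsilon> and \<rho> :: "real^'N \<Rightarrow> real" assume x: "x \<in> K" "\<epsilon> \<le> d" and \<rho>: "mollifier \<epsilon> \<rho>"
      have sub: "cball x \<epsilon> \<subseteq> S" using x by (force simp: S_def)
      note t = mollifier_test_function[OF \<rho> order.trans[OF sub S(2)]]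
      obtain B where B: "\<And>x. \<rho> x \<le> B" using mollifier_bounded[OF \<rho>] by blast
      have \<rho>m: "\<rho> \<in> borel_measurable borel" "\<And>x. 0 \<le> \<rho> x"
        using \<rho> borel_measurable_integrable[of lborel \<rho>] by (auto simp: mollifier_def)
      have ir: "integrable lborel (\<lambda>y. g y * \<rho> (x - y))" if "integrable lborel g" for g :: "real^'N \<Rightarrow> real"
        using integrable_bounded_scaleR[OF that, of "\<lambda>y. \<rho> (x - y)" B] B \<rho>m by (simp add: mult.commute)
      have "(LBINT y. U y $ j * partial_deriv i (\<lambda>y. \<rho> (x - y)) y) = - (LBINT y. G' y $ j $ i * \<rho> (x - y))"
        by (rule G(9)[rule_format, OF t(1)]) (use t sub in blast)
      moreover have "(LBINT y. V y $ j * partial_deriv i (\<lambda>y. \<rho> (x - y)) y) = - (LBINT y. H' y $ j $ i * \<rho> (x - y))"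
        by (rule H(9)[rule_format, OF t(1)]) (use t sub in blast)
      moreover have "(LBINT y. U y $ j * partial_deriv i (\<lambda>y. \<rho> (x - y)) y) = (LBINT y. V y $ j * partial_deriv i (\<lambda>y. \<rho> (x - y)) y)"
      proof (rule integral_cong_AE)
        have [measurable]: "partial_deriv i (\<lambda>y. \<rho> (x - y)) \<in> borel_measurable borel"
          by (intro borel_measurable_continuous_onI C1_funD test_functionsD(2)[OF t(1)])
        show "(\<lambda>y. U y $ j * partial_deriv i (\<lambda>y. \<rho> (x - y)) y) \<in> borel_measurable lborel"
          "(\<lambda>y. V y $ j * partial_deriv i (\<lambda>y. \<rho> (x - y)) y) \<in> borel_measurable lborel" by measurable
      qed (use UV in auto)
      ultimately show "(LBINT y. (G' y $ j $ i - H' y $ j $ i) * \<rho> (x - y)) = 0"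
        using ir[OF i(1)] ir[OF i(2)] by (simp add: left_diff_distrib)
    qed
    then have "AE x in lborel. \<forall>i\<in>UNIV. \<forall>j\<in>UNIV. x \<in> K \<longrightarrow> G' x $ j $ i - H' x $ j $ i = 0"
      by (intro AE_finite_allI) auto
    then show ?thesis using G(6) H(6)
    proof eventually_elim
      case (elim x)
      have "K \<subseteq> S" using d(1) by (force simp: S_def)
      then show ?case using elim by (auto simp: vec_eq_iff)
    qed
  qed
  obtain C :: "nat \<Rightarrow> (real^'N) set" where C: "\<And>n. compact (C n)" "\<And>n. C n \<subseteq> \<Omega>" "\<Union>(range C) = \<Omega>"
    using compact_exhaustion[OF \<Omega>] by blast
  have "AE x in lborel. \<forall>n :: nat. x \<in> C n \<longrightarrow> G x = H x" unfolding AE_all_countable using K[OF C(1,2)] by blast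
  then show ?thesis by eventually_elim (use C(3) in auto)
qed

subsection \<open>The convex-quasiconvexity inequality on balls\<close>

definition grad_matrix :: "(real^'N::finite \<Rightarrow> real^'n::finite) \<Rightarrow> real^'N \<Rightarrow> real^'N^'n" where
  "grad_matrix w x = (\<chi> j. grad (\<lambda>x. w x $ j) x)"

lemma C1_map_grad_matrix: "(\<And>j. C1_fun (\<lambda>x. w x $ j)) \<Longrightarrow> C1_map w (grad_matrix w)"
  by (auto simp: C1_map_iff grad_matrix_def)

lemma vector_test_function_C1:
  assumes "\<phi> \<in> vector_test_functions \<Omega>"
  shows "C1_map \<phi> (grad_matrix \<phi>)" "x \<notin> \<Omega> \<Longrightarrow> \<phi> x = 0" "x \<notin> \<Omega> \<Longrightarrow> grad_matrix \<phi> x = 0"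
    "\<exists>R. \<forall>x. x \<notin> cball 0 R \<longrightarrow> \<phi> x = 0 \<and> grad_matrix \<phi> x = 0"
proof -
  have t: "(\<lambda>x. \<phi> x $ j) \<in> test_functions \<Omega>" for j using assms by (simp add: vector_test_functions_def)
  show "C1_map \<phi> (grad_matrix \<phi>)" by (rule C1_map_grad_matrix) (rule test_functionsD(2)[OF t])
  show "x \<notin> \<Omega> \<Longrightarrow> \<phi> x = 0" "x \<notin> \<Omega> \<Longrightarrow> grad_matrix \<phi> x = 0"
    using test_functionsD(4,5)[OF t] by (auto simp: vec_eq_iff grad_matrix_def grad_def)
  have "\<forall>j. \<exists>R. \<forall>x. x \<notin> cball 0 R \<longrightarrow> \<phi> x $ j = 0" using test_functionsD(3)[OF t] by blast
  then obtain R where R: "\<And>j x. x \<notin> cball 0 (R j) \<Longrightarrow> \<phi> x $ j = 0" by metis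
  define M where "M = Max (range R)"
  have M: "R j \<le> M" for j by (auto simp: M_def)
  have z: "\<phi> x $ j = 0" if "x \<notin> cball 0 M" for x j using R[of x j] M[of j] that by auto
  have "grad (\<lambda>x. \<phi> x $ j) x = 0" if "x \<notin> cball 0 M" for x j
    by (rule partial_deriv_eq_0_outside(2)[where S="cball 0 M" and \<phi>="\<lambda>x. \<phi> x $ j"]) (use z that in auto)
  then have "\<phi> x = 0 \<and> grad_matrix \<phi> x = 0" if "x \<notin> cball 0 M" for x
    using z that by (auto simp: vec_eq_iff grad_matrix_def)
  then show "\<exists>R. \<forall>x. x \<notin> cball 0 R \<longrightarrow> \<phi> x = 0 \<and> grad_matrix \<phi> x = 0" by blast
qed

lemma borel_measurable_C1_map:
  assumes "C1_map w Dw"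
  shows "w \<in> borel_measurable borel" "Dw \<in> borel_measurable borel"
  by (intro borel_measurable_continuous_onI C1_map_continuous[OF assms])+

text \<open>For the zero boundary values the constant sequence \<phi> serves as the approximating
  sequence. The chosen weak gradient agrees with the classical one only almost everywhere, which is
  enough inside integrals.\<close>

lemma vector_test_function_W1inf_zero:
  fixes \<phi> :: "real^'N::finite \<Rightarrow> real^'n::finite"
  assumes \<phi>: "\<phi> \<in> vector_test_functions \<Omega>" and \<Omega>: "open \<Omega>"
  shows "\<phi> \<in> W1inf_zero_space \<Omega>"
    and "AE x in lborel. x \<in> \<Omega> \<longrightarrow> weak_gradient \<Omega> \<phi> x = grad_matrix \<phi> x"
proof -
  note t = vector_test_function_C1[OF \<phi>]
  obtain R where R: "\<And>x. x \<notin> cball 0 R \<Longrightarrow> \<phi> x = 0" "\<And>x. x \<notin> cball 0 R \<Longrightarrow> grad_matrix \<phi> x = 0" using t(4) by blast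
  have hw: "has_weak_gradient \<Omega> \<phi> (grad_matrix \<phi>)" by (rule C1_map_has_weak_gradient[OF t(1) \<Omega>])
  then have "has_weak_gradient \<Omega> \<phi> (weak_gradient \<Omega> \<phi>)" unfolding weak_gradient_def by (rule someI[of "has_weak_gradient \<Omega> \<phi>"])
  from weak_gradient_unique[OF this hw \<Omega>]
  show "AE x in lborel. x \<in> \<Omega> \<longrightarrow> weak_gradient \<Omega> \<phi> x = grad_matrix \<phi> x" .
  note m = borel_measurable_C1_map[OF t(1)]
  have \<Omega>b: "\<Omega> \<in> sets borel" using \<Omega> by simp
  have i: "integrable lborel \<phi>" "integrable lborel (grad_matrix \<phi>)"
    by (rule integrable_compact_support[where R=R]; use R C1_map_continuous[OF t(1)] in blast)+
  have L1: "\<phi> \<in> L1_space \<Omega>" "grad_matrix \<phi> \<in> L1_space \<Omega>"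
    using integral_lebesgue_on_eq_lborel(2)[OF m(1) \<Omega>b t(2)] integral_lebesgue_on_eq_lborel(2)[OF m(2) \<Omega>b t(3)] i
    by (auto simp: L1_space_def)
  obtain B1 where B1: "\<forall>x. norm (\<phi> x) \<le> B1"
    using bounded_compact_support[OF C1_map_continuous(1)[OF t(1)], of R] R by blast
  obtain B2 where B2: "\<forall>x. norm (grad_matrix \<phi> x) \<le> B2"
    using bounded_compact_support[OF C1_map_continuous(2)[OF t(1)], of R] R by blast
  have Linf: "\<phi> \<in> Linf_space \<Omega>" "grad_matrix \<phi> \<in> Linf_space \<Omega>"
    using lebesgue_on_representative_measurable(1)[OF m(1) _ \<Omega>b, of \<phi>] B1
      lebesgue_on_representative_measurable(1)[OF m(2) _ \<Omega>b, of "grad_matrix \<phi>"] B2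
    by (auto simp: Linf_space_def)
  show "\<phi> \<in> W1inf_zero_space \<Omega>"
    using L1 Linf hw \<phi>
    by (auto simp: W1inf_zero_space_def W1inf_space_def W11_zero_space_def W11_space_def L1_converges_def
        intro!: exI[of _ "\<lambda>_. \<phi>"])
qed

lemma continuous_bounded_on_cball_prod:
  fixes h :: "'a::euclidean_space \<Rightarrow> 'b::euclidean_space \<Rightarrow> real"
  assumes "continuous_on UNIV (\<lambda>(v, \<xi>). h v \<xi>)"
  shows "\<exists>H\<ge>0. \<forall>v \<xi>. norm v \<le> R \<longrightarrow> norm \<xi> \<le> S \<longrightarrow> \<bar>h v \<xi>\<bar> \<le> H"
proof -
  have "compact ((\<lambda>(v, \<xi>). h v \<xi>) ` (cball 0 R \<times> cball 0 S))"
    by (intro compact_continuous_image compact_Times compact_cball continuous_on_subset[OF assms]) auto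
  from compact_imp_bounded[OF this] obtain H where H: "\<forall>y\<in>(\<lambda>(v, \<xi>). h v \<xi>) ` (cball 0 R \<times> cball 0 S). norm y \<le> H"
    by (auto simp: bounded_iff)
  have "\<bar>h v \<xi>\<bar> \<le> max H 0" if "norm v \<le> R" "norm \<xi> \<le> S" for v \<xi>
    using H that by (force intro: max.coboundedI1)
  then show ?thesis by (intro exI[of _ "max H 0"]) auto
qed

lemma borel_measurable_continuous_compose2:
  fixes h :: "'a::euclidean_space \<Rightarrow> 'b::euclidean_space \<Rightarrow> real"
  assumes "continuous_on UNIV (\<lambda>(v, \<xi>). h v \<xi>)"
    and "f \<in> borel_measurable M" "g \<in> borel_measurable M"
  shows "(\<lambda>x. h (f x) (g x)) \<in> borel_measurable M"
  using borel_measurable_continuous_onI[OF assms(1)] borel_measurable_Pair[OF assms(2,3)]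
  by (auto dest: measurable_compose[rotated])

lemma tendsto_continuous_compose2:
  fixes h :: "'a::euclidean_space \<Rightarrow> 'b::euclidean_space \<Rightarrow> real"
  assumes "continuous_on UNIV (\<lambda>(v, \<xi>). h v \<xi>)" "(f \<longlongrightarrow> v) F" "(g \<longlongrightarrow> \<xi>) F"
  shows "((\<lambda>x. h (f x) (g x)) \<longlongrightarrow> h v \<xi>) F"
proof -
  have "isCont (\<lambda>(v, \<xi>). h v \<xi>) (v, \<xi>)"
    using assms(1) by (simp add: continuous_on_eq_continuous_at)
  from isCont_tendsto_compose[OF this tendsto_Pair[OF assms(2,3)]] show ?thesis by simp
qed

lemma integrable_bounded_on_ball:
  fixes k :: "'a::euclidean_space \<Rightarrow> real"
  assumes "k \<in> borel_measurable borel" "\<And>x. x \<notin> ball x0 r \<Longrightarrow> k x = 0" "\<And>x. \<bar>k x\<bar> \<le> B"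
  shows "integrable lborel k"
proof (rule Bochner_Integration.integrable_bound[of lborel "\<lambda>x. B * indicator (ball x0 r) x"])
  show "integrable lborel (\<lambda>x. B * indicator (ball x0 r) x :: real)"
    using emeasure_lborel_ball_finite[of x0 r] by (intro integrable_mult_right) auto
  show "AE x in lborel. norm (k x) \<le> norm (B * indicator (ball x0 r) x)"
    using assms(2,3) by (intro AE_I2) (fastforce simp: indicator_def intro: order_trans[OF _ abs_ge_self])
qed (use assms in auto)

text \<open>A single scaled copy of the ball inside the open set \<open>D\<close> of the definition suffices: outside of it
  the perturbation vanishes.\<close>

lemma convex_quasiconvex_test:
  fixes h :: "real^'m::finite \<Rightarrow> real^'N::finite^'n::finite \<Rightarrow> real"
  assumes h: "convex_quasiconvex h" and cont: "continuous_on UNIV (\<lambda>(v, \<xi>). h v \<xi>)"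
    and r: "r > 0" and \<phi>: "\<phi> \<in> vector_test_functions (ball x0 r)"
    and \<eta>: "\<eta> \<in> borel_measurable borel" "\<And>x. norm (\<eta> x) \<le> B" "\<And>x. x \<notin> ball x0 r \<Longrightarrow> \<eta> x = 0"
      "(LBINT x. \<eta> x) = 0"
  shows "0 \<le> (LBINT x. h (v + \<eta> x) (\<xi> + grad_matrix \<phi> x) - h v \<xi>)"
proof -
  obtain D :: "(real^'N) set" where D: "D \<noteq> {}" "bounded D" "open D"
    and all: "\<forall>v \<xi>. \<forall>\<eta>\<in>Linf_space D. (LINT x|lebesgue_on D. \<eta> x) = 0 \<longrightarrow>
      (\<forall>\<phi>\<in>W1inf_zero_space D. integrable (lebesgue_on D) (\<lambda>x. h (v + \<eta> x) (\<xi> + weak_gradient D \<phi> x)) \<and>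
       h v \<xi> \<le> 1 / measure lebesgue D * (LINT x|lebesgue_on D. h (v + \<eta> x) (\<xi> + weak_gradient D \<phi> x)))"
    using h unfolding convex_quasiconvex_def by (elim conjE exE)
  have ineq: "h v \<xi> \<le> 1 / measure lebesgue D * (LINT x|lebesgue_on D. h (v + \<eta> x) (\<xi> + weak_gradient D \<phi> x))"
    if "\<eta> \<in> Linf_space D" "(LINT x|lebesgue_on D. \<eta> x) = 0" "\<phi> \<in> W1inf_zero_space D" for v \<xi> \<eta> \<phi>
    using all[rule_format, OF that] by (rule conjunct2)
  obtain a s where s: "s > 0" "ball a s \<subseteq> D" using D(1,3) by (meson ex_in_conv openE)
  have Db: "D \<in> sets borel" using D by simp
  have measD: "measure lborel D > 0"
  proof -
    have "0 < measure lborel (ball a s)" by (rule content_ball_pos[OF s(1)])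
    also have "\<dots> \<le> measure lborel D"
      using D s emeasure_bounded_finite[OF D(2)] by (intro measure_mono_fmeasurable) (auto simp: fmeasurable_def)
    finally show ?thesis .
  qed
  \<comment> \<open>\<open>x \<mapsto> t + c *\<^sub>R x\<close> maps a ball \<open>ball a s\<close>
    inside \<open>D\<close> onto \<open>ball x0 r\<close>.\<close>
  define c where "c = r / s"
  define t where "t = x0 - c *\<^sub>R a"
  have c: "c > 0" using r s by (simp add: c_def)
  have in_ball: "t + c *\<^sub>R x \<in> ball x0 r \<longleftrightarrow> x \<in> ball a s" for x
  proof -
    have "x0 - (t + c *\<^sub>R x) = c *\<^sub>R (a - x)" by (simp add: t_def algebra_simps)
    then have eq: "dist x0 (t + c *\<^sub>R x) = c * dist a x" using c by (simp add: dist_norm)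
    have "c * dist a x < r \<longleftrightarrow> dist a x < s" using s(1) r by (simp add: c_def pos_divide_less_eq)
    then show ?thesis by (simp add: eq)
  qed
  \<comment> \<open>The factor \<open>1 / c\<close> cancels the factor from the chain rule, so
    gradients are transported without rescaling.\<close>
  define \<phi>' where "\<phi>' = (\<lambda>x. (1 / c) *\<^sub>R \<phi> (t + c *\<^sub>R x))"
  define \<eta>' where "\<eta>' = (\<lambda>x. \<eta> (t + c *\<^sub>R x))"
  note \<phi>C = vector_test_function_C1[OF \<phi>]
  have tj: "(\<lambda>x. \<phi> x $ j) \<in> test_functions (ball x0 r)" for j using \<phi> by (simp add: vector_test_functions_def)
  have \<phi>': "\<phi>' \<in> vector_test_functions D"
    unfolding vector_test_functions_def
  proof (intro CollectI allI)
    fix j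
    let ?S = "closure {x. \<phi> x $ j \<noteq> 0}"
    let ?T = "(\<lambda>y. (1 / c) *\<^sub>R (y - t)) ` ?S"
    have S: "compact ?S" "?S \<subseteq> ball x0 r" using tj[of j] by (auto simp: test_functions_def)
    show "(\<lambda>x. \<phi>' x $ j) \<in> test_functions D"
    proof (rule test_functionsI[where K="?T"])
      show "Ck_fun k (\<lambda>x. \<phi>' x $ j)" for k
        using Ck_fun_affine[OF test_functionsD(1)[OF tj[of j]], where d="1 / c" and a=t and c=c and k=k] by (simp add: \<phi>'_def)
      show "compact ?T" by (intro compact_continuous_image S continuous_intros)
      have rescale: "(1 / c) *\<^sub>R ((t + c *\<^sub>R x) - t) = x" "t + c *\<^sub>R ((1 / c) *\<^sub>R (x - t)) = x" for x using c by auto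
      show "\<phi>' x $ j = 0" if "x \<notin> ?T" for x
      proof (rule ccontr)
        assume "\<phi>' x $ j \<noteq> 0"
        then have "t + c *\<^sub>R x \<in> {x. \<phi> x $ j \<noteq> 0}" by (simp add: \<phi>'_def)
        then have "t + c *\<^sub>R x \<in> ?S" by (rule subsetD[OF closure_subset])
        then have "(1 / c) *\<^sub>R ((t + c *\<^sub>R x) - t) \<in> ?T" by (rule imageI)
        then show False using that rescale by simp
      qed
      show "?T \<subseteq> D"
      proof
        fix x assume "x \<in> ?T"
        then obtain y where y: "y \<in> ?S" "x = (1 / c) *\<^sub>R (y - t)" by blast
        then have "t + c *\<^sub>R x \<in> ball x0 r" using rescale(2)[of y] S(2) by auto
        then show "x \<in> D" using in_ball s(2) by auto
      qed
    qed
  qed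
  have jac: "grad_matrix \<phi>' x = grad_matrix \<phi> (t + c *\<^sub>R x)" for x
    using partial_deriv_affine[OF test_functionsD(2)[OF tj], where d="1 / c" and a=t and c=c and x=x] c
    by (simp add: grad_matrix_def grad_def \<phi>'_def vec_eq_iff)
  define k where "k = (\<lambda>x. h (v + \<eta> x) (\<xi> + grad_matrix \<phi> x))"
  obtain R where R: "\<And>x. x \<notin> cball 0 R \<Longrightarrow> grad_matrix \<phi> x = 0" using \<phi>C(4) by blast
  obtain B2 where B2: "\<forall>x. norm (grad_matrix \<phi> x) \<le> B2"
    using bounded_compact_support[OF C1_map_continuous(2)[OF \<phi>C(1)], of R] R by blast
  note [measurable] = \<eta>(1) borel_measurable_C1_map[OF \<phi>C(1)]
  have [measurable]: "k \<in> borel_measurable borel"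
    unfolding k_def by (rule borel_measurable_continuous_compose2[OF cont]) measurable
  obtain H where H: "H \<ge> 0" "\<And>v' \<xi>'. norm v' \<le> norm v + B \<Longrightarrow> norm \<xi>' \<le> norm \<xi> + B2 \<Longrightarrow> \<bar>h v' \<xi>'\<bar> \<le> H"
    using continuous_bounded_on_cball_prod[OF cont] by blast
  have kH: "\<bar>k x\<bar> \<le> H" for x
    unfolding k_def using \<eta>(2)[of x] B2 by (intro H) (auto intro: norm_triangle_le add_left_mono)
  have B0: "B \<ge> 0" "B2 \<ge> 0" using \<eta>(2)[of 0] B2 norm_ge_zero order_trans by blast+
  \<comment> \<open>The perturbed and unperturbed integrands agree off the ball. The integral over
    \<open>D\<close> is thus \<open>h v \<xi>\<close> times the volume of \<open>D\<close> plus an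
    integral that sees only the scaled ball, and the volume cancels from the inequality.\<close>
  have k0: "k x - h v \<xi> = 0" if "x \<notin> ball x0 r" for x using \<phi>C(3) \<eta>(3) that by (simp add: k_def)
  have "\<bar>h v \<xi>\<bar> \<le> H" using B0 by (intro H) auto
  then have "\<bar>k x - h v \<xi>\<bar> \<le> H + H" for x using kH[of x] by linarith
  then have ik0: "integrable lborel (\<lambda>x. k x - h v \<xi>)"
    by (intro integrable_bounded_on_ball[of _ x0 r "H + H"] k0) auto
  have out: "t + c *\<^sub>R x \<notin> ball x0 r" if "x \<notin> D" for x using in_ball[of x] s(2) that by blast
  have \<eta>'i: "(LINT x|lebesgue_on D. \<eta>' x) = 0"
  proof -
    have "(LINT x|lebesgue_on D. \<eta>' x) = (LBINT x. \<eta>' x)"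
      by (rule integral_lebesgue_on_eq_lborel(1)) (use \<eta>(3)[OF out] Db in \<open>simp_all add: \<eta>'_def\<close>)
    moreover have "0 = (\<bar>c\<bar> ^ DIM(real^'N)) *\<^sub>R (LBINT x. \<eta>' x)"
      using integral_lborel_affine[of \<eta> c t] c \<eta>(4) by (simp add: \<eta>'_def)
    ultimately show ?thesis using c by simp
  qed
  have "\<eta>' \<in> borel_measurable (lebesgue_on D)"
    by (rule lebesgue_on_representative_measurable(1)[of \<eta>']) (use Db in \<open>auto simp: \<eta>'_def\<close>)
  then have "\<eta>' \<in> Linf_space D" using \<eta>(2) by (auto simp: Linf_space_def \<eta>'_def)
  from ineq[OF this \<eta>'i vector_test_function_W1inf_zero(1)[OF \<phi>' D(3)], of v \<xi>]
  have "h v \<xi> \<le> 1 / measure lborel D * (LINT x|lebesgue_on D. h (v + \<eta>' x) (\<xi> + weak_gradient D \<phi>' x))"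
    using Db by (simp add: measure_completion)
  also have "(LINT x|lebesgue_on D. h (v + \<eta>' x) (\<xi> + weak_gradient D \<phi>' x))
      = (LBINT x. indicator D x *\<^sub>R k (t + c *\<^sub>R x))"
  proof (rule lebesgue_on_integral_representative(2)[OF _ _ Db])
    show "(\<lambda>x. k (t + c *\<^sub>R x)) \<in> borel_measurable borel" by measurable
    show "AE x in lborel. x \<in> D \<longrightarrow> k (t + c *\<^sub>R x) = h (v + \<eta>' x) (\<xi> + weak_gradient D \<phi>' x)"
      using vector_test_function_W1inf_zero(2)[OF \<phi>' D(3)] by eventually_elim (simp add: k_def \<eta>'_def jac)
  qed
  also have "\<dots> = (LBINT x. (k (t + c *\<^sub>R x) - h v \<xi>) + h v \<xi> * indicator D x)"
    using k0[OF out] by (intro Bochner_Integration.integral_cong) (auto simp: indicator_def)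
  also have "\<dots> = (LBINT x. k (t + c *\<^sub>R x) - h v \<xi>) + h v \<xi> * measure lborel D"
  proof -
    have "integrable lborel (\<lambda>x. k (t + c *\<^sub>R x) - h v \<xi>)" using integrable_lborel_affine[OF ik0, of c t] c by simp
    moreover have "integrable lborel (indicator D :: real^'N \<Rightarrow> real)" using Db emeasure_bounded_finite[OF D(2)] by simp
    ultimately show ?thesis using Db by simp
  qed
  finally have "h v \<xi> * measure lborel D \<le> (LBINT x. k (t + c *\<^sub>R x) - h v \<xi>) + h v \<xi> * measure lborel D"
    using measD by (simp add: field_simps)
  then have "0 \<le> (LBINT x. k (t + c *\<^sub>R x) - h v \<xi>)" by simp
  then have "0 \<le> (\<bar>c\<bar> ^ DIM(real^'N)) *\<^sub>R (LBINT x. k (t + c *\<^sub>R x) - h v \<xi>)"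
    using c by (simp add: zero_le_mult_iff)
  also have "\<dots> = (LBINT x. k x - h v \<xi>)"
    using integral_lborel_affine[of "\<lambda>x. k x - h v \<xi>" c t] c by simp
  finally show ?thesis by (simp add: k_def)
qed

section \<open>From smooth perturbations and bounded fields to C1 maps and Lp fields\<close>

lemma conv_commute:
  fixes \<rho> g :: "'a::euclidean_space \<Rightarrow> real"
  assumes [measurable]: "\<rho> \<in> borel_measurable borel" "g \<in> borel_measurable borel"
  shows "conv \<rho> g = conv g \<rho>"
proof
  fix x
  have "conv \<rho> g x = (LBINT y. \<rho> (x - (x - y)) *\<^sub>R g (x - y))"
    unfolding conv_def by (subst integral_lborel_translate(2)[symmetric, of "\<lambda>y. \<rho> (x - y) *\<^sub>R g y" x]) auto
  then show "conv \<rho> g x = conv g \<rho> x" by (simp add: conv_def mult.commute)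
qed

lemma conv_mollifier_eq:
  fixes g :: "real^'N::finite \<Rightarrow> real"
  assumes "mollifier \<epsilon> \<rho>" and [measurable]: "g \<in> borel_measurable borel"
  shows "conv \<rho> g x = (LBINT z. \<rho> z * g (x - z))"
proof -
  have [measurable]: "\<rho> \<in> borel_measurable borel"
    using assms borel_measurable_integrable[of lborel \<rho>] by (auto simp: mollifier_def)
  show ?thesis by (subst conv_commute) (auto simp: conv_def mult.commute)
qed

text \<open>\<open>conv \<rho> g x\<close> is a weighted mean of values of \<open>g\<close> near
  \<open>x\<close>. With \<open>a = 0\<close> and \<open>e = 0\<close> this locates the support of a
  mollified function, with \<open>a = 0\<close> it gives uniform bounds, and with
  \<open>a = g x\<close> convergence.\<close>

lemma mollify_pointwise:
  fixes g :: "real^'N::finite \<Rightarrow> real"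
  assumes \<rho>: "mollifier \<epsilon> \<rho>" and g: "continuous_on UNIV g" "\<And>x. \<bar>g x\<bar> \<le> B"
    and e: "\<And>z. norm z < \<epsilon> \<Longrightarrow> \<bar>g (x - z) - a\<bar> \<le> e"
  shows "\<bar>conv \<rho> g x - a\<bar> \<le> e"
proof -
  have [measurable]: "g \<in> borel_measurable borel" by (rule borel_measurable_continuous_onI[OF g(1)])
  have i: "integrable lborel (\<lambda>z. \<rho> z * g (x - z))"
  proof -
    have "integrable lborel (\<lambda>z. g (x - z) *\<^sub>R \<rho> z)"
      by (rule integrable_bounded_scaleR[where B=B]) (use g \<rho> in \<open>auto simp: mollifier_def\<close>)
    then show ?thesis by (simp add: mult.commute)
  qed
  have i\<rho>: "integrable lborel \<rho>" "(LBINT x. \<rho> x) = 1" using \<rho> by (auto simp: mollifier_def)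
  have "conv \<rho> g x - a = (LBINT z. \<rho> z * g (x - z) - \<rho> z * a)"
    using i i\<rho> conv_mollifier_eq[OF \<rho>] by simp
  also have "\<bar>\<dots>\<bar> \<le> (LBINT z. \<bar>\<rho> z * g (x - z) - \<rho> z * a\<bar>)" by (rule integral_abs_bound)
  also have "\<dots> \<le> (LBINT z. \<rho> z * e)"
  proof (rule integral_mono)
    fix z
    have \<rho>z: "\<rho> z \<ge> 0" "\<epsilon> \<le> norm z \<Longrightarrow> \<rho> z = 0" using \<rho> by (auto simp: mollifier_def)
    have "\<bar>\<rho> z * g (x - z) - \<rho> z * a\<bar> = \<rho> z * \<bar>g (x - z) - a\<bar>"
      using \<rho>z by (simp flip: right_diff_distrib add: abs_mult)
    also have "\<dots> \<le> \<rho> z * e"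
      using \<rho>z e[of z] by (cases "norm z < \<epsilon>") (auto intro: mult_left_mono)
    finally show "\<bar>\<rho> z * g (x - z) - \<rho> z * a\<bar> \<le> \<rho> z * e" .
  qed (use i i\<rho> in auto)
  also have "\<dots> = e" using i\<rho> by simp
  finally show ?thesis .
qed

lemma C1_map_zero_outside:
  fixes \<Phi> :: "real^'N::finite \<Rightarrow> real^'n::finite"
  assumes \<Phi>: "C1_map \<Phi> D\<Phi>" and S: "closed S" "\<And>x. x \<notin> S \<Longrightarrow> \<Phi> x = 0" "x \<notin> S"
  shows "D\<Phi> x = 0"
proof -
  have "grad (\<lambda>x. \<Phi> x $ j) x = 0" for j
    by (rule partial_deriv_eq_0_outside(2)[where S=S and \<phi>="\<lambda>x. \<Phi> x $ j"]) (use S in auto)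
  then show ?thesis using \<Phi> by (simp add: C1_map_iff vec_eq_iff)
qed

lemma cball_subset_cball_0:
  fixes x0 :: "'a::real_normed_vector"
  shows "cball x0 s \<subseteq> cball 0 (norm x0 + s)"
proof
  fix x assume "x \<in> cball x0 s"
  then show "x \<in> cball 0 (norm x0 + s)" using norm_triangle_ineq[of x0 "x - x0"] by (auto simp: dist_norm norm_minus_commute)
qed

text \<open>Mollification makes \<Phi> an admissible test function. The mollified gradients are
  uniformly bounded and converge pointwise to \<open>D\<Phi>\<close>, and \<open>h\<close> is
  bounded on bounded sets, so dominated convergence on the ball carries the inequality over.\<close>

lemma convex_quasiconvex_C1:
  fixes h :: "real^'m::finite \<Rightarrow> real^'N::finite^'n::finite \<Rightarrow> real"
  assumes h: "convex_quasiconvex h" and cont: "continuous_on UNIV (\<lambda>(v, \<xi>). h v \<xi>)"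
    and r: "0 < r" "s < r" and \<Phi>: "C1_map \<Phi> D\<Phi>" "\<And>x. x \<notin> cball x0 s \<Longrightarrow> \<Phi> x = 0"
    and \<eta>: "\<eta> \<in> borel_measurable borel" "\<And>x. norm (\<eta> x) \<le> B" "\<And>x. x \<notin> ball x0 r \<Longrightarrow> \<eta> x = 0"
      "(LBINT x. \<eta> x) = 0"
  shows "0 \<le> (LBINT x. h (v + \<eta> x) (\<xi> + D\<Phi> x) - h v \<xi>)"
proof -
  \<comment> \<open>The first bound keeps the mollified supports in a compact subset of
    \<open>ball x0 r\<close>, using the margin \<open>s < r\<close>; the second sends the scale to
    0.\<close>
  define \<epsilon> where "\<epsilon> m = min ((r - s) / 2) (1 / real (Suc m))" for m
  have \<epsilon>: "\<epsilon> m > 0" for m using r by (simp add: \<epsilon>_def)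
  have "\<forall>m. \<exists>\<rho> :: real^'N \<Rightarrow> real. mollifier (\<epsilon> m) \<rho>" using mollifier_exists \<epsilon> by blast
  then obtain \<rho> :: "nat \<Rightarrow> real^'N \<Rightarrow> real" where \<rho>: "\<And>m. mollifier (\<epsilon> m) (\<rho> m)" by metis
  have \<Phi>j: "C1_fun (\<lambda>x. \<Phi> x $ j)" "grad (\<lambda>x. \<Phi> x $ j) = (\<lambda>x. D\<Phi> x $ j)" for j using \<Phi>(1) by (auto simp: C1_map_iff)
  have pd: "partial_deriv i (\<lambda>x. \<Phi> x $ j) = (\<lambda>x. D\<Phi> x $ j $ i)" for i j
    using \<Phi>j(2)[of j] by (auto simp: grad_def fun_eq_iff vec_eq_iff)
  note sub = cball_subset_cball_0[of x0 s]
  have D0: "D\<Phi> x = 0" if "x \<notin> cball x0 s" for x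
    by (rule C1_map_zero_outside[where S="cball x0 s", OF \<Phi>(1)]) (use \<Phi>(2) that in auto)
  note cD = C1_map_continuous[OF \<Phi>(1)]
  obtain B2 where B2: "B2 \<ge> 0" "\<And>x. norm (D\<Phi> x) \<le> B2"
    using bounded_compact_support[OF cD(2), of "norm x0 + s"] D0 sub by blast
  have B2': "\<bar>D\<Phi> x $ j $ i\<bar> \<le> B2" for x i j
    using B2(2)[of x] Finite_Cartesian_Product.norm_nth_le[of "D\<Phi> x" j] component_le_norm_cart[of "D\<Phi> x $ j" i] by linarith
  have cDij: "continuous_on UNIV (\<lambda>x. D\<Phi> x $ j $ i)" for i j using cD by (intro continuous_intros)
  note [measurable] = borel_measurable_C1_map[OF \<Phi>(1)] \<eta>(1)
  have \<rho>m [measurable]: "\<rho> m \<in> borel_measurable borel" and \<rho>i: "integrable lborel (\<rho> m)" for m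
    using \<rho>[of m] borel_measurable_integrable[of lborel "\<rho> m"] by (auto simp: mollifier_def)
  define \<phi> where "\<phi> m = (\<lambda>x. \<chi> j. conv (\<rho> m) (\<lambda>y. \<Phi> y $ j) x)" for m
  have c\<Phi>j: "continuous_on UNIV (\<lambda>x. \<Phi> x $ j)" for j using cD by (intro continuous_intros)
  have \<Phi>j0: "\<Phi> x $ j = 0" if "x \<notin> cball 0 (norm x0 + s)" for x j using \<Phi>(2)[of x] sub that by (metis subsetD zero_index)
  have i\<Phi>: "integrable lborel (\<lambda>y. \<Phi> y $ j)" for j
    by (rule integrable_compact_support[OF c\<Phi>j \<Phi>j0])
  have test: "\<phi> m \<in> vector_test_functions (ball x0 r)" for m
    unfolding vector_test_functions_def
  proof (intro CollectI allI)
    fix j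
    show "(\<lambda>x. \<phi> m x $ j) \<in> test_functions (ball x0 r)"
    proof (rule test_functionsI[where K="cball x0 (s + \<epsilon> m)"])
      show "Ck_fun k (\<lambda>x. \<phi> m x $ j)" for k
        unfolding \<phi>_def vec_lambda_beta
        by (rule conv_Ck[of _ _ "\<epsilon> m"]) (use \<rho>[of m] i\<Phi> in \<open>auto simp: mollifier_def\<close>)
      show "\<phi> m x $ j = 0" if "x \<notin> cball x0 (s + \<epsilon> m)" for x
      proof -
        have "\<bar>conv (\<rho> m) (\<lambda>y. \<Phi> y $ j) x - 0\<bar> \<le> 0"
        proof (rule mollify_pointwise[OF \<rho> c\<Phi>j])
          obtain B1 where "\<forall>x. norm (\<Phi> x $ j) \<le> B1" using bounded_compact_support[OF c\<Phi>j \<Phi>j0] by blast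
          then show "\<bar>\<Phi> x $ j\<bar> \<le> (SUP x. \<bar>\<Phi> x $ j\<bar>)" for x
            by (intro cSUP_upper) (auto intro!: bdd_aboveI[of _ B1])
          fix z :: "real^'N" assume "norm z < \<epsilon> m"
          then have "x - z \<notin> cball x0 s"
            using that dist_triangle[of x0 x "x - z"] by (auto simp: dist_norm)
          then show "\<bar>\<Phi> (x - z) $ j - 0\<bar> \<le> 0" using \<Phi>(2) by simp
        qed
        then show ?thesis by (simp add: \<phi>_def)
      qed
      have "\<epsilon> m \<le> (r - s) / 2" unfolding \<epsilon>_def by (rule min.cobounded1)
      then have "s + \<epsilon> m < r" using r(2) by (simp add: field_simps)
      then show "cball x0 (s + \<epsilon> m) \<subseteq> ball x0 r" by auto
    qed auto
  qed
  have jac: "grad_matrix (\<phi> m) x $ j $ i = conv (\<rho> m) (\<lambda>y. D\<Phi> y $ j $ i) x" for m x i j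
  proof -
    \<comment> \<open>Exchanging the roles makes \<Phi> the kernel, so that the derivative falls on
      \<Phi> and the gradient of the mollification is the mollification of
      \<open>D\<Phi>\<close>.\<close>
    have "conv (\<rho> m) (\<lambda>y. \<Phi> y $ j) = conv (\<lambda>y. \<Phi> y $ j) (\<rho> m)" by (rule conv_commute) measurable
    then have "grad_matrix (\<phi> m) x $ j $ i = partial_deriv i (conv (\<lambda>y. \<Phi> y $ j) (\<rho> m)) x"
      by (simp add: grad_matrix_def grad_def \<phi>_def)
    also have "\<dots> = conv (partial_deriv i (\<lambda>y. \<Phi> y $ j)) (\<rho> m) x"
      using conv_C1(2)[OF \<Phi>j(1) \<Phi>j0 \<rho>i] by simp
    also have "\<dots> = conv (\<rho> m) (\<lambda>y. D\<Phi> y $ j $ i) x" unfolding pd by (subst conv_commute) measurable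
    finally show ?thesis .
  qed
  have jac_bound: "norm (grad_matrix (\<phi> m) x) \<le> B2 * CARD('n) * CARD('N)" for m x
  proof -
    have "\<bar>grad_matrix (\<phi> m) x $ j $ i - 0\<bar> \<le> B2" for i j
      unfolding jac by (rule mollify_pointwise[OF \<rho> cDij B2']) (use B2' in auto)
    then have "(\<Sum>j\<in>UNIV. \<Sum>i\<in>UNIV. \<bar>grad_matrix (\<phi> m) x $ j $ i\<bar>) \<le> (\<Sum>j\<in>(UNIV :: 'n set). \<Sum>i\<in>(UNIV :: 'N set). B2)"
      by (intro sum_mono) auto
    then show ?thesis using norm_matrix_le_sum[of "grad_matrix (\<phi> m) x"] by (simp add: mult_ac)
  qed
  have \<epsilon>0: "\<epsilon> \<longlonglongrightarrow> 0"
  proof (rule tendsto_sandwich[OF _ _ tendsto_const LIMSEQ_Suc[OF lim_1_over_n]])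
    show "\<forall>\<^sub>F m in sequentially. 0 \<le> \<epsilon> m" using \<epsilon> by (simp add: less_imp_le)
    show "\<forall>\<^sub>F m in sequentially. \<epsilon> m \<le> 1 / real (Suc m)" by (simp add: \<epsilon>_def)
  qed
  have jac_lim: "(\<lambda>m. grad_matrix (\<phi> m) x) \<longlonglongrightarrow> D\<Phi> x" for x
  proof (intro vec_tendstoI)
    fix i j
    show "(\<lambda>m. grad_matrix (\<phi> m) x $ j $ i) \<longlonglongrightarrow> D\<Phi> x $ j $ i"
    proof (rule LIMSEQ_I)
      fix e :: real assume e: "e > 0"
      have "continuous (at x) (\<lambda>x. D\<Phi> x $ j $ i)" using cDij by (simp add: continuous_on_eq_continuous_at)
      then obtain d where d: "d > 0" "\<And>y. dist y x < d \<Longrightarrow> dist (D\<Phi> y $ j $ i) (D\<Phi> x $ j $ i) < e / 2"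
        unfolding continuous_at_eps_delta using e by (metis half_gt_zero)
      obtain M where M: "\<And>m. m \<ge> M \<Longrightarrow> \<epsilon> m < d"
        using order_tendstoD(2)[OF \<epsilon>0 d(1)] by (auto simp: eventually_sequentially)
      have "norm (grad_matrix (\<phi> m) x $ j $ i - D\<Phi> x $ j $ i) < e" if "m \<ge> M" for m
      proof -
        have "\<bar>grad_matrix (\<phi> m) x $ j $ i - D\<Phi> x $ j $ i\<bar> \<le> e / 2"
          unfolding jac
        proof (rule mollify_pointwise[OF \<rho> cDij B2'])
          fix z :: "real^'N" assume "norm z < \<epsilon> m"
          then show "\<bar>D\<Phi> (x - z) $ j $ i - D\<Phi> x $ j $ i\<bar> \<le> e / 2"
            using d(2)[of "x - z"] M[OF that] by (auto simp: dist_norm)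
        qed
        then show ?thesis using e by simp
      qed
      then show "\<exists>M. \<forall>m\<ge>M. norm (grad_matrix (\<phi> m) x $ j $ i - D\<Phi> x $ j $ i) < e" by blast
    qed
  qed
  define B3 where "B3 = B2 * CARD('n) * CARD('N)"
  obtain H where H: "H \<ge> 0" "\<And>v' \<xi>'. norm v' \<le> norm v + B \<Longrightarrow> norm \<xi>' \<le> norm \<xi> + B3 \<Longrightarrow> \<bar>h v' \<xi>'\<bar> \<le> H"
    using continuous_bounded_on_cball_prod[OF cont] by blast
  have B0: "B \<ge> 0" "B3 \<ge> 0" using \<eta>(2)[of 0] norm_ge_zero order_trans jac_bound[of 0 0] by (blast, auto simp: B3_def B2(1))
  have "(\<lambda>m. \<integral>x. h (v + \<eta> x) (\<xi> + grad_matrix (\<phi> m) x) - h v \<xi> \<partial>lborel)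
      \<longlonglongrightarrow> (LBINT x. h (v + \<eta> x) (\<xi> + D\<Phi> x) - h v \<xi>)"
  proof (rule integral_dominated_convergence[where w="\<lambda>x. (2 * H) * indicator (ball x0 r) x"])
    show "integrable lborel (\<lambda>x. (2 * H) * indicator (ball x0 r) x :: real)"
      using emeasure_lborel_ball_finite[of x0 r] by (intro integrable_mult_right) auto
    show "(\<lambda>x. h (v + \<eta> x) (\<xi> + D\<Phi> x) - h v \<xi>) \<in> borel_measurable lborel"
      by (intro borel_measurable_diff borel_measurable_continuous_compose2[OF cont]) measurable
    fix m
    have [measurable]: "grad_matrix (\<phi> m) \<in> borel_measurable borel"
      using borel_measurable_C1_map(2)[OF vector_test_function_C1(1)[OF test]] .
    show "(\<lambda>x. h (v + \<eta> x) (\<xi> + grad_matrix (\<phi> m) x) - h v \<xi>) \<in> borel_measurable lborel"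
      by (intro borel_measurable_diff borel_measurable_continuous_compose2[OF cont]) measurable
    show "AE x in lborel. norm (h (v + \<eta> x) (\<xi> + grad_matrix (\<phi> m) x) - h v \<xi>) \<le> (2 * H) * indicator (ball x0 r) x"
    proof (rule AE_I2)
      fix x
      show "norm (h (v + \<eta> x) (\<xi> + grad_matrix (\<phi> m) x) - h v \<xi>) \<le> (2 * H) * indicator (ball x0 r) x"
      proof (cases "x \<in> ball x0 r")
        case True
        have "\<bar>h (v + \<eta> x) (\<xi> + grad_matrix (\<phi> m) x)\<bar> \<le> H"
          using \<eta>(2)[of x] jac_bound[of m x]
          by (intro H) (auto simp: B3_def intro: norm_triangle_le add_left_mono)
        moreover have "\<bar>h v \<xi>\<bar> \<le> H" using B0 by (intro H) auto
        ultimately show ?thesis using True by auto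
      next
        case False
        then show ?thesis using \<eta>(3) vector_test_function_C1(3)[OF test[of m]] by simp
      qed
    qed
  next
    show "AE x in lborel. (\<lambda>m. h (v + \<eta> x) (\<xi> + grad_matrix (\<phi> m) x) - h v \<xi>) \<longlonglongrightarrow> h (v + \<eta> x) (\<xi> + D\<Phi> x) - h v \<xi>"
      by (intro AE_I2 tendsto_diff tendsto_continuous_compose2[OF cont] tendsto_add tendsto_const jac_lim)
  qed
  then show ?thesis
    by (rule LIMSEQ_le_const) (use convex_quasiconvex_test[OF h cont r(1) test \<eta>] in blast)
qed

text \<open>A Jensen inequality: convex in the first variable, quasiconvex in the second. Fields in
  Lp are reached by truncating \<open>v\<close> in size. The growth bound yields one integrable
  majorant for all truncations, and the means converge, so that continuity of \<open>h\<close>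
  handles the left-hand side.\<close>

lemma convex_quasiconvex_Lp:
  fixes h :: "real^'m::finite \<Rightarrow> real^'N::finite^'n::finite \<Rightarrow> real"
  assumes h: "convex_quasiconvex h" and cont: "continuous_on UNIV (\<lambda>(v, \<xi>). h v \<xi>)"
    and growth: "\<And>v \<xi>. \<bar>h v \<xi>\<bar> \<le> C * (1 + norm v powr p + norm \<xi>)" and p: "1 \<le> p" and C: "0 \<le> C"
    and r: "0 < r" "s < r" and \<Phi>: "C1_map \<Phi> D\<Phi>" "\<And>x. x \<notin> cball x0 s \<Longrightarrow> \<Phi> x = 0"
    and v [measurable]: "v \<in> borel_measurable borel"
    and vi: "integrable lborel (\<lambda>x. indicator (ball x0 r) x * norm (v x) powr p)"
  shows "measure lborel (ball x0 r) * h ((1 / measure lborel (ball x0 r)) *\<^sub>R (LBINT x. indicator (ball x0 r) x *\<^sub>R v x)) \<xi>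
     \<le> (LBINT x. indicator (ball x0 r) x * h (v x) (\<xi> + D\<Phi> x))"
    and "integrable lborel (\<lambda>x. indicator (ball x0 r) x * h (v x) (\<xi> + D\<Phi> x))"
    and "integrable lborel (\<lambda>x. indicator (ball x0 r) x *\<^sub>R v x)"
proof -
  let ?B = "ball x0 r"
  define b where "b = measure lborel ?B"
  have b: "b > 0" using content_ball_pos[OF r(1)] by (simp add: b_def)
  have iB: "integrable lborel (indicator ?B :: real^'N \<Rightarrow> real)"
    using emeasure_lborel_ball_finite[of x0 r] by simp
  have D0: "D\<Phi> x = 0" if "x \<notin> cball x0 s" for x
    by (rule C1_map_zero_outside[where S="cball x0 s", OF \<Phi>(1)]) (use \<Phi>(2) that in auto)
  have D0': "D\<Phi> x = 0" if "x \<notin> ball x0 r" for x using D0 r that by auto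
  note sub = cball_subset_cball_0[of x0 s]
  obtain B2 where B2: "B2 \<ge> 0" "\<And>x. norm (D\<Phi> x) \<le> B2"
    using bounded_compact_support[OF C1_map_continuous(2)[OF \<Phi>(1)], of "norm x0 + s"] D0 sub by blast
  note [measurable] = borel_measurable_C1_map[OF \<Phi>(1)]
  \<comment> \<open>Majorant for every field that is pointwise no larger than \<open>v\<close>,
    hence for \<open>v\<close> and all its truncations at once.\<close>
  define w where "w = (\<lambda>x. C * (1 + norm \<xi> + B2) * indicator ?B x + C * (indicator ?B x * norm (v x) powr p))"
  have iw: "integrable lborel w"
    unfolding w_def using vi iB by (intro Bochner_Integration.integrable_add integrable_mult_right)
  have hw: "\<bar>indicator ?B x * h v' (\<xi> + D\<Phi> x)\<bar> \<le> w x" if "norm v' \<le> norm (v x)" for x v'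
  proof (cases "x \<in> ?B")
    case True
    have "\<bar>h v' (\<xi> + D\<Phi> x)\<bar> \<le> C * (1 + norm v' powr p + norm (\<xi> + D\<Phi> x))" by (rule growth)
    also have "\<dots> \<le> C * (1 + norm (v x) powr p + (norm \<xi> + B2))"
      using C p that B2(2)[of x] by (intro mult_left_mono add_mono powr_mono2) (auto intro: norm_triangle_le)
    finally show ?thesis using True by (simp add: w_def algebra_simps)
  qed (use C B2 in \<open>simp add: w_def\<close>)
  have hm: "(\<lambda>x. indicator ?B x * h (v' x) (\<xi> + D\<Phi> x)) \<in> borel_measurable lborel"
    if "v' \<in> borel_measurable borel" for v'
    using that by (intro borel_measurable_times borel_measurable_continuous_compose2[OF cont] borel_measurable_indicator) auto
  show "integrable lborel (\<lambda>x. indicator ?B x * h (v x) (\<xi> + D\<Phi> x))"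
    by (rule Bochner_Integration.integrable_bound[OF iw hm]) (use hw in \<open>auto intro!: AE_I2 order_trans[OF _ abs_ge_self]\<close>)
  have le1: "t \<le> 1 + t powr p" if "t \<ge> 0" for t :: real
  proof (cases "t \<le> 1")
    case False
    then have "t powr 1 \<le> t powr p" using p by (intro powr_mono) auto
    then show ?thesis using False by simp
  qed (simp add: add_increasing2)
  define w1 where "w1 = (\<lambda>x. indicator ?B x + indicator ?B x * norm (v x) powr p)"
  have iw1: "integrable lborel w1" unfolding w1_def using vi iB by simp
  have w1: "norm (indicator ?B x *\<^sub>R v') \<le> w1 x" if "norm v' \<le> norm (v x)" for x v'
    using le1[of "norm (v x)"] that by (auto simp: w1_def indicator_def)
  have sm: "(\<lambda>x. indicator ?B x *\<^sub>R v' x) \<in> borel_measurable lborel" if "v' \<in> borel_measurable borel" for v' :: "real^'N \<Rightarrow> real^'m"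
    using that by (intro borel_measurable_scaleR borel_measurable_indicator) auto
  show iv: "integrable lborel (\<lambda>x. indicator ?B x *\<^sub>R v x)"
    by (rule Bochner_Integration.integrable_bound[OF iw1]) (use w1 sm in \<open>auto intro!: AE_I2 order_trans[OF _ abs_ge_self]\<close>)
  \<comment> \<open>Large values are replaced by 0, not projected to the sphere of radius
    \<open>m\<close>; each value then equals \<open>v x\<close> from some index on.\<close>
  define vm where "vm m x = (if norm (v x) \<le> real m then v x else 0)" for m x
  have [measurable]: "vm m \<in> borel_measurable borel" for m unfolding vm_def[abs_def] by measurable
  have vm_le: "norm (vm m x) \<le> norm (v x)" "norm (vm m x) \<le> real m" for m x by (auto simp: vm_def)
  have vm_lim: "(\<lambda>m. vm m x) \<longlonglongrightarrow> v x" for x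
  proof (rule tendsto_eventually)
    obtain M :: nat where "norm (v x) \<le> real M" using real_arch_simple by blast
    then show "\<forall>\<^sub>F m in sequentially. vm m x = v x"
      by (auto simp: vm_def eventually_sequentially intro!: exI[of _ M])
  qed
  have ivm: "integrable lborel (\<lambda>x. indicator ?B x *\<^sub>R vm m x)" for m
    by (rule Bochner_Integration.integrable_bound[OF iw1]) (use w1 vm_le(1) sm in \<open>auto intro!: AE_I2 order_trans[OF _ abs_ge_self]\<close>)
  define a where "a m = (1 / b) *\<^sub>R (LBINT x. indicator ?B x *\<^sub>R vm m x)" for m
  have "(\<lambda>m. \<integral>x. indicator ?B x *\<^sub>R vm m x \<partial>lborel) \<longlonglongrightarrow> (LBINT x. indicator ?B x *\<^sub>R v x)"
    by (rule integral_dominated_convergence[OF _ _ iw1])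
      (use w1 vm_le(1) sm in \<open>auto intro!: AE_I2 tendsto_scaleR vm_lim\<close>)
  then have a_lim: "a \<longlonglongrightarrow> (1 / b) *\<^sub>R (LBINT x. indicator ?B x *\<^sub>R v x)"
    unfolding a_def by (intro tendsto_scaleR tendsto_const)
  have main: "b * h (a m) \<xi> \<le> (LBINT x. indicator ?B x * h (vm m x) (\<xi> + D\<Phi> x))" for m
  proof -
    \<comment> \<open>Perturbations must be bounded with mean 0, hence the truncated field minus its
      mean; the inequality is tested at that mean.\<close>
    define \<eta> where "\<eta> = (\<lambda>x. indicator ?B x *\<^sub>R (vm m x - a m))"
    have \<eta>: "\<eta> \<in> borel_measurable borel" "\<And>x. norm (\<eta> x) \<le> real m + norm (a m)" "\<And>x. x \<notin> ?B \<Longrightarrow> \<eta> x = 0"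
      using vm_le(2) by (auto simp: \<eta>_def indicator_def intro!: order_trans[OF norm_triangle_ineq4] add_mono)
    have "(LBINT x. \<eta> x) = (LBINT x. indicator ?B x *\<^sub>R vm m x) - b *\<^sub>R a m"
      using ivm iB by (simp add: \<eta>_def scaleR_diff_right b_def)
    also have "\<dots> = 0" using b by (simp add: a_def)
    finally have "(LBINT x. \<eta> x) = 0" .
    from convex_quasiconvex_C1[OF h cont r \<Phi> \<eta> this, where v="a m" and \<xi>=\<xi>]
    have "0 \<le> (LBINT x. h (a m + \<eta> x) (\<xi> + D\<Phi> x) - h (a m) \<xi>)" .
    also have "\<dots> = (LBINT x. indicator ?B x * h (vm m x) (\<xi> + D\<Phi> x) - h (a m) \<xi> * indicator ?B x)"
      using D0' by (intro Bochner_Integration.integral_cong) (auto simp: \<eta>_def indicator_def)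
    also have "\<dots> = (LBINT x. indicator ?B x * h (vm m x) (\<xi> + D\<Phi> x)) - h (a m) \<xi> * b"
    proof -
      have "integrable lborel (\<lambda>x. indicator ?B x * h (vm m x) (\<xi> + D\<Phi> x))"
        by (rule Bochner_Integration.integrable_bound[OF iw hm]) (use hw vm_le in \<open>auto intro!: AE_I2 order_trans[OF _ abs_ge_self]\<close>)
      then show ?thesis using iB by (simp add: b_def)
    qed
    finally show ?thesis by (simp add: mult.commute)
  qed
  have "(\<lambda>m. \<integral>x. indicator ?B x * h (vm m x) (\<xi> + D\<Phi> x) \<partial>lborel) \<longlonglongrightarrow> (LBINT x. indicator ?B x * h (v x) (\<xi> + D\<Phi> x))"
    by (rule integral_dominated_convergence[OF _ _ iw])
      (use hw vm_le(1) hm in \<open>auto intro!: AE_I2 tendsto_mult tendsto_continuous_compose2[OF cont] vm_lim\<close>)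
  moreover have "(\<lambda>m. b * h (a m) \<xi>) \<longlonglongrightarrow> b * h ((1 / b) *\<^sub>R (LBINT x. indicator ?B x *\<^sub>R v x)) \<xi>"
    by (intro tendsto_mult tendsto_const tendsto_continuous_compose2[OF cont] a_lim)
  ultimately have "b * h ((1 / b) *\<^sub>R (LBINT x. indicator ?B x *\<^sub>R v x)) \<xi> \<le> (LBINT x. indicator ?B x * h (v x) (\<xi> + D\<Phi> x))"
    using main by (meson LIMSEQ_le)
  then show "measure lborel ?B * h ((1 / measure lborel ?B) *\<^sub>R (LBINT x. indicator ?B x *\<^sub>R v x)) \<xi>
     \<le> (LBINT x. indicator ?B x * h (v x) (\<xi> + D\<Phi> x))" by (simp add: b_def)
qed

subsection \<open>Truncation and cutoff on a ball\<close>

definition pos_sq :: "real \<Rightarrow> real" where "pos_sq t = (max 0 t)\<^sup>2"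

lemma pos_sq_deriv: "(pos_sq has_real_derivative 2 * max 0 t) (at t)"
proof (cases t "0 :: real" rule: linorder_cases)
  case less
  have "((\<lambda>t. 0) has_real_derivative 0) (at t)" by simp
  then have "(pos_sq has_real_derivative 0) (at t)"
    by (rule has_field_derivative_transform_within_open[where S="{..<0}"]) (use less in \<open>auto simp: pos_sq_def\<close>)
  then show ?thesis using less by simp
next
  case equal
  have "((\<lambda>y. (pos_sq y - pos_sq 0) / (y - 0)) \<longlongrightarrow> max 0 0) (at (0 :: real))"
  proof (rule tendsto_cong[THEN iffD2])
    show "\<forall>\<^sub>F y in at 0. (pos_sq y - pos_sq 0) / (y - 0) = max 0 y"
      by (auto simp: pos_sq_def eventually_at_filter power2_eq_square max_def)
    show "((\<lambda>y. max 0 y) \<longlongrightarrow> max 0 (0 :: real)) (at 0)" by (intro tendsto_intros)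
  qed
  then show ?thesis using equal by (simp add: has_field_derivative_iff)
next
  case greater
  have "((\<lambda>t. t\<^sup>2) has_real_derivative 2 * t) (at t)" by (auto intro!: derivative_eq_intros)
  then have "(pos_sq has_real_derivative 2 * t) (at t)"
    by (rule has_field_derivative_transform_within_open[where S="{0<..}"]) (use greater in \<open>auto simp: pos_sq_def\<close>)
  then show ?thesis using greater by simp
qed

text \<open>A C1 transition from 1 on \<open>t \<le> 0\<close> to 0 on \<open>t \<ge> 1\<close>:
  since \<open>pos_sq\<close> has vanishing slope at 0, the inner copy flattens the left end and the
  outer copy the right end. The chain rule gives a slope of modulus at most 4.\<close>

definition step_down :: "real \<Rightarrow> real" where "step_down t = pos_sq (1 - pos_sq t)"

definition step_down' :: "real \<Rightarrow> real" where "step_down' t = - 4 * max 0 (1 - pos_sq t) * max 0 t"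

lemma step_down_deriv: "(step_down has_real_derivative step_down' t) (at t)"
proof -
  have "((\<lambda>t. pos_sq (1 - pos_sq t)) has_real_derivative (2 * max 0 (1 - pos_sq t)) * (0 - 2 * max 0 t)) (at t)"
    by (rule DERIV_chain2[OF pos_sq_deriv]) (intro DERIV_diff DERIV_const pos_sq_deriv)
  then show ?thesis by (simp add: step_down_def[abs_def] step_down'_def mult.assoc)
qed

lemma continuous_step_down: "continuous_on UNIV step_down" "continuous_on UNIV step_down'"
proof -
  show "continuous_on UNIV step_down"
    by (meson DERIV_isCont continuous_at_imp_continuous_on step_down_deriv)
  have "continuous_on UNIV pos_sq"
    by (meson DERIV_isCont continuous_at_imp_continuous_on pos_sq_deriv)
  then show "continuous_on UNIV step_down'"
    unfolding step_down'_def[abs_def] by (intro continuous_intros)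
qed

lemma step_down_simps:
  "t \<le> 0 \<Longrightarrow> step_down t = 1" "t \<le> 0 \<Longrightarrow> step_down' t = 0"
  "1 \<le> t \<Longrightarrow> step_down t = 0" "1 \<le> t \<Longrightarrow> step_down' t = 0"
proof -
  have "1 \<le> pos_sq t" if "1 \<le> t" using that by (simp add: pos_sq_def)
  then show "1 \<le> t \<Longrightarrow> step_down t = 0" "1 \<le> t \<Longrightarrow> step_down' t = 0"
    by (auto simp: step_down_def step_down'_def pos_sq_def[of "1 - _"])
qed (auto simp: step_down_def step_down'_def pos_sq_def)

lemma step_down_bounds: "0 \<le> step_down t" "step_down t \<le> 1" "\<bar>step_down' t\<bar> \<le> 4"
proof -
  have m: "0 \<le> max 0 (1 - pos_sq t)" "max 0 (1 - pos_sq t) \<le> 1" by (auto simp: pos_sq_def)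
  show "0 \<le> step_down t" by (simp add: step_down_def pos_sq_def)
  show "step_down t \<le> 1" unfolding step_down_def pos_sq_def[of "1 - _"] using m by (simp add: power_le_one)
  show "\<bar>step_down' t\<bar> \<le> 4"
  proof (cases "0 \<le> t \<and> t \<le> 1")
    case True
    then have "max 0 (1 - pos_sq t) * max 0 t \<le> 1" using m by (intro mult_le_one) auto
    then show ?thesis using m by (simp add: step_down'_def abs_mult)
  qed (use step_down_simps(2,4)[of t] in fastforce)
qed

lemma norm_outer_le: "norm (\<chi> j. (y $ j) *\<^sub>R (g :: real^'N::finite)) \<le> norm (y :: real^'n::finite) * norm g"
  by (simp add: norm_vec_def[of y] norm_vec_def[of "\<chi> j. (y $ j) *\<^sub>R g"] L2_set_left_distrib)

lemma norm_combination_le: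
  fixes A :: "real^'N::finite^'n::finite"
  shows "norm (\<Sum>j\<in>UNIV. (y $ j) *\<^sub>R (A $ j)) \<le> norm y * norm A"
proof -
  have "norm (\<Sum>j\<in>UNIV. (y $ j) *\<^sub>R (A $ j)) \<le> (\<Sum>j\<in>UNIV. \<bar>norm (y $ j)\<bar> * \<bar>norm (A $ j)\<bar>)"
    by (rule order_trans[OF norm_sum]) simp
  also have "\<dots> \<le> L2_set (\<lambda>j. norm (y $ j)) UNIV * L2_set (\<lambda>j. norm (A $ j)) UNIV" by (rule L2_set_mult_ineq)
  finally show ?thesis by (simp add: norm_vec_def[of y] norm_vec_def[of A])
qed

text \<open>\<Phi> is \<open>y\<close> times one cutoff in \<open>(norm (y x))\<^sup>2\<close> and
  one in \<open>(norm (x - x0))\<^sup>2\<close>; squares keep both differentiable. Where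
  \<open>(norm (y x))\<^sup>2 \<le> 2 * A\<close>, the truncation contributes at most \<open>8 / A *
  (norm (y x))\<^sup>2 * norm (Dy x) \<le> 16 * norm (Dy x)\<close>, whatever \<open>A\<close> is,
  which together with the main term gives 17. The cutoff in space contributes
  \<open>8 * K / r\<close> times \<open>norm (y x)\<close>; its transition stays in the ball of
  radius \<open>r\<close> by \<open>\<beta> + 1 / K \<le> 1\<close>.\<close>

lemma truncated_cutoff:
  fixes y :: "real^'N::finite \<Rightarrow> real^'n::finite"
  assumes y: "C1_map y Dy" and r: "r > 0" and A: "A > 0" and K: "K > 0" and \<beta>: "\<beta> + 1 / K \<le> 1"
  shows "\<exists>\<Phi> D\<Phi>. C1_map \<Phi> D\<Phi>
    \<and> (\<forall>x. (norm (y x))\<^sup>2 \<le> A \<longrightarrow> (norm (x - x0))\<^sup>2 \<le> \<beta> * r\<^sup>2 \<longrightarrow> D\<Phi> x = Dy x)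
    \<and> (\<forall>x. \<not> ((norm (y x))\<^sup>2 \<le> 2 * A \<and> (norm (x - x0))\<^sup>2 \<le> (\<beta> + 1 / K) * r\<^sup>2) \<longrightarrow> \<Phi> x = 0 \<and> D\<Phi> x = 0)
    \<and> (\<forall>x. (norm (y x))\<^sup>2 \<le> 2 * A \<longrightarrow> (norm (x - x0))\<^sup>2 \<le> (\<beta> + 1 / K) * r\<^sup>2 \<longrightarrow>
         norm (D\<Phi> x) \<le> 17 * norm (Dy x) + 8 * K / r * norm (y x))"
proof -
  \<comment> \<open>\<open>a\<close> runs from 0 to 1 while the squared norm of \<open>y\<close>
    runs from \<open>A\<close> to \<open>2 * A\<close>, and \<open>b\<close> while the squared
    relative radius runs from \<beta> to \<open>\<beta> + 1 / K\<close>. \<open>ga\<close> and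
    \<open>gb\<close> are their gradients, and \<open>c\<close> is the cutoff with gradient
    \<open>g\<close>.\<close>
  define a where "a x = (y x \<bullet> y x) / A - 1" for x
  define b where "b x = (((x - x0) \<bullet> (x - x0)) / r\<^sup>2 - \<beta>) * K" for x
  define ga where "ga x = (2 / A) *\<^sub>R (\<Sum>j\<in>UNIV. (y x $ j) *\<^sub>R (Dy x $ j))" for x
  define gb where "gb x = (2 * K / r\<^sup>2) *\<^sub>R (x - x0)" for x
  define c where "c x = step_down (a x) * step_down (b x)" for x
  define g where "g x = (step_down' (a x) * step_down (b x)) *\<^sub>R ga x + (step_down (a x) * step_down' (b x)) *\<^sub>R gb x" for x
  define \<Phi> where "\<Phi> x = c x *\<^sub>R y x" for x
  define D\<Phi> where "D\<Phi> x = c x *\<^sub>R Dy x + (\<chi> j. (y x $ j) *\<^sub>R g x)" for x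
  have yd: "(y has_derivative (\<lambda>h. Dy x *v h)) (at x)" for x using y by (simp add: C1_map_def)
  note yc = C1_map_continuous[OF y]
  have ad: "(a has_derivative (\<lambda>h. ga x \<bullet> h)) (at x)" for x
  proof -
    have "((\<lambda>x. (y x \<bullet> y x) * (1 / A) - 1) has_derivative (\<lambda>h. (y x \<bullet> (Dy x *v h) + (Dy x *v h) \<bullet> y x) * (1 / A) - 0)) (at x)"
      by (intro has_derivative_diff has_derivative_mult_left has_derivative_inner yd has_derivative_const)
    moreover have "(y x \<bullet> (Dy x *v h) + (Dy x *v h) \<bullet> y x) * (1 / A) - 0 = ga x \<bullet> h" for h
    proof -
      have "y x \<bullet> (Dy x *v h) = (\<Sum>j\<in>UNIV. (y x $ j) *\<^sub>R (Dy x $ j)) \<bullet> h"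
        by (simp add: inner_sum_left inner_vec_def[of "y x"] matrix_vector_mult_nth)
      then show ?thesis by (simp add: ga_def inner_commute[of "_ *v _"])
    qed
    ultimately show ?thesis by (simp add: a_def[abs_def])
  qed
  have bd: "(b has_derivative (\<lambda>h. gb x \<bullet> h)) (at x)" for x
  proof -
    have "((\<lambda>x. (((x - x0) \<bullet> (x - x0)) * (1 / r\<^sup>2) - \<beta>) * K) has_derivative
        (\<lambda>h. (((x - x0) \<bullet> (h - 0) + (h - 0) \<bullet> (x - x0)) * (1 / r\<^sup>2) - 0) * K)) (at x)"
      by (intro has_derivative_diff has_derivative_mult_left has_derivative_inner has_derivative_const has_derivative_ident)
    then show ?thesis
      by (simp add: b_def[abs_def] gb_def inner_commute[of "x - x0"] mult_ac)
  qed
  have sd: "((\<lambda>x. step_down (f x)) has_derivative (\<lambda>h. step_down' (f x) * (G \<bullet> h))) (at x)"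
    if "(f has_derivative (\<lambda>h. G \<bullet> h)) (at x)" for f x and G :: "real^'N"
    using has_derivative_compose[OF that step_down_deriv[unfolded has_field_derivative_def]] by simp
  have cd: "(c has_derivative (\<lambda>h. g x \<bullet> h)) (at x)" for x
    unfolding c_def[abs_def]
    by (rule has_derivative_eq_rhs[OF has_derivative_mult[OF sd[OF ad] sd[OF bd]]])
      (simp add: g_def inner_add_left mult_ac add.commute)
  have \<Phi>d: "(\<Phi> has_derivative (\<lambda>h. D\<Phi> x *v h)) (at x)" for x
    unfolding \<Phi>_def[abs_def]
  proof (rule has_derivative_eq_rhs[OF has_derivative_scaleR[OF cd yd]], rule ext)
    fix h
    show "c x *\<^sub>R (Dy x *v h) + (g x \<bullet> h) *\<^sub>R y x = D\<Phi> x *v h"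
      by (simp add: D\<Phi>_def vec_eq_iff matrix_vector_mult_nth inner_add_left mult_ac)
  qed
  have conts: "continuous_on UNIV a" "continuous_on UNIV b" "continuous_on UNIV c"
    using ad bd cd by (auto simp: continuous_on_eq_continuous_at intro: has_derivative_continuous)
  have sc: "continuous_on UNIV (\<lambda>x. step_down (f x))" "continuous_on UNIV (\<lambda>x. step_down' (f x))"
    if "continuous_on UNIV f" for f :: "real^'N \<Rightarrow> real"
    using continuous_on_compose2[OF continuous_step_down(1) that] continuous_on_compose2[OF continuous_step_down(2) that] by auto
  have "continuous_on UNIV g"
    unfolding g_def[abs_def] ga_def[abs_def] gb_def[abs_def]
    by (intro continuous_intros sc conts yc)
  then have "continuous_on UNIV D\<Phi>"
    unfolding D\<Phi>_def[abs_def] by (intro continuous_intros continuous_on_vec_lambda conts yc)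
  then have C1: "C1_map \<Phi> D\<Phi>" using \<Phi>d by (simp add: C1_map_def)
  have yy: "y x \<bullet> y x = (norm (y x))\<^sup>2" "(x - x0) \<bullet> (x - x0) = (norm (x - x0))\<^sup>2" for x
    by (simp_all add: dot_square_norm)
  have 1: "D\<Phi> x = Dy x" if "(norm (y x))\<^sup>2 \<le> A" "(norm (x - x0))\<^sup>2 \<le> \<beta> * r\<^sup>2" for x
  proof -
    have "a x \<le> 0" using that(1) A by (simp add: a_def yy)
    moreover have "b x \<le> 0" using that(2) r K by (simp add: b_def yy field_simps mult_le_0_iff)
    ultimately have "c x = 1" "g x = 0" by (simp_all add: c_def g_def step_down_simps)
    then show ?thesis by (simp add: D\<Phi>_def vec_eq_iff)
  qed
  have 2: "\<Phi> x = 0 \<and> D\<Phi> x = 0" if "\<not> ((norm (y x))\<^sup>2 \<le> 2 * A \<and> (norm (x - x0))\<^sup>2 \<le> (\<beta> + 1 / K) * r\<^sup>2)" for x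
  proof -
    have "1 \<le> a x \<or> 1 \<le> b x"
    proof (cases "(norm (y x))\<^sup>2 \<le> 2 * A")
      case True
      then have "(norm (x - x0))\<^sup>2 > (\<beta> + 1 / K) * r\<^sup>2" using that by simp
      then have "(norm (x - x0))\<^sup>2 / r\<^sup>2 - \<beta> > 1 / K" using r by (simp add: field_simps)
      then have "b x > 1" using K by (simp add: b_def yy field_simps)
      then show ?thesis by simp
    next
      case False
      then show ?thesis using A by (simp add: a_def yy field_simps)
    qed
    then have "c x = 0" "g x = 0" by (auto simp: c_def g_def step_down_simps)
    then show ?thesis by (simp add: \<Phi>_def D\<Phi>_def vec_eq_iff)
  qed
  have 3: "norm (D\<Phi> x) \<le> 17 * norm (Dy x) + 8 * K / r * norm (y x)"
    if yA: "(norm (y x))\<^sup>2 \<le> 2 * A" and "(norm (x - x0))\<^sup>2 \<le> (\<beta> + 1 / K) * r\<^sup>2" for x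
  proof -
    have "(norm (x - x0))\<^sup>2 \<le> 1 * r\<^sup>2" using that(2) \<beta> by (rule order_trans[OF _ mult_right_mono]) auto
    then have xr: "norm (x - x0) \<le> r" using r by (simp add: power2_le_iff_abs_le)
    have c: "\<bar>c x\<bar> \<le> 1" using step_down_bounds by (auto simp: c_def abs_mult intro!: mult_le_one)
    \<comment> \<open>Each factor \<open>step_down\<close> only helps; the slope 4 turns the bounds
      \<open>2 / A\<close> and \<open>2 * K / r\<close> for \<open>ga\<close> and \<open>gb\<close>
      into the constants 8.\<close>
    have s4: "\<bar>step_down' t * step_down t'\<bar> \<le> 4" for t t'
      using mult_mono[OF step_down_bounds(3)[of t] step_down_bounds(2)[of t']] step_down_bounds(1)[of t'] by (simp add: abs_mult)
    have na: "norm (ga x) \<le> (2 / A) * (norm (y x) * norm (Dy x))"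
      using norm_combination_le[of "y x" "Dy x"] A by (simp add: ga_def divide_right_mono)
    have nb: "norm (gb x) \<le> 2 * K / r"
    proof -
      have "norm (gb x) = 2 * K / r\<^sup>2 * norm (x - x0)" using K by (simp add: gb_def)
      also have "\<dots> \<le> 2 * K / r\<^sup>2 * r" using xr K by (intro mult_left_mono) auto
      finally show ?thesis using r by (simp add: power2_eq_square)
    qed
    have "norm (g x) \<le> 4 * norm (ga x) + 4 * norm (gb x)"
      unfolding g_def using s4[of "a x" "b x"] s4[of "b x" "a x"]
      by (intro norm_triangle_mono) (auto simp: mult.commute intro!: mult_right_mono mult_left_mono)
    also have "\<dots> \<le> 4 * ((2 / A) * (norm (y x) * norm (Dy x))) + 4 * (2 * K / r)"
      using na nb by (intro add_mono mult_left_mono) auto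
    finally have ng: "norm (g x) \<le> 8 / A * norm (y x) * norm (Dy x) + 8 * K / r" by (simp add: mult_ac)
    have "norm (D\<Phi> x) \<le> norm (Dy x) + norm (y x) * norm (g x)"
      unfolding D\<Phi>_def using c
      by (intro norm_triangle_mono norm_outer_le) (simp add: mult_left_le_one_le)
    also have "norm (y x) * norm (g x) \<le> norm (y x) * (8 / A * norm (y x) * norm (Dy x) + 8 * K / r)"
      using ng by (intro mult_left_mono) auto
    also have "\<dots> = (norm (y x))\<^sup>2 / A * (8 * norm (Dy x)) + 8 * K / r * norm (y x)"
      by (simp add: power2_eq_square algebra_simps)
    also have "(norm (y x))\<^sup>2 / A * (8 * norm (Dy x)) \<le> 2 * (8 * norm (Dy x))"
      using yA A by (intro mult_right_mono) (auto simp: field_simps)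
    finally show ?thesis by simp
  qed
  show ?thesis using C1 1 2 3 by (intro exI[of _ \<Phi>] exI[of _ D\<Phi>]) blast
qed

lemma integrable_on_ball_continuous:
  fixes g :: "'a::euclidean_space \<Rightarrow> real"
  assumes "continuous_on UNIV g"
  shows "integrable lborel (\<lambda>x. indicator (ball x0 r) x * g x)"
proof -
  have "integrable lborel (\<lambda>x. indicator (cball x0 r) x *\<^sub>R g x)"
    by (intro borel_integrable_compact compact_cball continuous_on_subset[OF assms]) auto
  then have "integrable lborel (\<lambda>x. indicator (ball x0 r) x *\<^sub>R (indicator (cball x0 r) x *\<^sub>R g x))"
    by (rule integrable_bounded_scaleR[where B=1]) (auto simp: indicator_def)
  then show ?thesis by (rule back_subst[of "integrable lborel"]) (auto simp: indicator_def fun_eq_iff)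
qed

lemma integrable_indicator_subset:
  fixes g :: "'a::euclidean_space \<Rightarrow> real"
  assumes "integrable lborel (\<lambda>x. indicator B x * g x)" "G \<in> sets borel" "G \<subseteq> B"
  shows "integrable lborel (\<lambda>x. indicator G x * g x)"
proof -
  have "integrable lborel (\<lambda>x. indicator G x *\<^sub>R (indicator B x * g x))"
    using assms by (intro integrable_bounded_scaleR[where B=1]) (auto simp: indicator_def)
  then show ?thesis
    by (rule back_subst[of "integrable lborel"]) (use assms(3) in \<open>auto simp: indicator_def fun_eq_iff\<close>)
qed

text \<open>The perturbation is \<open>w - l\<close>, truncated at one of the levels \<open>r\<^sup>2 2\<^sup>i\<close> of \<open>|w - l|\<^sup>2\<close> and cut off in
  space; among \<open>M\<close> disjoint transition regions one carries at most the fraction \<open>1 / M\<close> of the energy.\<close>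

lemma cell_inequality:
  fixes h :: "real^'m::finite \<Rightarrow> real^'N::finite^'n::finite \<Rightarrow> real" and u0 :: "real^'n" and \<xi> :: "real^'N^'n"
  assumes h: "convex_quasiconvex h" and cont: "continuous_on UNIV (\<lambda>(v, \<xi>). h v \<xi>)"
    and h0: "\<And>v \<xi>. 0 \<le> h v \<xi>" and growth: "\<And>v \<xi>. h v \<xi> \<le> C * (1 + norm v powr p + norm \<xi>)"
    and p: "1 \<le> p" and C: "0 \<le> C" and r: "0 < r" and \<sigma>: "0 < \<sigma>" "\<sigma> < 1" and M: "0 < M"
    and w: "C1_map w Dw"
    and v [measurable]: "v \<in> borel_measurable borel"
    and vi: "integrable lborel (\<lambda>x. indicator (ball x0 r) x * norm (v x) powr p)"
  defines "y \<equiv> \<lambda>x. w x - (u0 + \<xi> *v (x - x0))"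
  shows "\<exists>G. G \<in> sets borel \<and> G \<subseteq> ball x0 r \<and> (\<forall>x\<in>G. (norm (y x))\<^sup>2 \<le> r\<^sup>2 * 2 ^ M)
    \<and> measure lborel (ball x0 r - G) \<le> (1 - \<sigma> ^ CARD('N)) * measure lborel (ball x0 r)
        + (LBINT x. indicator (ball x0 r) x * norm (y x)) / r
    \<and> measure lborel (ball x0 r) * h ((1 / measure lborel (ball x0 r)) *\<^sub>R (LBINT x. indicator G x *\<^sub>R v x)) \<xi>
      \<le> (LBINT x. indicator G x * h (v x) (Dw x))
        + 18 * C * (1 + norm \<xi>) / M * (LBINT x. indicator (ball x0 r) x * (1 + norm (Dw x)))
        + 16 * C * M / (1 - \<sigma>\<^sup>2) * ((LBINT x. indicator (ball x0 r) x * norm (y x)) / r)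
        + C * (1 + norm \<xi>) * measure lborel (ball x0 r - G)"
proof -
  let ?B = "ball x0 r"
  \<comment> \<open>\<open>M\<close> steps of width \<open>1 / K\<close> lead the squared relative
    radius from \<open>\<sigma>\<^sup>2\<close> to the midpoint of \<open>\<sigma>\<^sup>2\<close>
    and 1, so all the shells lie strictly inside the ball.\<close>
  define K where "K = 2 * real M / (1 - \<sigma>\<^sup>2)"
  define \<beta> where "\<beta> i = \<sigma>\<^sup>2 + real i / K" for i
  have \<sigma>2: "\<sigma>\<^sup>2 < 1" using \<sigma> by (simp add: power_less_one_iff abs_square_less_1)
  have K: "K > 0" using M \<sigma>2 by (simp add: K_def)
  have \<beta>_mono: "\<beta> i \<le> \<beta> j" if "i \<le> j" for i j using that K by (simp add: \<beta>_def divide_right_mono)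
  have \<beta>M: "\<beta> M < 1"
  proof -
    have "real M / K = (1 - \<sigma>\<^sup>2) / 2" using M \<sigma>2 by (simp add: K_def field_simps)
    then show ?thesis using \<sigma>2 by (simp add: \<beta>_def field_simps)
  qed
  have Dy: "C1_map y (\<lambda>x. Dw x - \<xi>)"
    unfolding C1_map_def y_def
  proof (intro conjI allI)
    fix x
    have "(w has_derivative (\<lambda>h. Dw x *v h)) (at x)" using w by (simp add: C1_map_def)
    moreover have "((\<lambda>x. u0 + \<xi> *v (x - x0)) has_derivative (\<lambda>h. \<xi> *v h)) (at x)"
    proof -
      have "((\<lambda>x. \<xi> *v x) has_derivative (\<lambda>h. \<xi> *v h)) (at (x - x0))"
        by (rule bounded_linear_imp_has_derivative) (simp add: linear_linear)
      then have "((\<lambda>x. \<xi> *v (x - x0)) has_derivative (\<lambda>h. \<xi> *v h)) (at x)"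
        by (rule has_derivative_compose[rotated]) (auto intro!: derivative_eq_intros)
      from has_derivative_add[OF has_derivative_const[of u0] this] show ?thesis by simp
    qed
    ultimately show "((\<lambda>x. w x - (u0 + \<xi> *v (x - x0))) has_derivative (\<lambda>h. (Dw x - \<xi>) *v h)) (at x)"
      by (rule has_derivative_eq_rhs[OF has_derivative_diff]) (simp add: matrix_vector_mult_diff_rdistrib)
  next
    show "continuous_on UNIV (\<lambda>x. Dw x - \<xi>)" using C1_map_continuous[OF w] by (intro continuous_intros)
  qed
  note yc = C1_map_continuous[OF Dy] and wc = C1_map_continuous[OF w]
  note [measurable] = borel_measurable_C1_map[OF Dy] borel_measurable_C1_map[OF w]
  \<comment> \<open>Both thresholds grow together, so that \<open>G (Suc i) - G i\<close> is the
    transition region of \<open>truncated_cutoff\<close> for \<open>A = r\<^sup>2 * 2 ^ i\<close>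
    and \<open>\<beta> i\<close>. At level 0 the threshold for the norm of \<open>y\<close> is
    \<open>r\<close>.\<close>
  define G where "G i = {x. (norm (y x))\<^sup>2 \<le> r\<^sup>2 * 2 ^ i \<and> (norm (x - x0))\<^sup>2 \<le> \<beta> i * r\<^sup>2}" for i
  have G_borel [measurable]: "G i \<in> sets borel" for i unfolding G_def by measurable
  have G_mono: "G i \<subseteq> G j" if "i \<le> j" for i j
  proof -
    have "r\<^sup>2 * 2 ^ i \<le> r\<^sup>2 * 2 ^ j" using that by (intro mult_left_mono power_increasing) auto
    moreover have "\<beta> i * r\<^sup>2 \<le> \<beta> j * r\<^sup>2" using \<beta>_mono[OF that] by (intro mult_right_mono) auto
    ultimately show ?thesis by (auto simp: G_def)
  qed
  have G_sub: "G i \<subseteq> ?B" if "i \<le> M" for i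
  proof
    fix x assume "x \<in> G i"
    then have "(norm (x - x0))\<^sup>2 \<le> \<beta> M * r\<^sup>2" using G_mono[OF that] by (auto simp: G_def)
    also have "\<dots> < 1 * r\<^sup>2" using \<beta>M r by (intro mult_strict_right_mono) auto
    finally have "norm (x - x0) < r" using r by (simp add: power_less_imp_less_base)
    then show "x \<in> ?B" by (simp add: dist_norm norm_minus_commute)
  qed
  define g where "g x = 1 + norm (Dw x)" for x
  have ig: "integrable lborel (\<lambda>x. indicator ?B x * g x)"
    unfolding g_def by (intro integrable_on_ball_continuous continuous_intros wc)
  have iB: "integrable lborel (indicator ?B :: real^'N \<Rightarrow> real)" using emeasure_lborel_ball_finite[of x0 r] by simp
  have iy: "integrable lborel (\<lambda>x. indicator ?B x * norm (y x))"
    by (intro integrable_on_ball_continuous continuous_intros yc)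
  define I where "I = (LBINT x. indicator ?B x * norm (y x))"
  have igG: "integrable lborel (\<lambda>x. indicator (G i) x * g x)" if "i \<le> M" for i
    by (rule integrable_indicator_subset[OF ig G_borel G_sub[OF that]])
  \<comment> \<open>Pigeonhole by telescoping: the \<open>M\<close> increments of the integral of
    \<open>g\<close> over the nested sets sum up to at most the integral over the ball.\<close>
  have "\<exists>i<M. (LBINT x. indicator (G (Suc i)) x * g x) - (LBINT x. indicator (G i) x * g x)
      \<le> (LBINT x. indicator ?B x * g x) / M"
  proof (rule ccontr)
    assume "\<not> ?thesis"
    then have *: "(LBINT x. indicator ?B x * g x) / M
      < (LBINT x. indicator (G (Suc i)) x * g x) - (LBINT x. indicator (G i) x * g x)" if "i < M" for i
      using that by force
    have "(\<Sum>i<M. (LBINT x. indicator ?B x * g x) / M)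
       < (\<Sum>i<M. (LBINT x. indicator (G (Suc i)) x * g x) - (LBINT x. indicator (G i) x * g x))"
      by (rule sum_strict_mono) (use M * in auto)
    also have "\<dots> = (LBINT x. indicator (G M) x * g x) - (LBINT x. indicator (G 0) x * g x)"
      by (rule sum_lessThan_telescope)
    also have "\<dots> \<le> (LBINT x. indicator (G M) x * g x)"
      by (simp add: g_def integral_nonneg_AE)
    also have "\<dots> \<le> (LBINT x. indicator ?B x * g x)"
      using G_sub[of M] by (intro integral_mono igG ig) (auto simp: indicator_def g_def)
    finally show False using M by simp
  qed
  then obtain i where i: "i < M"
    and pig: "(LBINT x. indicator (G (Suc i)) x * g x) - (LBINT x. indicator (G i) x * g x)
      \<le> (LBINT x. indicator ?B x * g x) / M" by blast
  define A where "A = r\<^sup>2 * 2 ^ i"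
  have A: "A > 0" "2 * A = r\<^sup>2 * 2 ^ Suc i" using r by (auto simp: A_def)
  have \<beta>S: "\<beta> i + 1 / K = \<beta> (Suc i)" by (simp add: \<beta>_def add_divide_distrib)
  have "\<beta> (Suc i) \<le> \<beta> M" using i by (intro \<beta>_mono) auto
  then have \<beta>le: "\<beta> i + 1 / K \<le> 1" using \<beta>M \<beta>S by simp
  obtain \<Phi> D\<Phi> where \<Phi>: "C1_map \<Phi> D\<Phi>"
    and "\<forall>x. (norm (y x))\<^sup>2 \<le> A \<longrightarrow> (norm (x - x0))\<^sup>2 \<le> \<beta> i * r\<^sup>2 \<longrightarrow> D\<Phi> x = Dw x - \<xi>"
    and "\<forall>x. \<not> ((norm (y x))\<^sup>2 \<le> 2 * A \<and> (norm (x - x0))\<^sup>2 \<le> (\<beta> i + 1 / K) * r\<^sup>2) \<longrightarrow> \<Phi> x = 0 \<and> D\<Phi> x = 0"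
    and "\<forall>x. (norm (y x))\<^sup>2 \<le> 2 * A \<longrightarrow> (norm (x - x0))\<^sup>2 \<le> (\<beta> i + 1 / K) * r\<^sup>2 \<longrightarrow>
         norm (D\<Phi> x) \<le> 17 * norm (Dw x - \<xi>) + 8 * K / r * norm (y x)"
    using truncated_cutoff[OF Dy r A(1) K \<beta>le, of x0] by (elim exE conjE)
  then have \<Phi>1: "\<And>x. x \<in> G i \<Longrightarrow> D\<Phi> x = Dw x - \<xi>"
    and \<Phi>2: "\<And>x. x \<notin> G (Suc i) \<Longrightarrow> \<Phi> x = 0 \<and> D\<Phi> x = 0"
    and \<Phi>3: "\<And>x. x \<in> G (Suc i) \<Longrightarrow> norm (D\<Phi> x) \<le> 17 * norm (Dw x - \<xi>) + 8 * K / r * norm (y x)"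
    unfolding \<beta>S A(2) by (simp_all add: G_def A_def)
  \<comment> \<open>The perturbation has to vanish outside a closed ball of radius strictly below
    \<open>r\<close>; the largest set \<open>G M\<close> provides it.\<close>
  define s where "s = r * sqrt (\<beta> M)"
  have \<beta>0: "0 \<le> \<beta> M" using K by (simp add: \<beta>_def)
  have s: "s < r" using r \<beta>M \<beta>0 by (simp add: s_def)
  have supp: "\<Phi> x = 0" if "x \<notin> cball x0 s" for x
  proof (rule ccontr)
    assume "\<Phi> x \<noteq> 0"
    then have "x \<in> G M" using \<Phi>2 G_mono[of "Suc i" M] i by auto
    then have "(norm (x - x0))\<^sup>2 \<le> s\<^sup>2" using \<beta>0 by (simp add: G_def s_def power_mult_distrib mult.commute)
    then have "norm (x - x0) \<le> s" using r \<beta>0 by (simp add: s_def power2_le_iff_abs_le)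
    then show False using that by (simp add: dist_norm norm_minus_commute)
  qed
  \<comment> \<open>Off \<open>G i\<close> the growth bound is then free of the term in
    \<open>v\<close>, so the pigeonhole has to control the gradient alone.\<close>
  define v' where "v' x = indicator (G i) x *\<^sub>R v x" for x
  have [measurable]: "v' \<in> borel_measurable borel" unfolding v'_def[abs_def] by measurable
  have v'i: "integrable lborel (\<lambda>x. indicator ?B x * norm (v' x) powr p)"
  proof -
    have "integrable lborel (\<lambda>x. indicator (G i) x *\<^sub>R (indicator ?B x * norm (v x) powr p))"
      by (rule integrable_bounded_scaleR[OF vi, where B=1]) (auto simp: indicator_def)
    then show ?thesis
      by (rule back_subst[of "integrable lborel"]) (use p in \<open>auto simp: indicator_def fun_eq_iff v'_def\<close>)
  qed
  have growth': "\<bar>h v \<xi>\<bar> \<le> C * (1 + norm v powr p + norm \<xi>)" for v \<xi> using h0[of v \<xi>] growth[of v \<xi>] by simp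
  have qc: "measure lborel ?B * h ((1 / measure lborel ?B) *\<^sub>R (LBINT x. indicator ?B x *\<^sub>R v' x)) \<xi>
      \<le> (LBINT x. indicator ?B x * h (v' x) (\<xi> + D\<Phi> x))"
    "integrable lborel (\<lambda>x. indicator ?B x * h (v' x) (\<xi> + D\<Phi> x))"
    by (rule convex_quasiconvex_Lp(1,2)[OF h cont growth' p C r s \<Phi>]; fact supp v'i \<open>v' \<in> borel_measurable borel\<close>)+
  have GB: "G i \<subseteq> ?B" "G (Suc i) \<subseteq> ?B" "G i \<subseteq> G (Suc i)" using G_sub[of i] G_sub[of "Suc i"] G_mono[of i "Suc i"] i by auto
  have eqv: "(\<lambda>x. indicator ?B x *\<^sub>R v' x) = (\<lambda>x. indicator (G i) x *\<^sub>R v x)"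
    using GB(1) by (auto simp: v'_def indicator_def fun_eq_iff)
  have ihG: "integrable lborel (\<lambda>x. indicator (G i) x * h (v x) (Dw x))"
  proof -
    have "integrable lborel (\<lambda>x. indicator (G i) x *\<^sub>R (indicator ?B x * h (v' x) (\<xi> + D\<Phi> x)))"
      by (rule integrable_bounded_scaleR[OF qc(2), where B=1]) (auto simp: indicator_def)
    then show ?thesis
      by (rule back_subst[of "integrable lborel"])
        (use GB(1) \<Phi>1 in \<open>auto simp: indicator_def fun_eq_iff v'_def\<close>)
  qed
  have iE: "integrable lborel (indicator (?B - G i) :: real^'N \<Rightarrow> real)"
    using integrable_indicator_subset[of ?B "\<lambda>_. 1" "?B - G i"] iB by simp
  let ?c = "18 * C * (1 + norm \<xi>)"
  \<comment> \<open>On \<open>G i\<close> the integrand is exactly \<open>h (v x) (Dw x)\<close>,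
    since \<open>\<xi> + D\<Phi> x = Dw x\<close>. On the transition region the growth bound is
    paid, with 18 = 17 + 1 absorbing \<xi> and the constant. On the rest of the ball only
    \<open>h 0 \<xi>\<close> remains.\<close>
  have pt: "indicator ?B x * h (v' x) (\<xi> + D\<Phi> x) \<le> indicator (G i) x * h (v x) (Dw x)
      + ?c * (indicator (G (Suc i)) x * g x - indicator (G i) x * g x)
      + 8 * C * K / r * (indicator ?B x * norm (y x)) + C * (1 + norm \<xi>) * indicator (?B - G i) x" for x
  proof -
    have g0: "g x \<ge> 0" by (simp add: g_def)
    consider "x \<notin> ?B" | "x \<in> G i" | "x \<in> G (Suc i)" "x \<notin> G i" | "x \<in> ?B" "x \<notin> G (Suc i)" by blast
    then show ?thesis
    proof cases
      case 1
      then show ?thesis using GB by (auto simp: indicator_def)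
    next
      case 2
      then have "x \<in> ?B" "x \<in> G (Suc i)" using GB by auto
      then show ?thesis using 2 \<Phi>1[OF 2] C K r by (simp add: v'_def)
    next
      case 3
      then have xB: "x \<in> ?B" using GB by auto
      have "h (v' x) (\<xi> + D\<Phi> x) \<le> C * (1 + norm (v' x) powr p + norm (\<xi> + D\<Phi> x))" by (rule growth)
      also have "\<dots> = C * (1 + norm (\<xi> + D\<Phi> x))" using 3 p by (simp add: v'_def)
      also have "\<dots> \<le> C * (18 * (1 + norm \<xi>) * g x + 8 * K / r * norm (y x))"
      proof (rule mult_left_mono[OF _ C])
        have "norm (\<xi> + D\<Phi> x) \<le> norm \<xi> + (17 * norm (Dw x - \<xi>) + 8 * K / r * norm (y x))"
          using \<Phi>3[OF 3(1)] by (rule norm_triangle_le[OF add_left_mono])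
        also have "\<dots> \<le> norm \<xi> + (17 * (norm (Dw x) + norm \<xi>) + 8 * K / r * norm (y x))"
          by (intro add_left_mono add_right_mono mult_left_mono norm_triangle_ineq4) auto
        finally have "1 + norm (\<xi> + D\<Phi> x) \<le> 18 * (1 + norm \<xi> + norm (Dw x)) + 8 * K / r * norm (y x)"
          using norm_ge_zero[of "Dw x"] unfolding distrib_left by linarith
        also have "18 * (1 + norm \<xi> + norm (Dw x)) \<le> 18 * (1 + norm \<xi>) * g x"
          by (simp add: g_def algebra_simps)
        finally show "1 + norm (\<xi> + D\<Phi> x) \<le> 18 * (1 + norm \<xi>) * g x + 8 * K / r * norm (y x)" by simp
      qed
      also have "\<dots> = ?c * g x + 8 * C * K / r * norm (y x)" by (simp add: algebra_simps)
      finally have "h (v' x) (\<xi> + D\<Phi> x) \<le> ?c * g x + 8 * C * K / r * norm (y x)" .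
      moreover have "0 \<le> C * (1 + norm \<xi>)" using C by simp
      ultimately show ?thesis using 3 xB by simp
    next
      case 4
      then have "x \<notin> G i" using GB by auto
      have "h (v' x) (\<xi> + D\<Phi> x) \<le> C * (1 + norm (v' x) powr p + norm (\<xi> + D\<Phi> x))" by (rule growth)
      also have "\<dots> = C * (1 + norm \<xi>)" using \<open>x \<notin> G i\<close> p \<Phi>2[OF 4(2)] by (simp add: v'_def)
      finally show ?thesis using 4 \<open>x \<notin> G i\<close> C K r by (simp add: add_increasing)
    qed
  qed
  have "measure lborel ?B * h ((1 / measure lborel ?B) *\<^sub>R (LBINT x. indicator (G i) x *\<^sub>R v x)) \<xi>
    \<le> (LBINT x. indicator ?B x * h (v' x) (\<xi> + D\<Phi> x))" using qc(1) by (simp only: eqv)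
  also have "\<dots> \<le> (LBINT x. indicator (G i) x * h (v x) (Dw x)
      + ?c * (indicator (G (Suc i)) x * g x - indicator (G i) x * g x)
      + 8 * C * K / r * (indicator ?B x * norm (y x)) + C * (1 + norm \<xi>) * indicator (?B - G i) x)"
    using i by (intro integral_mono qc(2) Bochner_Integration.integrable_add integrable_mult_right
        Bochner_Integration.integrable_diff ihG igG iy iE pt) auto
  also have "\<dots> = (LBINT x. indicator (G i) x * h (v x) (Dw x))
      + ?c * ((LBINT x. indicator (G (Suc i)) x * g x) - (LBINT x. indicator (G i) x * g x))
      + 8 * C * K / r * I + C * (1 + norm \<xi>) * measure lborel (?B - G i)"
    using ihG igG[of i] igG[of "Suc i"] i iy iE by (simp add: I_def)
  also have "\<dots> \<le> (LBINT x. indicator (G i) x * h (v x) (Dw x))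
      + ?c * ((LBINT x. indicator ?B x * g x) / M)
      + 8 * C * K / r * I + C * (1 + norm \<xi>) * measure lborel (?B - G i)"
    using pig C by (intro add_mono mult_left_mono order_refl) auto
  also have "?c * ((LBINT x. indicator ?B x * g x) / M) = ?c / M * (LBINT x. indicator ?B x * g x)" by simp
  also have "8 * C * K / r * I = 16 * C * M / (1 - \<sigma>\<^sup>2) * (I / r)" by (simp add: K_def)
  finally have main: "measure lborel ?B * h ((1 / measure lborel ?B) *\<^sub>R (LBINT x. indicator (G i) x *\<^sub>R v x)) \<xi>
    \<le> (LBINT x. indicator (G i) x * h (v x) (Dw x)) + ?c / M * (LBINT x. indicator ?B x * g x)
      + 16 * C * M / (1 - \<sigma>\<^sup>2) * (I / r) + C * (1 + norm \<xi>) * measure lborel (?B - G i)" .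
  have "measure lborel (?B - G i) \<le> (1 - \<sigma> ^ CARD('N)) * measure lborel ?B + I / r"
  proof -
    have ic: "integrable lborel (indicator (cball x0 (\<sigma> * r)) :: real^'N \<Rightarrow> real)"
      using emeasure_lborel_cball_finite[of x0 "\<sigma> * r"] by simp
    \<comment> \<open>A point of the ball outside \<open>G i\<close> lies in the outer shell of
      relative volume \<open>1 - \<sigma> ^ CARD('N)\<close>, or it violates the level
      \<open>r\<close> of \<open>norm (y x)\<close>; the second set is bounded by Chebyshev.\<close>
    have pt: "indicator (?B - G i) x \<le> (indicator ?B x - indicator (cball x0 (\<sigma> * r)) x) + (1 / r) * (indicator ?B x * norm (y x))" for x
    proof (cases "x \<in> ?B \<and> x \<notin> G i")
      case True
      then have "x \<notin> G 0" using G_mono[of 0 i] by auto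
      show ?thesis
      proof (cases "x \<in> cball x0 (\<sigma> * r)")
        case xc: True
        then have "(norm (x - x0))\<^sup>2 \<le> (\<sigma> * r)\<^sup>2" by (intro power_mono) (auto simp: dist_norm norm_minus_commute)
        then have "(norm (x - x0))\<^sup>2 \<le> \<beta> 0 * r\<^sup>2" by (simp add: \<beta>_def power_mult_distrib)
        then have "r\<^sup>2 < (norm (y x))\<^sup>2" using \<open>x \<notin> G 0\<close> by (simp add: G_def)
        then have "r < norm (y x)" by (rule power_less_imp_less_base) simp
        then show ?thesis using True xc r by (simp add: field_simps)
      next
        case False
        then show ?thesis using True r by simp
      qed
    next
      case False
      have "\<sigma> * r < r" using \<sigma> r by simp
      then have "cball x0 (\<sigma> * r) \<subseteq> ?B" by auto
      then show ?thesis using False r by (auto simp: indicator_def)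
    qed
    have "measure lborel (?B - G i) = (LBINT x. indicator (?B - G i) x)" by simp
    also have "\<dots> \<le> (LBINT x. (indicator ?B x - indicator (cball x0 (\<sigma> * r)) x) + (1 / r) * (indicator ?B x * norm (y x)))"
      by (intro integral_mono iE Bochner_Integration.integrable_add integrable_mult_right
        Bochner_Integration.integrable_diff iB ic iy pt)
    also have "\<dots> = measure lborel ?B - measure lborel (cball x0 (\<sigma> * r)) + I / r"
      using iB ic iy by (simp add: I_def)
    also have "measure lborel (cball x0 (\<sigma> * r)) = \<sigma> ^ CARD('N) * measure lborel ?B"
      using content_cball[of "\<sigma> * r" x0] content_ball[of r x0] \<sigma> r by (simp add: power_mult_distrib)
    finally show ?thesis by (simp add: left_diff_distrib)
  qed
  moreover have "(norm (y x))\<^sup>2 \<le> r\<^sup>2 * 2 ^ M" if "x \<in> G i" for x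
    using that G_mono[of i M] i by (auto simp: G_def)
  ultimately show ?thesis
    using main GB(1) unfolding g_def I_def by (intro exI[of _ "G i"] conjI ballI G_borel) auto
qed

subsection \<open>Smooth approximation in \<open>W\<^sup>1\<^sup>,\<^sup>1\<close>\<close>

text \<open>\<open>U\<close> and \<open>V\<close> live on the whole space, but they are tied to each
  other only inside \<Omega>. For extensions by zero nothing is claimed across the boundary, which
  is why the estimates below are restricted to compact subsets.\<close>

definition borel_weak_gradient ::
  "(real^'N::finite) set \<Rightarrow> (real^'N \<Rightarrow> real^'n::finite) \<Rightarrow> (real^'N \<Rightarrow> real^'N^'n) \<Rightarrow> bool" where
  "borel_weak_gradient \<Omega> U V \<longleftrightarrow> U \<in> borel_measurable borel \<and> V \<in> borel_measurable borel \<and>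
     integrable lborel U \<and> integrable lborel V \<and>
     (\<forall>\<phi>\<in>test_functions \<Omega>. \<forall>i j.
       (LBINT x. U x $ j * partial_deriv i \<phi> x) = - (LBINT x. V x $ j $ i * \<phi> x))"

lemma uniform_pos_lower_bound:
  assumes "\<And>i :: 'i::finite. \<exists>d>0 :: real. \<forall>\<epsilon>. \<epsilon> \<le> d \<longrightarrow> P i \<epsilon>"
  shows "\<exists>d>0. \<forall>i \<epsilon>. \<epsilon> \<le> d \<longrightarrow> P i \<epsilon>"
proof -
  obtain d where d: "\<And>i. d i > 0" "\<And>i \<epsilon>. \<epsilon> \<le> d i \<Longrightarrow> P i \<epsilon>" using assms by metis
  have "Min (range d) > 0" using d(1) by (subst Min_gr_iff) auto
  moreover have "Min (range d) \<le> d i" for i by (intro Min_le) auto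
  ultimately show ?thesis using d(2) by (intro exI[of _ "Min (range d)"]) (auto intro: order_trans)
qed

text \<open>Mollification of \<open>U\<close>. For \<open>x\<close> in \<open>K\<close> the kernel
  centred at \<open>x\<close> is a test function in \<Omega>, so the gradient of the mollified
  function is the mollification of \<open>V\<close> there, and both are L1-close.\<close>

lemma smooth_approximation:
  fixes U :: "real^'N::finite \<Rightarrow> real^'n::finite"
  assumes UV: "borel_weak_gradient \<Omega> U V" and \<Omega>: "open \<Omega>" and K: "compact K" "K \<subseteq> \<Omega>" and e: "e > 0"
  shows "\<exists>w Dw. C1_map w Dw \<and> (\<integral>\<^sup>+x. indicator K x * ennreal (norm (w x - U x)) \<partial>lborel) \<le> ennreal e
    \<and> (\<integral>\<^sup>+x. indicator K x * ennreal (norm (Dw x - V x)) \<partial>lborel) \<le> ennreal e"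
proof -
  have [measurable]: "U \<in> borel_measurable borel" "V \<in> borel_measurable borel" "K \<in> sets borel"
    and int: "integrable lborel U" "integrable lborel V"
    using UV K by (auto simp: borel_weak_gradient_def borel_compact)
  \<comment> \<open>The norms are estimated by sums over all entries, and \<open>c\<close> is the
    share of \<open>e\<close> for each entry.\<close>
  define c where "c = e / (CARD('n) * CARD('N))"
  have c: "c > 0" using e by (simp add: c_def)
  have cle: "CARD('n) * c \<le> e" "CARD('n) * (CARD('N) * c) \<le> e"
    using e by (auto simp: c_def divide_le_eq_1 field_simps)
  obtain d where d: "d > 0" "compact (\<Union>x\<in>K. cball x d)" "(\<Union>x\<in>K. cball x d) \<subseteq> \<Omega>"
    using compact_cball_nbhd[OF K(1) \<Omega> K(2)] .
  have iU: "integrable lborel (\<lambda>x. U x $ j)" for j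
    by (intro integrable_bounded_linear[OF bounded_linear_vec_nth] int)
  have iV: "integrable lborel (\<lambda>x. V x $ j $ i)" for i j
    by (intro integrable_bounded_linear[OF bounded_linear_vec_nth] int)
  have "\<exists>d>0. \<forall>\<epsilon>. \<epsilon> \<le> d \<longrightarrow> (\<forall>\<rho>. mollifier \<epsilon> \<rho> \<longrightarrow> (\<integral>\<^sup>+x. norm (conv \<rho> (\<lambda>x. U x $ j) x - U x $ j) \<partial>lborel) \<le> ennreal c)" for j
    using mollify_L1[OF iU c] by blast
  from uniform_pos_lower_bound[of "\<lambda>j \<epsilon>. \<forall>\<rho>. mollifier \<epsilon> \<rho> \<longrightarrow> (\<integral>\<^sup>+x. norm (conv \<rho> (\<lambda>x. U x $ j) x - U x $ j) \<partial>lborel) \<le> ennreal c", OF this]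
  obtain d1 where d1: "d1 > 0" "\<And>j \<epsilon> \<rho>. \<epsilon> \<le> d1 \<Longrightarrow> mollifier \<epsilon> \<rho> \<Longrightarrow>
      (\<integral>\<^sup>+x. norm (conv \<rho> (\<lambda>x. U x $ j) x - U x $ j) \<partial>lborel) \<le> ennreal c" by blast
  have "\<exists>d>0. \<forall>\<epsilon>. \<epsilon> \<le> d \<longrightarrow> (\<forall>\<rho>. mollifier \<epsilon> \<rho> \<longrightarrow>
      (\<integral>\<^sup>+x. norm (conv \<rho> (\<lambda>x. V x $ fst ji $ snd ji) x - V x $ fst ji $ snd ji) \<partial>lborel) \<le> ennreal c)" for ji :: "'n \<times> 'N"
    using mollify_L1[OF iV c] by blast
  from uniform_pos_lower_bound[of "\<lambda>ji \<epsilon>. \<forall>\<rho>. mollifier \<epsilon> \<rho> \<longrightarrow>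
      (\<integral>\<^sup>+x. norm (conv \<rho> (\<lambda>x. V x $ fst ji $ snd ji) x - V x $ fst ji $ snd ji) \<partial>lborel) \<le> ennreal c", OF this]
  obtain d2 where d2: "d2 > 0" "\<And>j i \<epsilon> \<rho>. \<epsilon> \<le> d2 \<Longrightarrow> mollifier \<epsilon> \<rho> \<Longrightarrow>
      (\<integral>\<^sup>+x. norm (conv \<rho> (\<lambda>x. V x $ j $ i) x - V x $ j $ i) \<partial>lborel) \<le> ennreal c" by auto
  define \<epsilon> where "\<epsilon> = min d (min d1 d2)"
  have \<epsilon>: "\<epsilon> > 0" "\<epsilon> \<le> d" "\<epsilon> \<le> d1" "\<epsilon> \<le> d2" using d(1) d1(1) d2(1) by (auto simp: \<epsilon>_def)
  obtain \<rho> :: "real^'N \<Rightarrow> real" where \<rho>: "mollifier \<epsilon> \<rho>" using mollifier_exists[OF \<epsilon>(1)] by blast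
  have \<rho>C: "C1_fun \<rho>" "\<And>x. x \<notin> cball 0 \<epsilon> \<Longrightarrow> \<rho> x = 0"
    using \<rho> Ck_fun_C1[of 0 \<rho>] by (simp_all add: mollifier_def del: Ck_fun.simps)
  have [measurable]: "\<rho> \<in> borel_measurable borel" by (rule borel_measurable_continuous_onI[OF C1_funD(4)[OF \<rho>C(1)]])
  define w where "w x = (\<chi> j. conv \<rho> (\<lambda>y. U y $ j) x)" for x
  have wj: "C1_fun (\<lambda>x. w x $ j)" for j
    using conv_C1(1)[where R=\<epsilon>, OF \<rho>C(1) _ iU] \<rho>C(2) by (simp add: w_def)
  then have w: "C1_map w (grad_matrix w)" by (rule C1_map_grad_matrix)
  note [measurable] = borel_measurable_C1_map[OF w]
  have Dw: "grad_matrix w x $ j $ i = conv \<rho> (\<lambda>y. V y $ j $ i) x" if x: "x \<in> K" for x i j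
  proof -
    have "cball x \<epsilon> \<subseteq> \<Omega>" using x d(3) \<epsilon>(2) by force
    note t = mollifier_test_function[OF \<rho> this]
    have "grad_matrix w x $ j $ i = conv (partial_deriv i \<rho>) (\<lambda>y. U y $ j) x"
      using conv_C1(2)[where R=\<epsilon>, OF \<rho>C(1) _ iU] \<rho>C(2) by (simp add: grad_matrix_def grad_def w_def)
    also have "\<dots> = - (LBINT y. U y $ j * partial_deriv i (\<lambda>y. \<rho> (x - y)) y)"
      by (simp add: conv_def t(3) mult.commute)
    also have "\<dots> = (LBINT y. V y $ j $ i * \<rho> (x - y))"
      using UV t(1) by (simp add: borel_weak_gradient_def)
    finally show ?thesis by (simp add: conv_def mult.commute)
  qed
  have "(\<integral>\<^sup>+x. indicator K x * ennreal (norm (w x - U x)) \<partial>lborel)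
      \<le> (\<integral>\<^sup>+x. (\<Sum>j\<in>UNIV. ennreal (norm (conv \<rho> (\<lambda>x. U x $ j) x - U x $ j))) \<partial>lborel)"
  proof (rule nn_integral_mono)
    fix x
    have "norm (w x - U x) \<le> (\<Sum>j\<in>UNIV. norm (conv \<rho> (\<lambda>x. U x $ j) x - U x $ j))"
      using norm_le_l1_cart[of "w x - U x"] by (simp add: w_def)
    then show "indicator K x * ennreal (norm (w x - U x)) \<le> (\<Sum>j\<in>UNIV. ennreal (norm (conv \<rho> (\<lambda>x. U x $ j) x - U x $ j)))"
      by (auto simp: indicator_def sum_ennreal intro!: ennreal_leI)
  qed
  also have "\<dots> = (\<Sum>j\<in>UNIV. (\<integral>\<^sup>+x. ennreal (norm (conv \<rho> (\<lambda>x. U x $ j) x - U x $ j)) \<partial>lborel))"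
  proof (rule nn_integral_sum)
    fix j
    have "conv \<rho> (\<lambda>x. U x $ j) = (\<lambda>x. w x $ j)" by (simp add: w_def)
    then show "(\<lambda>x. ennreal (norm (conv \<rho> (\<lambda>x. U x $ j) x - U x $ j))) \<in> borel_measurable lborel" by simp
  qed
  also have "\<dots> \<le> (\<Sum>j\<in>(UNIV :: 'n set). ennreal c)"
    by (intro sum_mono d1(2)[OF \<epsilon>(3) \<rho>])
  also have "\<dots> \<le> ennreal e" using c cle by (simp add: ennreal_of_nat_eq_real_of_nat ennreal_leI flip: ennreal_mult)
  finally have 1: "(\<integral>\<^sup>+x. indicator K x * ennreal (norm (w x - U x)) \<partial>lborel) \<le> ennreal e" .
  have cm: "conv \<rho> (\<lambda>x. V x $ j $ i) \<in> borel_measurable borel" for i j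
    using conv_C1(1)[where R=\<epsilon>, OF \<rho>C(1) _ iV] \<rho>C(2) by (intro borel_measurable_continuous_onI C1_funD) auto
  have "(\<integral>\<^sup>+x. indicator K x * ennreal (norm (grad_matrix w x - V x)) \<partial>lborel)
      \<le> (\<integral>\<^sup>+x. (\<Sum>j\<in>UNIV. \<Sum>i\<in>UNIV. ennreal (norm (conv \<rho> (\<lambda>x. V x $ j $ i) x - V x $ j $ i))) \<partial>lborel)"
  proof (rule nn_integral_mono)
    fix x
    have "norm (grad_matrix w x - V x) \<le> (\<Sum>j\<in>UNIV. \<Sum>i\<in>UNIV. norm (conv \<rho> (\<lambda>x. V x $ j $ i) x - V x $ j $ i))" if "x \<in> K"
      using norm_matrix_le_sum[of "grad_matrix w x - V x"] that by (simp add: Dw)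
    then show "indicator K x * ennreal (norm (grad_matrix w x - V x))
        \<le> (\<Sum>j\<in>UNIV. \<Sum>i\<in>UNIV. ennreal (norm (conv \<rho> (\<lambda>x. V x $ j $ i) x - V x $ j $ i)))"
      by (auto simp: indicator_def sum_ennreal sum_nonneg intro!: ennreal_leI)
  qed
  also have "\<dots> = (\<Sum>j\<in>UNIV. \<Sum>i\<in>UNIV. (\<integral>\<^sup>+x. ennreal (norm (conv \<rho> (\<lambda>x. V x $ j $ i) x - V x $ j $ i)) \<partial>lborel))"
  proof -
    have m: "(\<lambda>x. ennreal (norm (conv \<rho> (\<lambda>x. V x $ j $ i) x - V x $ j $ i))) \<in> borel_measurable lborel" for i j
      using cm borel_measurable_integrable[OF iV[of j i]]
      by (intro measurable_compose[OF _ measurable_ennreal] borel_measurable_norm borel_measurable_diff) auto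
    have m2: "(\<lambda>x. \<Sum>i\<in>UNIV. ennreal (norm (conv \<rho> (\<lambda>x. V x $ j $ i) x - V x $ j $ i))) \<in> borel_measurable lborel" for j
      by (intro borel_measurable_sum m)
    show ?thesis by (subst nn_integral_sum[OF m2], intro sum.cong refl nn_integral_sum m)
  qed
  also have "\<dots> \<le> (\<Sum>j\<in>(UNIV :: 'n set). \<Sum>i\<in>(UNIV :: 'N set). ennreal c)"
    by (intro sum_mono d2(2)[OF \<epsilon>(4) \<rho>])
  also have "\<dots> \<le> ennreal e" using c cle by (simp add: ennreal_of_nat_eq_real_of_nat ennreal_leI flip: ennreal_mult)
  finally have "(\<integral>\<^sup>+x. indicator K x * ennreal (norm (grad_matrix w x - V x)) \<partial>lborel) \<le> ennreal e" .
  then show ?thesis using w 1 by blast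
qed

text \<open>An integrable series of nonnegative functions is finite almost everywhere, so its terms
  tend to 0 there. This replaces the passage to an almost everywhere convergent subsequence; the
  integrable sum itself serves later as a majorant.\<close>

lemma AE_suminf_finite:
  assumes [measurable]: "\<And>j. \<Psi> j \<in> borel_measurable M" and "\<And>j. (\<integral>\<^sup>+x. \<Psi> j x \<partial>M) \<le> ennreal ((1 / 2) ^ j)"
  shows "(\<integral>\<^sup>+x. (\<Sum>j. \<Psi> j x) \<partial>M) < \<infinity>" "AE x in M. (\<lambda>j. \<Psi> j x) \<longlonglongrightarrow> 0"
proof -
  have "(\<integral>\<^sup>+x. (\<Sum>j. \<Psi> j x) \<partial>M) = (\<Sum>j. (\<integral>\<^sup>+x. \<Psi> j x \<partial>M))" by (rule nn_integral_suminf) measurable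
  also have "\<dots> \<le> (\<Sum>j. ennreal ((1 / 2) ^ j))" by (intro suminf_le assms summableI)
  also have "\<dots> = ennreal (\<Sum>j. (1 / 2) ^ j)" by (rule suminf_ennreal2) (auto intro: summable_geometric)
  also have "\<dots> < \<infinity>" by simp
  finally show *: "(\<integral>\<^sup>+x. (\<Sum>j. \<Psi> j x) \<partial>M) < \<infinity>" .
  have "AE x in M. (\<Sum>j. \<Psi> j x) \<noteq> \<infinity>" using * by (intro nn_integral_PInf_AE) auto
  then show "AE x in M. (\<lambda>j. \<Psi> j x) \<longlonglongrightarrow> 0"
  proof eventually_elim
    case (elim x)
    have "\<Psi> j x \<le> (\<Sum>j. \<Psi> j x)" for j using sum_le_suminf[of "\<lambda>j. \<Psi> j x" "{j}"] by simp
    then have fin: "\<Psi> j x < top" for j using elim by (metis infinity_ennreal_def less_top order_le_less_trans)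
    then have eq: "\<Psi> j x = ennreal (enn2real (\<Psi> j x))" for j by simp
    have "summable (\<lambda>j. enn2real (\<Psi> j x))"
      using elim eq by (intro summable_suminf_not_top) auto
    then have "(\<lambda>j. enn2real (\<Psi> j x)) \<longlonglongrightarrow> 0" by (rule summable_LIMSEQ_zero)
    then have "(\<lambda>j. ennreal (enn2real (\<Psi> j x))) \<longlonglongrightarrow> ennreal 0" by (intro tendsto_ennrealI)
    then show ?case using eq by simp
  qed
qed

subsection \<open>Averaged differentiability\<close>

text \<open>Fundamental theorem of calculus along the segment from \<open>x\<close> to
  \<open>x + z\<close>, applied to \<open>w\<close> minus the linear part. The right-hand side is a
  nonnegative integral so that Tonelli can be applied to it without integrability
  conditions.\<close>

lemma C1_map_difference_bound:
  fixes w :: "real^'N::finite \<Rightarrow> real^'n::finite"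
  assumes w: "C1_map w Dw"
  shows "ennreal (norm (w (x + z) - w x - A *v z))
    \<le> ennreal (norm z) * (\<integral>\<^sup>+t. indicator {0..1} t * ennreal (norm (Dw (x + t *\<^sub>R z) - A)) \<partial>lborel)"
proof -
  define F where "F t = w (x + t *\<^sub>R z) - t *\<^sub>R (A *v z)" for t
  define f where "f t = (Dw (x + t *\<^sub>R z) - A) *v z" for t
  note wc = C1_map_continuous[OF w]
  have D: "(F has_vector_derivative f t) (at t within {0..1})" for t
  proof -
    have "((\<lambda>t. w (x + t *\<^sub>R z)) has_derivative (\<lambda>s. Dw (x + t *\<^sub>R z) *v (s *\<^sub>R z))) (at t within {0..1})"
      using w by (intro has_derivative_compose[of "\<lambda>t. x + t *\<^sub>R z" _ t _ w])
        (auto simp: C1_map_def intro!: derivative_eq_intros)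
    then show ?thesis
      unfolding has_vector_derivative_def F_def[abs_def] f_def
      by (rule has_derivative_eq_rhs[OF has_derivative_diff[OF _ has_derivative_scaleR_left[OF has_derivative_ident]]])
        (simp add: matrix_vector_mult_diff_rdistrib matrix_vector_mult_scaleR scaleR_diff_right fun_eq_iff)
  qed
  have comp: "continuous_on UNIV (\<lambda>t :: real. Dw (x + t *\<^sub>R z) - A)"
    by (intro continuous_intros continuous_on_compose2[OF wc(2)]) auto
  have cf: "continuous_on UNIV f"
  proof -
    have "f = (\<lambda>t. \<chi> j. (Dw (x + t *\<^sub>R z) - A) $ j \<bullet> z)"
      by (simp add: f_def fun_eq_iff vec_eq_iff matrix_vector_mult_nth)
    then show ?thesis by (simp only:) (intro continuous_on_vec_lambda continuous_on_inner continuous_on_component continuous_on_const comp)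
  qed
  have "w (x + z) - w x - A *v z = F 1 - F 0" by (simp add: F_def)
  also have "\<dots> = (LBINT t. indicator {0..1} t *\<^sub>R f t)"
    by (rule integral_FTC_Icc[symmetric]) (use D cf in \<open>auto intro: continuous_on_subset\<close>)
  finally have "ennreal (norm (w (x + z) - w x - A *v z)) = ennreal (norm (LBINT t. indicator {0..1} t *\<^sub>R f t))" by simp
  also have "\<dots> \<le> (\<integral>\<^sup>+t. norm (indicator {0..1} t *\<^sub>R f t) \<partial>lborel)"
    by (intro integral_norm_bound_ennreal borel_integrable_compact) (use cf in \<open>auto intro: continuous_on_subset\<close>)
  also have "\<dots> \<le> (\<integral>\<^sup>+t. ennreal (norm z) * (indicator {0..1} t * ennreal (norm (Dw (x + t *\<^sub>R z) - A))) \<partial>lborel)"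
  proof (rule nn_integral_mono)
    fix t :: real
    have "norm (f t) \<le> norm z * norm (Dw (x + t *\<^sub>R z) - A)"
      using norm_matrix_vector_mult_le[of "Dw (x + t *\<^sub>R z) - A" z] by (simp add: f_def mult.commute)
    then show "ennreal (norm (indicator {0..1} t *\<^sub>R f t)) \<le> ennreal (norm z) * (indicator {0..1} t * ennreal (norm (Dw (x + t *\<^sub>R z) - A)))"
      by (auto simp: indicator_def intro!: ennreal_leI simp flip: ennreal_mult)
  qed
  also have "\<dots> = ennreal (norm z) * (\<integral>\<^sup>+t. indicator {0..1} t * ennreal (norm (Dw (x + t *\<^sub>R z) - A)) \<partial>lborel)"
  proof (rule nn_integral_cmult)
    have "(\<lambda>t. norm (Dw (x + t *\<^sub>R z) - A)) \<in> borel_measurable borel"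
      by (intro borel_measurable_continuous_onI continuous_intros comp)
    then show "(\<lambda>t. indicator {0..1} t * ennreal (norm (Dw (x + t *\<^sub>R z) - A))) \<in> borel_measurable lborel" by measurable
  qed
  finally show ?thesis .
qed

lemma translation_nn:
  fixes g :: "'a::euclidean_space \<Rightarrow> 'b::euclidean_space"
  assumes g: "integrable lborel g" and e: "e > 0"
  shows "\<exists>d>0. \<forall>h. norm h < d \<longrightarrow> (\<integral>\<^sup>+x. ennreal (norm (g (x + h) - g x)) \<partial>lborel) \<le> ennreal e"
proof -
  obtain d where d: "d > 0" "\<And>h. norm h < d \<Longrightarrow> (LBINT x. norm (g (x + h) - g x)) < e"
    using L1_translation_continuous[OF g e] by blast
  have "(\<integral>\<^sup>+x. ennreal (norm (g (x + h) - g x)) \<partial>lborel) \<le> ennreal e" if "norm h < d" for h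
  proof -
    have "integrable lborel (\<lambda>x. norm (g (x + h) - g x))" using integrable_lborel_translate(1)[OF g, of h] g by auto
    then have "(\<integral>\<^sup>+x. ennreal (norm (g (x + h) - g x)) \<partial>lborel) = ennreal (LBINT x. norm (g (x + h) - g x))"
      by (rule nn_integral_eq_integral) auto
    then show ?thesis using d(2)[OF that] by (simp add: ennreal_leI)
  qed
  then show ?thesis using d(1) by blast
qed

text \<open>Differentiability in L1 mean. For a C1 approximation of \<open>U\<close> the segment
  bound and Tonelli reduce the remainder to \<open>norm z\<close> times the distance between its
  gradient and \<open>V\<close> at shifted points. Shifting \<open>V\<close> costs \<open>e\<close>,
  by continuity of translations. Approximating \<open>U\<close> costs an error without the factor
  \<open>norm z\<close>, which is sent to 0 for fixed \<open>z\<close>.\<close>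

lemma averaged_differentiability:
  fixes U :: "real^'N::finite \<Rightarrow> real^'n::finite"
  assumes UV: "borel_weak_gradient \<Omega> U V" and \<Omega>: "open \<Omega>" and K: "compact K" "K \<subseteq> \<Omega>" and e: "e > 0"
  shows "\<exists>d>0. \<forall>z. norm z < d \<longrightarrow>
    (\<integral>\<^sup>+x. indicator K x * ennreal (norm (U (x + z) - U x - V x *v z)) \<partial>lborel) \<le> ennreal (norm z * e)"
proof -
  have [measurable]: "U \<in> borel_measurable borel" "V \<in> borel_measurable borel"
    and int: "integrable lborel U" "integrable lborel V"
    using UV by (auto simp: borel_weak_gradient_def)
  have [measurable]: "K \<in> sets borel" using K by (simp add: borel_compact)
  obtain d0 where d0: "d0 > 0" "compact (\<Union>x\<in>K. cball x d0)" "(\<Union>x\<in>K. cball x d0) \<subseteq> \<Omega>"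
    using compact_cball_nbhd[OF K(1) \<Omega> K(2)] .
  define K' where "K' = (\<Union>x\<in>K. cball x d0)"
  have K'b [measurable]: "K' \<in> sets borel" using d0 by (simp add: K'_def borel_compact)
  obtain d1 where d1: "d1 > 0" "\<And>h. norm h < d1 \<Longrightarrow> (\<integral>\<^sup>+x. ennreal (norm (V (x + h) - V x)) \<partial>lborel) \<le> ennreal e"
    using translation_nn[OF int(2) e] by blast
  have "(\<integral>\<^sup>+x. indicator K x * ennreal (norm (U (x + z) - U x - V x *v z)) \<partial>lborel) \<le> ennreal (norm z * e)"
    if z: "norm z < min d0 d1" for z
  proof -
    \<comment> \<open>The whole segment stays in the compact neighbourhood where the approximation
      is controlled.\<close>
    have inK': "x + t *\<^sub>R z \<in> K'" if "x \<in> K" "t \<in> {0..1}" for x t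
    proof -
      have "norm (t *\<^sub>R z) \<le> d0" using that z by (auto intro: order_trans[OF mult_left_le_one_le])
      then show ?thesis using that by (force simp: K'_def dist_norm)
    qed
    have "(\<integral>\<^sup>+x. indicator K x * ennreal (norm (U (x + z) - U x - V x *v z)) \<partial>lborel) \<le> ennreal (norm z * e) + ennreal \<delta>"
      if \<delta>: "\<delta> > 0" for \<delta>
    proof -
      \<comment> \<open>Two errors for the values at \<open>x\<close> and \<open>x + z\<close> and
        one for the gradient, weighted by \<open>norm z\<close>, add up to \<open>\<delta>\<close>.
        The approximation may depend on \<open>z\<close>, since \<delta> disappears before
        \<open>z\<close> varies.\<close>
      define \<kappa> where "\<kappa> = \<delta> / (2 + norm z)"
      have \<kappa>: "\<kappa> > 0" "\<kappa> * (2 + norm z) = \<delta>" using \<delta> norm_ge_zero[of z] by (auto simp: \<kappa>_def intro!: divide_pos_pos add_pos_nonneg simp del: norm_ge_zero)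
      obtain w Dw where w: "C1_map w Dw"
        and wU: "(\<integral>\<^sup>+x. indicator K' x * ennreal (norm (w x - U x)) \<partial>lborel) \<le> ennreal \<kappa>"
        and wV: "(\<integral>\<^sup>+x. indicator K' x * ennreal (norm (Dw x - V x)) \<partial>lborel) \<le> ennreal \<kappa>"
        using smooth_approximation[OF UV \<Omega> _ _ \<kappa>(1), of K'] d0 unfolding K'_def by blast
      note [measurable] = borel_measurable_C1_map[OF w]
      let ?I = "\<lambda>x. \<integral>\<^sup>+t. indicator {0..1} t * ennreal (norm (Dw (x + t *\<^sub>R z) - V x)) \<partial>lborel"
      have pt: "indicator K x * ennreal (norm (U (x + z) - U x - V x *v z))
        \<le> indicator K' (x + z) * ennreal (norm (w (x + z) - U (x + z))) + indicator K' x * ennreal (norm (w x - U x))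
          + indicator K x * (ennreal (norm z) * ?I x)" for x
      proof (cases "x \<in> K")
        case True
        then have K': "x + z \<in> K'" "x \<in> K'" using inK'[OF True, of 1] inK'[OF True, of 0] by auto
        have "U (x + z) - U x - V x *v z = - (w (x + z) - U (x + z)) + (w x - U x) + (w (x + z) - w x - V x *v z)" by simp
        also have "norm \<dots> \<le> norm (w (x + z) - U (x + z)) + norm (w x - U x) + norm (w (x + z) - w x - V x *v z)"
          by (intro norm_triangle_mono) (simp_all only: norm_minus_cancel order_refl)
        finally have "ennreal (norm (U (x + z) - U x - V x *v z))
            \<le> ennreal (norm (w (x + z) - U (x + z)) + norm (w x - U x) + norm (w (x + z) - w x - V x *v z))" by (rule ennreal_leI)
        also have "\<dots> = ennreal (norm (w (x + z) - U (x + z))) + ennreal (norm (w x - U x)) + ennreal (norm (w (x + z) - w x - V x *v z))"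
          by (simp add: ennreal_plus)
        also have "\<dots> \<le> ennreal (norm (w (x + z) - U (x + z))) + ennreal (norm (w x - U x)) + ennreal (norm z) * ?I x"
          by (intro add_left_mono C1_map_difference_bound[OF w])
        finally show ?thesis using True K' by simp
      qed simp
      have A: "(\<integral>\<^sup>+x. indicator K' (x + z) * ennreal (norm (w (x + z) - U (x + z))) \<partial>lborel) \<le> ennreal \<kappa>"
        using nn_integral_lborel_translate(1)[of "\<lambda>x. indicator K' x * ennreal (norm (w x - U x))" z] wU by simp
      have C: "(\<integral>\<^sup>+x. indicator K x * (ennreal (norm z) * ?I x) \<partial>lborel) \<le> ennreal (norm z) * (ennreal \<kappa> + ennreal e)"
      proof -
        have "(\<integral>\<^sup>+x. indicator K x * (ennreal (norm z) * ?I x) \<partial>lborel)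
          = (\<integral>\<^sup>+x. ennreal (norm z) * (\<integral>\<^sup>+t. indicator K x * (indicator {0..1} t * ennreal (norm (Dw (x + t *\<^sub>R z) - V x))) \<partial>lborel) \<partial>lborel)"
          by (intro nn_integral_cong) (simp add: indicator_def)
        also have "\<dots> = ennreal (norm z) * (\<integral>\<^sup>+x. (\<integral>\<^sup>+t. indicator K x * (indicator {0..1} t * ennreal (norm (Dw (x + t *\<^sub>R z) - V x))) \<partial>lborel) \<partial>lborel)"
          by (rule nn_integral_cmult) measurable
        also have "(\<integral>\<^sup>+x. (\<integral>\<^sup>+t. indicator K x * (indicator {0..1} t * ennreal (norm (Dw (x + t *\<^sub>R z) - V x))) \<partial>lborel) \<partial>lborel)
          = (\<integral>\<^sup>+t. (\<integral>\<^sup>+x. indicator K x * (indicator {0..1} t * ennreal (norm (Dw (x + t *\<^sub>R z) - V x))) \<partial>lborel) \<partial>lborel)"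
          by (rule lborel_pair.Fubini') measurable
        also have "\<dots> \<le> (\<integral>\<^sup>+t. (ennreal \<kappa> + ennreal e) * indicator {0..1 :: real} t \<partial>lborel)"
        proof (rule nn_integral_mono)
          fix t :: real
          show "(\<integral>\<^sup>+x. indicator K x * (indicator {0..1} t * ennreal (norm (Dw (x + t *\<^sub>R z) - V x))) \<partial>lborel)
            \<le> (ennreal \<kappa> + ennreal e) * indicator {0..1} t"
          proof (cases "t \<in> {0..1}")
            case True
            have "(\<integral>\<^sup>+x. indicator K x * ennreal (norm (Dw (x + t *\<^sub>R z) - V x)) \<partial>lborel)
              \<le> (\<integral>\<^sup>+x. indicator K' (x + t *\<^sub>R z) * ennreal (norm (Dw (x + t *\<^sub>R z) - V (x + t *\<^sub>R z)))
                  + ennreal (norm (V (x + t *\<^sub>R z) - V x)) \<partial>lborel)"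
            proof (rule nn_integral_mono)
              fix x
              have "norm (Dw (x + t *\<^sub>R z) - V x) \<le> norm (Dw (x + t *\<^sub>R z) - V (x + t *\<^sub>R z)) + norm (V (x + t *\<^sub>R z) - V x)"
                using norm_triangle_ineq[of "Dw (x + t *\<^sub>R z) - V (x + t *\<^sub>R z)" "V (x + t *\<^sub>R z) - V x"] by simp
              then have "ennreal (norm (Dw (x + t *\<^sub>R z) - V x))
                  \<le> ennreal (norm (Dw (x + t *\<^sub>R z) - V (x + t *\<^sub>R z))) + ennreal (norm (V (x + t *\<^sub>R z) - V x))"
                by (simp add: ennreal_leI flip: ennreal_plus)
              then show "indicator K x * ennreal (norm (Dw (x + t *\<^sub>R z) - V x))
                \<le> indicator K' (x + t *\<^sub>R z) * ennreal (norm (Dw (x + t *\<^sub>R z) - V (x + t *\<^sub>R z)))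
                  + ennreal (norm (V (x + t *\<^sub>R z) - V x))"
                using inK'[OF _ True, of x] by (cases "x \<in> K") auto
            qed
            also have "\<dots> = (\<integral>\<^sup>+x. indicator K' (x + t *\<^sub>R z) * ennreal (norm (Dw (x + t *\<^sub>R z) - V (x + t *\<^sub>R z))) \<partial>lborel)
                  + (\<integral>\<^sup>+x. ennreal (norm (V (x + t *\<^sub>R z) - V x)) \<partial>lborel)"
              by (rule nn_integral_add) measurable
            also have "\<dots> \<le> ennreal \<kappa> + ennreal e"
            proof (rule add_mono)
              show "(\<integral>\<^sup>+x. indicator K' (x + t *\<^sub>R z) * ennreal (norm (Dw (x + t *\<^sub>R z) - V (x + t *\<^sub>R z))) \<partial>lborel) \<le> ennreal \<kappa>"
                using nn_integral_lborel_translate(1)[of "\<lambda>x. indicator K' x * ennreal (norm (Dw x - V x))" "t *\<^sub>R z"] wV by simp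
              have "norm (t *\<^sub>R z) < d1" using True z by (auto intro: order_le_less_trans[OF mult_left_le_one_le])
              then show "(\<integral>\<^sup>+x. ennreal (norm (V (x + t *\<^sub>R z) - V x)) \<partial>lborel) \<le> ennreal e" by (rule d1(2))
            qed
            finally show ?thesis using True by simp
          qed simp
        qed
        also have "\<dots> = ennreal \<kappa> + ennreal e" by (subst nn_integral_cmult_indicator) auto
        finally show ?thesis by (simp add: mult_left_mono)
      qed
      have "(\<integral>\<^sup>+x. indicator K x * ennreal (norm (U (x + z) - U x - V x *v z)) \<partial>lborel)
        \<le> (\<integral>\<^sup>+x. indicator K' (x + z) * ennreal (norm (w (x + z) - U (x + z))) + indicator K' x * ennreal (norm (w x - U x))
          + indicator K x * (ennreal (norm z) * ?I x) \<partial>lborel)"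
        by (rule nn_integral_mono[OF pt])
      also have "\<dots> = (\<integral>\<^sup>+x. indicator K' (x + z) * ennreal (norm (w (x + z) - U (x + z))) \<partial>lborel)
          + (\<integral>\<^sup>+x. indicator K' x * ennreal (norm (w x - U x)) \<partial>lborel)
          + (\<integral>\<^sup>+x. indicator K x * (ennreal (norm z) * ?I x) \<partial>lborel)"
        by (subst nn_integral_add, measurable, subst nn_integral_add, measurable)
      also have "\<dots> \<le> ennreal \<kappa> + ennreal \<kappa> + ennreal (norm z) * (ennreal \<kappa> + ennreal e)"
        by (intro add_mono A wU C)
      also have "\<dots> = ennreal (\<kappa> + \<kappa> + norm z * (\<kappa> + e))"
        using \<kappa>(1) e by (simp flip: ennreal_plus ennreal_mult)
      also have "\<kappa> + \<kappa> + norm z * (\<kappa> + e) = norm z * e + \<delta>" using \<kappa>(2) by (simp add: algebra_simps)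
      also have "ennreal (norm z * e + \<delta>) = ennreal (norm z * e) + ennreal \<delta>" using e \<delta> by (simp add: ennreal_plus)
      finally show ?thesis .
    qed
    then show ?thesis by (rule ennreal_le_epsilon)
  qed
  then show ?thesis using d0(1) d1(1) by (intro exI[of _ "min d0 d1"]) auto
qed

section \<open>Averages over balls of a common radius\<close>

lemma ball_in_borel [measurable]: "ball x r \<in> sets borel" "cball x r \<in> sets borel"
  by auto

lemma borel_measurable_matrix_vector_mult [measurable (raw)]:
  fixes A :: "'a \<Rightarrow> real^'N::finite^'n::finite"
  assumes "A \<in> borel_measurable M" "f \<in> borel_measurable M"
  shows "(\<lambda>x. A x *v f x) \<in> borel_measurable M"
proof -
  have "continuous_on UNIV (\<lambda>q :: (real^'N^'n) \<times> (real^'N). fst q *v snd q)"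
  proof -
    have "(\<lambda>q :: (real^'N^'n) \<times> (real^'N). fst q *v snd q) = (\<lambda>q. \<chi> j. fst q $ j \<bullet> snd q)"
      by (simp add: fun_eq_iff vec_eq_iff matrix_vector_mult_nth)
    then show ?thesis
      by (simp only:) (intro continuous_on_vec_lambda continuous_intros)
  qed
  then have c: "(\<lambda>q :: (real^'N^'n) \<times> (real^'N). fst q *v snd q) \<in> borel_measurable borel"
    by (rule borel_measurable_continuous_onI)
  from measurable_compose[OF borel_measurable_Pair[OF assms] c] show ?thesis by simp
qed

lemma measure_ball_center:
  fixes x :: "'a::euclidean_space"
  shows "measure lborel (ball x r) = measure lborel (ball (0 :: 'a) r)"
proof (cases "r \<ge> 0")
  case True
  then show ?thesis using content_ball[of r x] content_ball[of r "0 :: 'a"] by simp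
qed (simp add: ball_empty)

lemma nn_integral_ball_shift:
  fixes g :: "'a::euclidean_space \<Rightarrow> ennreal"
  assumes [measurable]: "g \<in> borel_measurable borel"
  shows "(\<integral>\<^sup>+z. indicator (ball 0 r) z * g (x + z) \<partial>lborel) = (\<integral>\<^sup>+y. indicator (ball x r) y * g y \<partial>lborel)"
proof -
  have "(\<integral>\<^sup>+y. indicator (ball x r) y * g y \<partial>lborel) = (\<integral>\<^sup>+z. indicator (ball x r) (z + x) * g (z + x) \<partial>lborel)"
    by (rule nn_integral_lborel_translate(1)[symmetric]) measurable
  also have "\<dots> = (\<integral>\<^sup>+z. indicator (ball 0 r) z * g (x + z) \<partial>lborel)"
    by (intro nn_integral_cong) (auto simp: indicator_def dist_norm add.commute)
  finally show ?thesis by simp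
qed

text \<open>Tonelli turns an estimate for each shift \<open>z\<close> into one for the average over
  all shifts in the ball.\<close>

lemma ball_average_bound:
  fixes N :: "'a::euclidean_space \<Rightarrow> 'a \<Rightarrow> ennreal"
  assumes [measurable]: "case_prod N \<in> borel_measurable (lborel \<Otimes>\<^sub>M lborel)" "K \<in> sets borel"
    and le: "\<And>z. z \<in> ball 0 r \<Longrightarrow> (\<integral>\<^sup>+x. indicator K x * N x z \<partial>lborel) \<le> ennreal c" and c: "c \<ge> 0"
  shows "(\<integral>\<^sup>+x. indicator K x * (\<integral>\<^sup>+z. indicator (ball 0 r) z * N x z \<partial>lborel) \<partial>lborel)
    \<le> ennreal (c * measure lborel (ball (0 :: 'a) r))"
proof -
  have "(\<integral>\<^sup>+x. indicator K x * (\<integral>\<^sup>+z. indicator (ball 0 r) z * N x z \<partial>lborel) \<partial>lborel)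
    = (\<integral>\<^sup>+x. (\<integral>\<^sup>+z. indicator K x * (indicator (ball 0 r) z * N x z) \<partial>lborel) \<partial>lborel)"
    by (intro nn_integral_cong) (simp add: indicator_def)
  also have "\<dots> = (\<integral>\<^sup>+z. (\<integral>\<^sup>+x. indicator K x * (indicator (ball 0 r) z * N x z) \<partial>lborel) \<partial>lborel)"
    by (rule lborel_pair.Fubini') measurable
  also have "\<dots> \<le> (\<integral>\<^sup>+z. ennreal c * indicator (ball (0 :: 'a) r) z \<partial>lborel)"
  proof (rule nn_integral_mono)
    fix z :: 'a
    show "(\<integral>\<^sup>+x. indicator K x * (indicator (ball 0 r) z * N x z) \<partial>lborel) \<le> ennreal c * indicator (ball 0 r) z"
      using le[of z] by (cases "z \<in> ball 0 r") auto
  qed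
  also have "\<dots> = ennreal c * emeasure lborel (ball (0 :: 'a) r)" by (rule nn_integral_cmult_indicator) simp
  also have "emeasure lborel (ball (0 :: 'a) r) = ennreal (measure lborel (ball (0 :: 'a) r))"
    using emeasure_lborel_ball_finite[of "0 :: 'a" r] by (intro emeasure_eq_ennreal_measure) auto
  finally show ?thesis using c by (simp add: ennreal_mult)
qed

text \<open>Integrated over the centres, both normalised averages are small for small radii. Radii
  for which these integrals are summable give convergence at almost every centre. One sequence of
  radii serves all centres, as required by an application of Fatou's lemma along it.\<close>

lemma vanishing_ball_averages:
  fixes U :: "real^'N::finite \<Rightarrow> real^'n::finite" and v :: "real^'N \<Rightarrow> real^'m::finite"
  assumes UV: "borel_weak_gradient \<Omega> U V" and \<Omega>: "open \<Omega>" and K: "compact K" "K \<subseteq> \<Omega>"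
    and v [measurable]: "v \<in> borel_measurable borel" and vi: "integrable lborel v"
  shows "\<exists>r. (\<forall>j. 0 < r j) \<and> r \<longlonglongrightarrow> 0 \<and> (AE x in lborel. x \<in> K \<longrightarrow>
      (\<lambda>j. (LBINT y. indicator (ball x (r j)) y * norm (U y - (U x + V x *v (y - x)))) / (r j * measure lborel (ball x (r j)))) \<longlonglongrightarrow> 0 \<and>
      (\<lambda>j. (LBINT y. indicator (ball x (r j)) y * norm (v y - v x)) / measure lborel (ball x (r j))) \<longlonglongrightarrow> 0)"
proof -
  have [measurable]: "U \<in> borel_measurable borel" "V \<in> borel_measurable borel" "K \<in> sets borel"
    using UV K by (auto simp: borel_weak_gradient_def borel_compact)
  \<comment> \<open>Two averages of size \<open>e j\<close> each add up to
    \<open>(1 / 2) ^ j\<close>.\<close>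
  define e where "e j = (1 / 2 :: real) ^ Suc j" for j
  have e: "e j > 0" for j by (simp add: e_def)
  have "\<forall>j. \<exists>d. d > 0 \<and> (\<forall>z. norm z < d \<longrightarrow>
      (\<integral>\<^sup>+x. indicator K x * ennreal (norm (U (x + z) - U x - V x *v z)) \<partial>lborel) \<le> ennreal (norm z * e j))"
    by (rule allI, rule averaged_differentiability[OF UV \<Omega> K e])
  from choice[OF this] obtain d1 where "\<forall>j. d1 j > 0 \<and> (\<forall>z. norm z < d1 j \<longrightarrow>
      (\<integral>\<^sup>+x. indicator K x * ennreal (norm (U (x + z) - U x - V x *v z)) \<partial>lborel) \<le> ennreal (norm z * e j))" ..
  then have d1: "\<And>j. d1 j > 0" "\<And>j z. norm z < d1 j \<Longrightarrow>
      (\<integral>\<^sup>+x. indicator K x * ennreal (norm (U (x + z) - U x - V x *v z)) \<partial>lborel) \<le> ennreal (norm z * e j)" by auto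
  have "\<forall>j. \<exists>d. d > 0 \<and> (\<forall>z. norm z < d \<longrightarrow> (\<integral>\<^sup>+x. ennreal (norm (v (x + z) - v x)) \<partial>lborel) \<le> ennreal (e j))"
    by (rule allI, rule translation_nn[OF vi e])
  from choice[OF this] obtain d2 where "\<forall>j. d2 j > 0 \<and> (\<forall>z. norm z < d2 j \<longrightarrow>
      (\<integral>\<^sup>+x. ennreal (norm (v (x + z) - v x)) \<partial>lborel) \<le> ennreal (e j))" ..
  then have d2: "\<And>j. d2 j > 0" "\<And>j z. norm z < d2 j \<Longrightarrow> (\<integral>\<^sup>+x. ennreal (norm (v (x + z) - v x)) \<partial>lborel) \<le> ennreal (e j)"
    by auto
  define r where "r j = min (1 / real (Suc j)) (min (d1 j) (d2 j))" for j
  have r: "r j > 0" "r j \<le> d1 j" "r j \<le> d2 j" for j using d1(1)[of j] d2(1)[of j] by (auto simp: r_def)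
  have r0: "r \<longlonglongrightarrow> 0"
  proof (rule tendsto_sandwich[OF _ _ tendsto_const LIMSEQ_Suc[OF lim_1_over_n]])
    show "\<forall>\<^sub>F j in sequentially. 0 \<le> r j" using r(1) by (simp add: less_imp_le)
    show "\<forall>\<^sub>F j in sequentially. r j \<le> 1 / real (Suc j)" by (simp add: r_def)
  qed
  define b where "b j = measure lborel (ball (0 :: real^'N) (r j))" for j
  have b: "b j > 0" for j using content_ball_pos[OF r(1)] by (simp add: b_def)
  define P where "P j x = (\<integral>\<^sup>+z. indicator (ball 0 (r j)) z * ennreal (norm (U (x + z) - U x - V x *v z)) \<partial>lborel)" for j x
  define Q where "Q j x = (\<integral>\<^sup>+z. indicator (ball 0 (r j)) z * ennreal (norm (v (x + z) - v x)) \<partial>lborel)" for j x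
  have [measurable]: "P j \<in> borel_measurable borel" "Q j \<in> borel_measurable borel" for j
  proof -
    have "(\<lambda>x. \<integral>\<^sup>+z. indicator (ball 0 (r j)) z * ennreal (norm (U (x + z) - U x - V x *v z)) \<partial>lborel) \<in> borel_measurable borel"
      by measurable
    then show "P j \<in> borel_measurable borel" by (simp add: P_def[abs_def])
    have "(\<lambda>x. \<integral>\<^sup>+z. indicator (ball 0 (r j)) z * ennreal (norm (v (x + z) - v x)) \<partial>lborel) \<in> borel_measurable borel"
      by measurable
    then show "Q j \<in> borel_measurable borel" by (simp add: Q_def[abs_def])
  qed
  \<comment> \<open>The normalisation by \<open>r j * b j\<close> is possible because the remainder
    of \<open>U\<close> carries the factor \<open>norm z < r j\<close>; for \<open>v\<close> only
    the volume is divided out.\<close>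
  define \<Psi> where "\<Psi> j x = ennreal (1 / (r j * b j)) * (indicator K x * P j x) + ennreal (1 / b j) * (indicator K x * Q j x)" for j x
  have \<Psi>m: "\<Psi> j \<in> borel_measurable lborel" for j unfolding \<Psi>_def[abs_def] by measurable
  have "(\<integral>\<^sup>+x. \<Psi> j x \<partial>lborel) \<le> ennreal ((1 / 2) ^ j)" for j
  proof -
    have "(\<integral>\<^sup>+x. \<Psi> j x \<partial>lborel) = ennreal (1 / (r j * b j)) * (\<integral>\<^sup>+x. indicator K x * P j x \<partial>lborel)
        + ennreal (1 / b j) * (\<integral>\<^sup>+x. indicator K x * Q j x \<partial>lborel)"
      unfolding \<Psi>_def by (subst nn_integral_add, measurable, subst (1 2) nn_integral_cmult, measurable)
    also have "\<dots> \<le> ennreal (1 / (r j * b j)) * ennreal (r j * e j * b j) + ennreal (1 / b j) * ennreal (e j * b j)"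
    proof (intro add_mono mult_left_mono)
      show "(\<integral>\<^sup>+x. indicator K x * P j x \<partial>lborel) \<le> ennreal (r j * e j * b j)"
        unfolding P_def b_def
      proof (rule ball_average_bound)
        fix z :: "real^'N" assume z: "z \<in> ball 0 (r j)"
        then have "(\<integral>\<^sup>+x. indicator K x * ennreal (norm (U (x + z) - U x - V x *v z)) \<partial>lborel) \<le> ennreal (norm z * e j)"
          using r(2)[of j] by (intro d1(2)) auto
        also have "\<dots> \<le> ennreal (r j * e j)" using z e[of j] by (intro ennreal_leI mult_right_mono) auto
        finally show "(\<integral>\<^sup>+x. indicator K x * ennreal (norm (U (x + z) - U x - V x *v z)) \<partial>lborel) \<le> ennreal (r j * e j)" .
      qed (use r(1)[of j] e[of j] in \<open>auto, measurable\<close>)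
      show "(\<integral>\<^sup>+x. indicator K x * Q j x \<partial>lborel) \<le> ennreal (e j * b j)"
        unfolding Q_def b_def
      proof (rule ball_average_bound)
        fix z :: "real^'N" assume z: "z \<in> ball 0 (r j)"
        have "(\<integral>\<^sup>+x. indicator K x * ennreal (norm (v (x + z) - v x)) \<partial>lborel) \<le> (\<integral>\<^sup>+x. ennreal (norm (v (x + z) - v x)) \<partial>lborel)"
          by (intro nn_integral_mono) (auto simp: indicator_def)
        also have "\<dots> \<le> ennreal (e j)" using r(3)[of j] z by (intro d2(2)) auto
        finally show "(\<integral>\<^sup>+x. indicator K x * ennreal (norm (v (x + z) - v x)) \<partial>lborel) \<le> ennreal (e j)" .
      qed (use e[of j] in \<open>auto, measurable\<close>)
    qed auto
    also have "\<dots> = ennreal (e j + e j)"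
      using r(1)[of j] b[of j] e[of j] by (simp flip: ennreal_mult ennreal_plus)
    also have "e j + e j = (1 / 2) ^ j" by (simp add: e_def)
    finally show ?thesis .
  qed
  from AE_suminf_finite(2)[OF \<Psi>m this]
  have "AE x in lborel. (\<lambda>j. \<Psi> j x) \<longlonglongrightarrow> 0" .
  then have "AE x in lborel. x \<in> K \<longrightarrow>
      (\<lambda>j. (LBINT y. indicator (ball x (r j)) y * norm (U y - (U x + V x *v (y - x)))) / (r j * measure lborel (ball x (r j)))) \<longlonglongrightarrow> 0 \<and>
      (\<lambda>j. (LBINT y. indicator (ball x (r j)) y * norm (v y - v x)) / measure lborel (ball x (r j))) \<longlonglongrightarrow> 0"
  proof eventually_elim
    case (elim x)
    show ?case
    proof
      assume x: "x \<in> K"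
      have P: "(LBINT y. indicator (ball x (r j)) y * norm (U y - (U x + V x *v (y - x)))) = enn2real (P j x)" for j
      proof -
        have "P j x = (\<integral>\<^sup>+y. indicator (ball x (r j)) y * ennreal (norm (U y - U x - V x *v (y - x))) \<partial>lborel)"
          unfolding P_def using nn_integral_ball_shift[of "\<lambda>y. ennreal (norm (U y - U x - V x *v (y - x)))" "r j" x]
          by (simp only: add_diff_cancel_left') measurable
        then show ?thesis
          by (subst integral_eq_nn_integral) (auto simp: ennreal_mult ennreal_indicator diff_diff_eq)
      qed
      have Q: "(LBINT y. indicator (ball x (r j)) y * norm (v y - v x)) = enn2real (Q j x)" for j
      proof -
        have "Q j x = (\<integral>\<^sup>+y. indicator (ball x (r j)) y * ennreal (norm (v y - v x)) \<partial>lborel)"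
          unfolding Q_def using nn_integral_ball_shift[of "\<lambda>y. ennreal (norm (v y - v x))" "r j" x] by simp
        then show ?thesis
          by (subst integral_eq_nn_integral) (auto simp: ennreal_mult ennreal_indicator)
      qed
      have "(\<lambda>j. ennreal (1 / (r j * b j)) * P j x) \<longlonglongrightarrow> 0"
        by (rule tendsto_sandwich[OF _ _ tendsto_const elim]) (use x in \<open>auto simp: \<Psi>_def\<close>)
      then have "(\<lambda>j. enn2real (ennreal (1 / (r j * b j)) * P j x)) \<longlonglongrightarrow> 0"
        using tendsto_enn2real[of _ 0] by simp
      then have 1: "(\<lambda>j. enn2real (P j x) / (r j * b j)) \<longlonglongrightarrow> 0"
        using r(1) b by (simp add: enn2real_mult less_imp_le)
      have "(\<lambda>j. ennreal (1 / b j) * Q j x) \<longlonglongrightarrow> 0"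
        by (rule tendsto_sandwich[OF _ _ tendsto_const elim]) (use x in \<open>auto simp: \<Psi>_def\<close>)
      then have "(\<lambda>j. enn2real (ennreal (1 / b j) * Q j x)) \<longlonglongrightarrow> 0"
        using tendsto_enn2real[of _ 0] by simp
      then have 2: "(\<lambda>j. enn2real (Q j x) / b j) \<longlonglongrightarrow> 0"
        using b by (simp add: enn2real_mult less_imp_le)
      show "(\<lambda>j. (LBINT y. indicator (ball x (r j)) y * norm (U y - (U x + V x *v (y - x)))) / (r j * measure lborel (ball x (r j)))) \<longlonglongrightarrow> 0 \<and>
        (\<lambda>j. (LBINT y. indicator (ball x (r j)) y * norm (v y - v x)) / measure lborel (ball x (r j))) \<longlonglongrightarrow> 0"
        using 1 2 unfolding P Q measure_ball_center[of x] b_def by blast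
    qed
  qed
  then show ?thesis using r(1) r0 by blast
qed

subsection \<open>Lower bound on small balls\<close>

text \<open>The moduli on compact sets are condensed into \<open>modulus\<close>: continuity at one
  point \<open>(x0, u0)\<close>, uniform in \<open>(v, \<xi>)\<close> relative to the growth. Here
  \<open>x\<close> ranges over a full ball around \<open>x0\<close>, which may be taken small enough
  to lie in \<Omega>.\<close>

locale coercive_integrand =
  fixes p C :: real and \<Omega> :: "(real^'N::finite) set"
    and f :: "real^'N \<Rightarrow> real^'n::finite \<Rightarrow> real^'m::finite \<Rightarrow> real^'N^'n \<Rightarrow> real"
  assumes p: "1 < p" and C: "0 < C" and \<Omega>: "open \<Omega>"
    and f_nonneg: "x \<in> \<Omega> \<Longrightarrow> 0 \<le> f x u v \<xi>"
    and f_cont: "continuous_on (\<Omega> \<times> UNIV \<times> UNIV \<times> UNIV) (\<lambda>(x, u, v, \<xi>). f x u v \<xi>)"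
    and f_cqc: "x \<in> \<Omega> \<Longrightarrow> convex_quasiconvex (\<lambda>v \<xi>. f x u v \<xi>)"
    and coercive: "x \<in> \<Omega> \<Longrightarrow> 1 / C * (norm v powr p + norm \<xi>) - C \<le> f x u v \<xi>"
    and growth: "x \<in> \<Omega> \<Longrightarrow> f x u v \<xi> \<le> C * (1 + norm v powr p + norm \<xi>)"
    and modulus: "x0 \<in> \<Omega> \<Longrightarrow> 0 < \<epsilon> \<Longrightarrow> \<exists>\<delta>>0. \<forall>x u v \<xi>. norm (x - x0) \<le> \<delta> \<longrightarrow> norm (u - u0) \<le> \<delta> \<longrightarrow>
      \<bar>f x u v \<xi> - f x0 u0 v \<xi>\<bar> \<le> \<epsilon> * (1 + norm v powr p + norm \<xi>)"
begin

text \<open>\<open>f\<close> is controlled only for \<open>x \<in> \<Omega>\<close>; the indicator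
  removes all other values, and joint continuity on the open product makes the composition
  Borel.\<close>

lemma f_borel:
  assumes A: "A \<in> sets borel" "A \<subseteq> \<Omega>"
    and [measurable]: "a \<in> borel_measurable borel" "b \<in> borel_measurable borel" "c \<in> borel_measurable borel"
  shows "(\<lambda>x. indicator A x * f x (a x) (b x) (c x)) \<in> borel_measurable borel"
proof -
  let ?S = "\<Omega> \<times> (UNIV :: (real^'n) set) \<times> (UNIV :: (real^'m) set) \<times> (UNIV :: (real^'N^'n) set)"
  have "?S \<in> sets borel" by (intro borel_open open_Times \<Omega> open_UNIV)
  then have 1: "(\<lambda>q. indicator ?S q *\<^sub>R (case q of (x, u, v, \<xi>) \<Rightarrow> f x u v \<xi>)) \<in> borel_measurable borel"
    by (rule borel_measurable_continuous_on_indicator[OF _ f_cont])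
  have 2: "(\<lambda>x. (x, a x, b x, c x)) \<in> borel_measurable borel"
    by (intro borel_measurable_Pair) measurable
  from measurable_compose[OF 2 1]
  have "(\<lambda>x. indicator A x * (indicator ?S (x, a x, b x, c x) *\<^sub>R f x (a x) (b x) (c x))) \<in> borel_measurable borel"
    using A(1) by simp
  then show ?thesis
    by (rule back_subst[of "\<lambda>g. g \<in> borel_measurable borel"]) (use A(2) in \<open>auto simp: fun_eq_iff indicator_def\<close>)
qed

lemma frozen_continuous: "x \<in> \<Omega> \<Longrightarrow> continuous_on UNIV (\<lambda>(v, \<xi>). f x u v \<xi>)"
  using continuous_on_compose2[OF f_cont, of UNIV "\<lambda>(v, \<xi>). (x, u, v, \<xi>)"]
  by (simp add: case_prod_beta' continuous_intros image_subset_iff)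

lemma integrable_energy:
  assumes A: "A \<in> sets borel" "A \<subseteq> \<Omega>" "emeasure lborel A < \<infinity>"
    and m: "a \<in> borel_measurable borel" "b \<in> borel_measurable borel" "c \<in> borel_measurable borel"
    and i: "integrable lborel (\<lambda>x. indicator A x * norm (b x) powr p)" "integrable lborel (\<lambda>x. indicator A x * norm (c x))"
  shows "integrable lborel (\<lambda>x. indicator A x * f x (a x) (b x) (c x))"
proof (rule Bochner_Integration.integrable_bound)
  show "integrable lborel (\<lambda>x. C * (indicator A x + indicator A x * norm (b x) powr p + indicator A x * norm (c x)))"
    using A i by (intro integrable_mult_right Bochner_Integration.integrable_add) auto
  show "AE x in lborel. norm (indicator A x * f x (a x) (b x) (c x))
      \<le> norm (C * (indicator A x + indicator A x * norm (b x) powr p + indicator A x * norm (c x)))"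
  proof (rule AE_I2)
    fix x
    show "norm (indicator A x * f x (a x) (b x) (c x))
      \<le> norm (C * (indicator A x + indicator A x * norm (b x) powr p + indicator A x * norm (c x)))"
      using f_nonneg[of x] growth[of x "a x" "b x" "c x"] A(2) by (cases "x \<in> A") auto
  qed
qed (use f_borel[OF A(1,2) m] in simp)

text \<open>Suppose the energy on the ball is below \<open>c * b\<close>, where \<open>b\<close> is
  its volume. Coercivity then bounds the gradient and \<open>v\<close>, so the errors in
  \<open>cell_inequality\<close> and those from freezing \<open>f\<close> at \<open>(x0, u0)\<close>
  total at most \<open>\<tau> / 4 * b\<close>, and
  \<open>h vbar \<xi>0 \<le> c + \<tau> / 4\<close>. But \<open>vbar\<close> is close to
  \<open>v0\<close>, so \<open>h vbar \<xi>0 > c + \<tau> / 2\<close>. The threshold \<gamma> is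
  fixed before the radius, \<open>w\<close> and \<open>v\<close>.\<close>

lemma cell_lower_bound:
  assumes x0: "x0 \<in> \<Omega>" and c0: "0 \<le> c" and c: "c < f x0 u0 v0 \<xi>0"
  shows "\<exists>\<gamma>>0. \<forall>r w Dw v. 0 < r \<longrightarrow> r < \<gamma> \<longrightarrow> C1_map w Dw \<longrightarrow> v \<in> borel_measurable borel \<longrightarrow>
    integrable lborel (\<lambda>x. indicator (ball x0 r) x * norm (v x) powr p) \<longrightarrow>
    (LBINT x. indicator (ball x0 r) x * norm (w x - (u0 + \<xi>0 *v (x - x0)))) / (r * measure lborel (ball x0 r)) \<le> \<gamma> \<longrightarrow>
    norm ((1 / measure lborel (ball x0 r)) *\<^sub>R (LBINT x. indicator (ball x0 r) x *\<^sub>R v x) - v0) \<le> \<gamma> \<longrightarrow>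
    ennreal (c * measure lborel (ball x0 r)) \<le> (\<integral>\<^sup>+x. ennreal (indicator (ball x0 r) x * f x (w x) (v x) (Dw x)) \<partial>lborel)"
proof -
  define h where "h = f x0 u0"
  have h: "convex_quasiconvex h" "continuous_on UNIV (\<lambda>(v, \<xi>). h v \<xi>)" "\<And>v \<xi>. 0 \<le> h v \<xi>"
    "\<And>v \<xi>. h v \<xi> \<le> C * (1 + norm v powr p + norm \<xi>)"
    using f_cqc[OF x0, of u0] frozen_continuous[OF x0] f_nonneg[OF x0] growth[OF x0] by (simp_all add: h_def)
  define \<tau> where "\<tau> = h v0 \<xi>0 - c"
  have \<tau>: "\<tau> > 0" using c by (simp add: \<tau>_def h_def)
  \<comment> \<open>From \<open>1 / C * R - C * b \<le> F < c * b\<close> follows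
    \<open>R \<le> E * b\<close> for the integral \<open>R\<close> of the growth terms.\<close>
  define E where "E = C * (c + C)"
  have E: "E \<ge> 0" using C c0 by (simp add: E_def)
  define a0 where "a0 = C * (1 + norm \<xi>0)"
  have a0: "a0 > 0" using C by (simp add: a0_def add_pos_nonneg)
  have "isCont (\<lambda>v. h v \<xi>0) v0"
    unfolding isCont_def by (rule tendsto_continuous_compose2[OF h(2)]) (auto intro: tendsto_intros)
  then obtain \<delta> where \<delta>: "\<delta> > 0" "\<And>v. norm (v - v0) < \<delta> \<Longrightarrow> \<bar>h v \<xi>0 - h v0 \<xi>0\<bar> < \<tau> / 2"
    using \<tau> unfolding continuous_at_eps_delta dist_norm real_norm_def by (meson half_gt_zero)
  \<comment> \<open>Level at which \<open>v\<close> is split; since \<open>1 - p < 0\<close>, the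
    part above it has integral at most \<open>\<delta> / 8 * b\<close>.\<close>
  obtain \<Lambda> where \<Lambda>: "\<Lambda> \<ge> 1" "\<Lambda> powr (1 - p) * E \<le> \<delta> / 8"
  proof -
    have "((\<lambda>t. t powr (1 - p)) \<longlongrightarrow> 0) at_top" using p by (intro tendsto_neg_powr filterlim_ident) auto
    then have "((\<lambda>t. t powr (1 - p) * E) \<longlongrightarrow> 0 * E) at_top" by (intro tendsto_intros)
    then have "\<forall>\<^sub>F t in at_top. t powr (1 - p) * E < \<delta> / 8" using \<delta>(1) by (intro order_tendstoD(2)) auto
    then have "\<forall>\<^sub>F t in at_top. t powr (1 - p) * E < \<delta> / 8 \<and> t \<ge> 1" by (intro eventually_conj eventually_ge_at_top)
    then obtain t where "t powr (1 - p) * E < \<delta> / 8 \<and> t \<ge> 1" using eventually_happens by fastforce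
    then show thesis by (intro that[of t]) auto
  qed
  \<comment> \<open>Admissible volume fraction outside of the good set: small both for the shift of
    the mean, through \<Lambda>, and for the energy paid there, through \<open>a0\<close>.\<close>
  define t0 where "t0 = min (\<delta> / (8 * \<Lambda>)) (\<tau> / (16 * a0))"
  have t0: "t0 > 0" "\<Lambda> * t0 \<le> \<delta> / 8" "a0 * t0 \<le> \<tau> / 16"
  proof -
    show "t0 > 0" using \<delta>(1) \<Lambda>(1) \<tau> a0 by (simp add: t0_def)
    have "t0 \<le> \<delta> / (8 * \<Lambda>)" "t0 \<le> \<tau> / (16 * a0)" by (simp_all add: t0_def)
    then show "\<Lambda> * t0 \<le> \<delta> / 8" "a0 * t0 \<le> \<tau> / 16" using \<Lambda>(1) a0 by (simp_all add: field_simps)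
  qed
  \<comment> \<open>By Bernoulli's inequality the shell between the radii
    \<open>\<sigma> * r\<close> and \<open>r\<close> has volume fraction at most
    \<open>CARD('N) * s \<le> t0\<close>.\<close>
  define s where "s = min (1 / 2) (t0 / CARD('N))"
  define \<sigma> where "\<sigma> = 1 - s"
  have s: "s > 0" "s \<le> 1 / 2" "CARD('N) * s \<le> t0"
  proof -
    show "s > 0" using t0(1) by (simp add: s_def)
    show "s \<le> 1 / 2" unfolding s_def by (rule min.cobounded1)
    have "s \<le> t0 / CARD('N)" by (simp add: s_def)
    then show "CARD('N) * s \<le> t0" by (simp add: field_simps)
  qed
  have \<sigma>: "0 < \<sigma>" "\<sigma> < 1" "1 - \<sigma> ^ CARD('N) \<le> t0"
  proof -
    show "0 < \<sigma>" "\<sigma> < 1" using s by (simp_all add: \<sigma>_def)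
    have "1 + CARD('N) * (- s) \<le> (1 + - s) ^ CARD('N)" using s by (intro Bernoulli_inequality) auto
    then show "1 - \<sigma> ^ CARD('N) \<le> t0" using s(3) by (simp add: \<sigma>_def)
  qed
  have \<sigma>2: "\<sigma>\<^sup>2 < 1" using \<sigma> by (simp add: power_less_one_iff abs_square_less_1)
  \<comment> \<open>The number of levels depends only on \<open>a0\<close>, \<open>E\<close> and
    \<tau>. It is fixed before \<gamma>, since \<open>L\<close> and \<kappa> grow with it.\<close>
  obtain M :: nat where M: "M > 0" "18 * a0 * (1 + E) / M \<le> \<tau> / 16"
  proof -
    obtain M :: nat where M: "18 * a0 * (1 + E) / (\<tau> / 16) < M" using reals_Archimedean2 by blast
    moreover have "0 \<le> 18 * a0 * (1 + E) / (\<tau> / 16)" using a0 E \<tau> by simp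
    ultimately have "M > 0" by (metis of_nat_0_less_iff order_le_less_trans)
    moreover have "18 * a0 * (1 + E) / M \<le> \<tau> / 16" using M \<open>M > 0\<close> \<tau> by (simp add: field_simps)
    ultimately show thesis by (rule that)
  qed
  define \<epsilon> where "\<epsilon> = \<tau> / (16 * (1 + E))"
  have \<epsilon>: "\<epsilon> > 0" "\<epsilon> * (1 + E) = \<tau> / 16" using \<tau> E by (auto simp: \<epsilon>_def field_simps)
  obtain \<rho>1 where \<rho>1: "\<rho>1 > 0" "\<And>x u v \<xi>. norm (x - x0) \<le> \<rho>1 \<Longrightarrow> norm (u - u0) \<le> \<rho>1 \<Longrightarrow>
      \<bar>f x u v \<xi> - h v \<xi>\<bar> \<le> \<epsilon> * (1 + norm v powr p + norm \<xi>)"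
    using modulus[OF x0 \<epsilon>(1), of u0] unfolding h_def by blast
  obtain \<rho>2 where \<rho>2: "\<rho>2 > 0" "ball x0 \<rho>2 \<subseteq> \<Omega>" using \<Omega> x0 by (meson openE)
  \<comment> \<open>On the good set \<open>norm (w x - u0) \<le> r * L\<close>: the truncation level
    is at most \<open>r * 2 ^ M\<close>, a crude bound for its square root form, and the affine part
    adds \<open>norm \<xi>0 * r\<close>.\<close>
  define L where "L = 2 ^ M + norm \<xi>0"
  have L: "L \<ge> 1" by (simp add: L_def add_increasing2)
  define \<kappa> where "\<kappa> = 16 * C * M / (1 - \<sigma>\<^sup>2) + a0"
  have \<kappa>: "\<kappa> > 0" using C \<sigma>2 a0 by (simp add: \<kappa>_def add_nonneg_pos)
  \<comment> \<open>In this order: shift of the mean, volume excluded by Chebyshev, cost of cutoff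
    and excluded volume, freezing radius, and the ball inside \<Omega>.\<close>
  define \<gamma> where "\<gamma> = min (min (\<delta> / 8) t0) (min (\<tau> / (16 * \<kappa>)) (min (\<rho>1 / L) \<rho>2))"
  have \<gamma>: "\<gamma> > 0" "\<gamma> \<le> \<delta> / 8" "\<gamma> \<le> t0" "\<kappa> * \<gamma> \<le> \<tau> / 16" "\<gamma> * L \<le> \<rho>1" "\<gamma> \<le> \<rho>2"
  proof -
    show "\<gamma> > 0" using \<delta>(1) t0(1) \<tau> \<kappa> \<rho>1(1) L \<rho>2(1) by (simp add: \<gamma>_def)
    have "\<gamma> \<le> \<tau> / (16 * \<kappa>)" "\<gamma> \<le> \<rho>1 / L" by (simp_all add: \<gamma>_def)
    then show "\<kappa> * \<gamma> \<le> \<tau> / 16" "\<gamma> * L \<le> \<rho>1" using \<kappa> L by (simp_all add: field_simps)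
  qed (simp_all only: \<gamma>_def min_le_iff_disj order_refl simp_thms)
  have "ennreal (c * measure lborel (ball x0 r)) \<le> (\<integral>\<^sup>+x. ennreal (indicator (ball x0 r) x * f x (w x) (v x) (Dw x)) \<partial>lborel)"
    if r: "0 < r" "r < \<gamma>" and w: "C1_map w Dw" and v [measurable]: "v \<in> borel_measurable borel"
      and vi: "integrable lborel (\<lambda>x. indicator (ball x0 r) x * norm (v x) powr p)"
      and I: "(LBINT x. indicator (ball x0 r) x * norm (w x - (u0 + \<xi>0 *v (x - x0)))) / (r * measure lborel (ball x0 r)) \<le> \<gamma>"
      and av: "norm ((1 / measure lborel (ball x0 r)) *\<^sub>R (LBINT x. indicator (ball x0 r) x *\<^sub>R v x) - v0) \<le> \<gamma>"
    for r w Dw v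
  proof (rule ccontr)
    let ?B = "ball x0 r"
    define b where "b = measure lborel ?B"
    have b: "b > 0" using content_ball_pos[OF r(1)] by (simp add: b_def)
    have B\<Omega>: "?B \<subseteq> \<Omega>" using r(2) \<gamma>(6) \<rho>2(2) by force
    note wm [measurable] = borel_measurable_C1_map[OF w] and wc = C1_map_continuous[OF w]
    have finB: "emeasure lborel ?B < \<infinity>" by (rule emeasure_lborel_ball_finite)
    have iB: "integrable lborel (indicator ?B :: real^'N \<Rightarrow> real)" using finB by simp
    have iDw: "integrable lborel (\<lambda>x. indicator ?B x * norm (Dw x))"
      by (intro integrable_on_ball_continuous continuous_intros wc)
    have iF: "integrable lborel (\<lambda>x. indicator ?B x * f x (w x) (v x) (Dw x))"
      by (rule integrable_energy[OF _ B\<Omega> finB wm(1) v wm(2) vi iDw]) simp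
    define F where "F = (LBINT x. indicator ?B x * f x (w x) (v x) (Dw x))"
    have F0: "0 \<le> indicator ?B x * f x (w x) (v x) (Dw x)" for x
      using f_nonneg B\<Omega> by (auto simp: indicator_def)
    have eq: "(\<integral>\<^sup>+x. ennreal (indicator ?B x * f x (w x) (v x) (Dw x)) \<partial>lborel) = ennreal F"
      unfolding F_def by (rule nn_integral_eq_integral[OF iF]) (use F0 in auto)
    assume "\<not> ?thesis"
    then have "ennreal F < ennreal (c * b)"
      unfolding eq not_le b_def .
    then have F: "F < c * b" using c0 b by (simp add: ennreal_less_iff F_def integral_nonneg_AE F0)
    define R where "R = (LBINT x. indicator ?B x * norm (v x) powr p) + (LBINT x. indicator ?B x * norm (Dw x))"
    have "1 / C * R - C * b = (LBINT x. 1 / C * (indicator ?B x * norm (v x) powr p + indicator ?B x * norm (Dw x)) - C * indicator ?B x)"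
      using vi iDw iB by (simp add: R_def b_def)
    also have "\<dots> \<le> F"
      unfolding F_def
    proof (rule integral_mono[OF _ iF])
      fix x
      show "1 / C * (indicator ?B x * norm (v x) powr p + indicator ?B x * norm (Dw x)) - C * indicator ?B x
        \<le> indicator ?B x * f x (w x) (v x) (Dw x)"
        using coercive[of x "v x" "Dw x" "w x"] B\<Omega> by (cases "x \<in> ?B") auto
    qed (use vi iDw iB in auto)
    finally have "1 / C * R \<le> (c + C) * b" using F by (simp add: algebra_simps)
    then have RE: "R \<le> E * b" using C by (simp add: E_def field_simps)
    have parts: "(LBINT x. indicator ?B x * norm (v x) powr p) \<le> R" "(LBINT x. indicator ?B x * norm (Dw x)) \<le> R"
      by (auto simp: R_def integral_nonneg_AE)
    have iG: "(LBINT x. indicator ?B x * (1 + norm (Dw x))) \<le> (1 + E) * b"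
    proof -
      have "(LBINT x. indicator ?B x * (1 + norm (Dw x))) = b + (LBINT x. indicator ?B x * norm (Dw x))"
        using iB iDw by (simp add: distrib_left b_def)
      then show ?thesis using parts(2) RE by (simp add: algebra_simps)
    qed
    define I where "I = (LBINT x. indicator ?B x * norm (w x - (u0 + \<xi>0 *v (x - x0))))"
    have I\<gamma>: "I / r \<le> \<gamma> * b" using that(6) r b by (simp add: I_def b_def[symmetric] field_simps)
    obtain G where G: "G \<in> sets borel" "G \<subseteq> ?B" "\<And>x. x \<in> G \<Longrightarrow> (norm (w x - (u0 + \<xi>0 *v (x - x0))))\<^sup>2 \<le> r\<^sup>2 * 2 ^ M"
      and Gm: "measure lborel (?B - G) \<le> (1 - \<sigma> ^ CARD('N)) * b + I / r"
      and main: "b * h ((1 / b) *\<^sub>R (LBINT x. indicator G x *\<^sub>R v x)) \<xi>0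
        \<le> (LBINT x. indicator G x * h (v x) (Dw x))
          + 18 * C * (1 + norm \<xi>0) / M * (LBINT x. indicator ?B x * (1 + norm (Dw x)))
          + 16 * C * M / (1 - \<sigma>\<^sup>2) * (I / r) + C * (1 + norm \<xi>0) * measure lborel (?B - G)"
      using cell_inequality[OF h(1,2,3,4) _ _ r(1) \<sigma>(1,2) M(1) w v vi, of u0 \<xi>0] p C
      unfolding I_def b_def by auto
    have "(1 - \<sigma> ^ CARD('N)) * b \<le> t0 * b" using \<sigma>(3) b by (intro mult_right_mono) auto
    then have Gm': "measure lborel (?B - G) \<le> (t0 + \<gamma>) * b" using Gm I\<gamma> by (simp add: distrib_right)
    note [measurable] = G(1)
    have iE: "integrable lborel (indicator (?B - G) :: real^'N \<Rightarrow> real)"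
      using integrable_indicator_subset[of ?B "\<lambda>_. 1" "?B - G"] iB G(1) by simp
    have igr: "integrable lborel (\<lambda>x. indicator ?B x + indicator ?B x * norm (v x) powr p + indicator ?B x * norm (Dw x))"
      using iB vi iDw by simp
    have hG: "(LBINT x. indicator G x * h (v x) (Dw x)) \<le> F + \<epsilon> * (b + R)"
    proof -
      have pt: "indicator G x * h (v x) (Dw x) \<le> indicator ?B x * f x (w x) (v x) (Dw x)
          + \<epsilon> * (indicator ?B x + indicator ?B x * norm (v x) powr p + indicator ?B x * norm (Dw x))" for x
      proof (cases "x \<in> G")
        case True
        have xB: "x \<in> ?B" using True G(2) by auto
        then have xr: "norm (x - x0) < r" by (simp add: dist_norm norm_minus_commute)
        have "(2 :: real) ^ M \<le> (2 ^ M)\<^sup>2" by (simp add: power2_eq_square)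
        then have "(norm (w x - (u0 + \<xi>0 *v (x - x0))))\<^sup>2 \<le> (r * 2 ^ M)\<^sup>2"
          using G(3)[OF True] by (simp add: power_mult_distrib) (meson mult_left_mono order_trans zero_le_power2)
        then have 1: "norm (w x - (u0 + \<xi>0 *v (x - x0))) \<le> r * 2 ^ M" using r by (simp add: power2_le_iff_abs_le)
        have 2: "norm (\<xi>0 *v (x - x0)) \<le> norm \<xi>0 * r"
          using norm_matrix_vector_mult_le[of \<xi>0 "x - x0"] xr by (meson less_imp_le mult_left_mono norm_ge_zero order_trans)
        have "norm (w x - u0) \<le> norm (w x - (u0 + \<xi>0 *v (x - x0))) + norm (\<xi>0 *v (x - x0))"
          using norm_triangle_ineq[of "w x - (u0 + \<xi>0 *v (x - x0))" "\<xi>0 *v (x - x0)"] by simp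
        also have "\<dots> \<le> r * L" using 1 2 by (simp add: L_def algebra_simps)
        also have "\<dots> \<le> \<gamma> * L" using r L by (intro mult_right_mono) auto
        finally have wu: "norm (w x - u0) \<le> \<rho>1" using \<gamma>(5) by simp
        have "norm (x - x0) \<le> \<gamma> * 1" using xr r by simp
        also have "\<dots> \<le> \<gamma> * L" using \<gamma>(1) L by (intro mult_left_mono) auto
        finally have "norm (x - x0) \<le> \<rho>1" using \<gamma>(5) by simp
        from \<rho>1(2)[OF this wu, of "v x" "Dw x"] show ?thesis using True xB by (simp add: abs_le_iff)
      next
        case False
        then show ?thesis using F0[of x] \<epsilon>(1) by (simp add: indicator_def)
      qed
      have ih: "integrable lborel (\<lambda>x. indicator G x * h (v x) (Dw x))"
      proof (rule Bochner_Integration.integrable_bound[OF Bochner_Integration.integrable_add[OF iF integrable_mult_right[OF igr, of \<epsilon>]]])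
        show "(\<lambda>x. indicator G x * h (v x) (Dw x)) \<in> borel_measurable lborel"
          by (intro borel_measurable_times borel_measurable_indicator borel_measurable_continuous_compose2[OF h(2)])
            (use G(1) wm v in auto)
        have "0 \<le> indicator G x * h (v x) (Dw x)" for x using h(3) by (simp add: indicator_def)
        then show "AE x in lborel. norm (indicator G x * h (v x) (Dw x)) \<le> norm (indicator ?B x * f x (w x) (v x) (Dw x)
          + \<epsilon> * (indicator ?B x + indicator ?B x * norm (v x) powr p + indicator ?B x * norm (Dw x)))"
          using pt by (intro AE_I2) (simp add: order_trans[OF _ abs_ge_self])
      qed
      have "(LBINT x. indicator G x * h (v x) (Dw x))
        \<le> (LBINT x. indicator ?B x * f x (w x) (v x) (Dw x)
          + \<epsilon> * (indicator ?B x + indicator ?B x * norm (v x) powr p + indicator ?B x * norm (Dw x)))"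
        by (intro integral_mono ih Bochner_Integration.integrable_add iF integrable_mult_right igr pt)
      also have "\<dots> = F + \<epsilon> * (b + R)"
        using iF iB vi iDw by (simp add: F_def b_def R_def)
      finally show ?thesis .
    qed
    \<comment> \<open>Normalised by the whole ball and not by \<open>G\<close>: the mean of the
      field that equals \<open>v\<close> on \<open>G\<close> and 0 elsewhere.\<close>
    define vbar where "vbar = (1 / b) *\<^sub>R (LBINT x. indicator G x *\<^sub>R v x)"
    have "b * h vbar \<xi>0 \<le> (c * b + \<epsilon> * ((1 + E) * b)) + 18 * a0 / M * ((1 + E) * b)
        + 16 * C * M / (1 - \<sigma>\<^sup>2) * (\<gamma> * b) + a0 * ((t0 + \<gamma>) * b)"
    proof -
      have "\<epsilon> * (b + R) \<le> \<epsilon> * ((1 + E) * b)" using RE \<epsilon>(1) by (intro mult_left_mono) (auto simp: algebra_simps)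
      then have 1: "(LBINT x. indicator G x * h (v x) (Dw x)) \<le> c * b + \<epsilon> * ((1 + E) * b)" using hG F by simp
      have 2: "18 * C * (1 + norm \<xi>0) / M * (LBINT x. indicator ?B x * (1 + norm (Dw x))) \<le> 18 * a0 / M * ((1 + E) * b)"
        using mult_left_mono[OF iG, of "18 * a0 / M"] a0 by (simp add: a0_def mult.assoc)
      have 3: "16 * C * M / (1 - \<sigma>\<^sup>2) * (I / r) \<le> 16 * C * M / (1 - \<sigma>\<^sup>2) * (\<gamma> * b)"
        using I\<gamma> C \<sigma>2 by (intro mult_left_mono) auto
      have 4: "C * (1 + norm \<xi>0) * measure lborel (?B - G) \<le> a0 * ((t0 + \<gamma>) * b)"
        using Gm' a0 by (auto simp: a0_def[symmetric] intro: mult_left_mono)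
      show ?thesis using main 1 2 3 4 unfolding vbar_def by linarith
    qed
    also have "\<dots> = b * (c + \<epsilon> * (1 + E) + 18 * a0 * (1 + E) / M + \<kappa> * \<gamma> + a0 * t0)"
      by (simp add: \<kappa>_def algebra_simps)
    also have "\<dots> \<le> b * (c + \<tau> / 16 + \<tau> / 16 + \<tau> / 16 + \<tau> / 16)"
      using \<epsilon>(2) M(2) \<gamma>(4) t0(3) b by (intro mult_left_mono add_mono) auto
    finally have hle: "h vbar \<xi>0 \<le> c + \<tau> / 4" using b by simp
    \<comment> \<open>Dropping the complement of \<open>G\<close> moves the mean by at most
      \<open>3 * \<delta> / 8\<close>; the mean over the full ball is within
      \<open>\<delta> / 8\<close> of \<open>v0\<close>.\<close>
    have "norm (vbar - v0) < \<delta>"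
    proof -
      have iv: "integrable lborel (\<lambda>x. indicator ?B x *\<^sub>R v x)"
        using convex_quasiconvex_Lp(3)[OF h(1,2), of C p r "r/2" "\<lambda>_. 0" "\<lambda>_. 0" x0 v] h(3,4) p C r vi
        by (auto simp: C1_map_def)
      have iGv: "integrable lborel (\<lambda>x. indicator G x *\<^sub>R v x)"
      proof -
        have "integrable lborel (\<lambda>x. indicator G x *\<^sub>R (indicator ?B x *\<^sub>R v x))"
          by (rule integrable_bounded_scaleR[OF iv, where B=1]) (auto simp: indicator_def)
        then show ?thesis
          by (rule back_subst[of "integrable lborel"]) (use G(2) in \<open>auto simp: indicator_def fun_eq_iff\<close>)
      qed
      have "norm ((LBINT x. indicator ?B x *\<^sub>R v x) - (LBINT x. indicator G x *\<^sub>R v x))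
        = norm (LBINT x. indicator ?B x *\<^sub>R v x - indicator G x *\<^sub>R v x)"
        using iv iGv by simp
      also have "\<dots> \<le> (LBINT x. norm (indicator ?B x *\<^sub>R v x - indicator G x *\<^sub>R v x))" by (rule integral_norm_bound)
      also have "\<dots> \<le> (LBINT x. \<Lambda> * indicator (?B - G) x + \<Lambda> powr (1 - p) * (indicator ?B x * norm (v x) powr p))"
      proof (rule integral_mono)
        fix x
        \<comment> \<open>Above the level, \<open>norm (v x)\<close> is
          \<open>norm (v x) powr (1 - p)\<close> times \<open>norm (v x) powr p\<close>, and the
          first factor decreases. This is the uniform integrability provided by
          \<open>p > 1\<close>.\<close>
        have "norm (v x) \<le> \<Lambda> + \<Lambda> powr (1 - p) * norm (v x) powr p"
        proof (cases "norm (v x) \<le> \<Lambda>")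
          case False
          have "norm (v x) = norm (v x) powr (1 - p) * norm (v x) powr p"
            using False \<Lambda>(1) by (simp flip: powr_add)
          also have "\<dots> \<le> \<Lambda> powr (1 - p) * norm (v x) powr p"
            using False \<Lambda>(1) p by (intro mult_right_mono powr_mono2') auto
          finally show ?thesis using \<Lambda>(1) by linarith
        qed (simp add: add_increasing2)
        moreover have "0 \<le> \<Lambda> powr (1 - p) * norm (v x) powr p" by simp
        ultimately show "norm (indicator ?B x *\<^sub>R v x - indicator G x *\<^sub>R v x)
          \<le> \<Lambda> * indicator (?B - G) x + \<Lambda> powr (1 - p) * (indicator ?B x * norm (v x) powr p)"
          using G(2) by (auto simp: indicator_def)
      qed (use iv iGv iE vi in auto)
      also have "\<dots> = \<Lambda> * measure lborel (?B - G) + \<Lambda> powr (1 - p) * (LBINT x. indicator ?B x * norm (v x) powr p)"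
        using iE vi by simp
      also have "\<dots> \<le> \<Lambda> * ((t0 + \<gamma>) * b) + \<Lambda> powr (1 - p) * (E * b)"
        using Gm' \<Lambda>(1) parts(1) RE by (intro add_mono mult_left_mono) auto
      also have "\<dots> = b * (\<Lambda> * t0 + \<Lambda> * \<gamma> + \<Lambda> powr (1 - p) * E)" by (simp add: algebra_simps)
      also have "\<dots> \<le> b * (\<delta> / 8 + \<delta> / 8 + \<delta> / 8)"
      proof -
        have "\<Lambda> * \<gamma> \<le> \<Lambda> * t0" using \<gamma>(3) \<Lambda>(1) by (intro mult_left_mono) auto
        then have "\<Lambda> * \<gamma> \<le> \<delta> / 8" using t0(2) by linarith
        then show ?thesis using t0(2) \<Lambda>(2) b by (intro mult_left_mono add_mono) auto
      qed
      finally have d: "norm ((LBINT x. indicator ?B x *\<^sub>R v x) - (LBINT x. indicator G x *\<^sub>R v x)) \<le> b * (3 * \<delta> / 8)" by simp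
      have "norm ((1 / b) *\<^sub>R (LBINT x. indicator ?B x *\<^sub>R v x) - vbar) \<le> 3 * \<delta> / 8"
      proof -
        have "norm ((1 / b) *\<^sub>R (LBINT x. indicator ?B x *\<^sub>R v x) - vbar)
          = norm ((LBINT x. indicator ?B x *\<^sub>R v x) - (LBINT x. indicator G x *\<^sub>R v x)) / b"
          unfolding vbar_def using b by (simp flip: scaleR_diff_right)
        also have "\<dots> \<le> 3 * \<delta> / 8" using d b by (simp add: pos_divide_le_eq mult.commute)
        finally show ?thesis .
      qed
      moreover have "norm ((1 / b) *\<^sub>R (LBINT x. indicator ?B x *\<^sub>R v x) - v0) \<le> \<delta> / 8"
        using av \<gamma>(2) unfolding b_def by linarith
      ultimately have "norm (vbar - v0) \<le> 3 * \<delta> / 8 + \<delta> / 8"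
        by (metis add_mono norm_minus_commute norm_diff_triangle_le)
      then show ?thesis using \<delta>(1) by simp
    qed
    then have "\<bar>h vbar \<xi>0 - h v0 \<xi>0\<bar> < \<tau> / 2" by (rule \<delta>(2))
    then show False using hle \<tau> \<tau>_def by linarith
  qed
  then show ?thesis using \<gamma>(1) by blast
qed

end

subsection \<open>Lower semicontinuity for continuously differentiable sequences\<close>

lemma ennreal_Liminf_add_null:
  fixes x e :: "nat \<Rightarrow> ennreal"
  assumes "e \<longlonglongrightarrow> 0"
  shows "liminf (\<lambda>k. x k + e k) \<le> liminf x"
proof (rule ennreal_le_epsilon)
  fix \<epsilon> :: real assume "\<epsilon> > 0"
  then have "\<forall>\<^sub>F k in sequentially. e k < ennreal \<epsilon>" using assms by (intro order_tendstoD(2)) auto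
  then have "liminf (\<lambda>k. x k + e k) \<le> liminf (\<lambda>k. x k + ennreal \<epsilon>)"
    by (intro Liminf_mono) (auto elim!: eventually_mono intro: add_left_mono less_imp_le)
  also have "\<dots> = liminf x + ennreal \<epsilon>" by (rule Liminf_add_const) simp
  finally show "liminf (\<lambda>k. x k + e k) \<le> liminf x + ennreal \<epsilon>" .
qed

context coercive_integrand
begin

text \<open>Centres lie in \<open>K\<close>, the energy is collected on the larger
  \<open>K'\<close>, and small balls around centres fit into \<open>K'\<close>. At almost every
  centre, \<open>cell_lower_bound\<close> applies for small radii and then for large
  \<open>k\<close>: L1 convergence controls \<open>w k\<close> and weak convergence the mean of
  \<open>vk k\<close> on each fixed ball.\<close>

lemma lsc_C1:
  assumes K: "compact K" "K \<subseteq> \<Omega>" and d: "0 < d" and K': "compact K'" "K' \<subseteq> \<Omega>" "\<And>x. x \<in> K \<Longrightarrow> cball x d \<subseteq> K'"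
    and UV: "borel_weak_gradient \<Omega> U V" and v [measurable]: "v \<in> borel_measurable borel" and vi: "integrable lborel v"
    and w: "\<And>k. C1_map (w k) (Dw k)"
    and vk [measurable]: "\<And>k. vk k \<in> borel_measurable borel"
    and vki: "\<And>k. integrable lborel (\<lambda>x. indicator K' x * norm (vk k x) powr p)"
    and wU: "(\<lambda>k. \<integral>\<^sup>+x. indicator K' x * ennreal (norm (w k x - U x)) \<partial>lborel) \<longlonglongrightarrow> 0"
    and weak: "\<And>x r. ball x r \<subseteq> K' \<Longrightarrow>
      (\<lambda>k. \<integral>y. indicator (ball x r) y *\<^sub>R vk k y \<partial>lborel) \<longlonglongrightarrow> (LBINT y. indicator (ball x r) y *\<^sub>R v y)"
  shows "(\<integral>\<^sup>+x. ennreal (indicator K x * f x (U x) (v x) (V x)) \<partial>lborel)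
    \<le> liminf (\<lambda>k. \<integral>\<^sup>+x. ennreal (indicator K' x * f x (w k x) (vk k x) (Dw k x)) \<partial>lborel)"
proof -
  have [measurable]: "U \<in> borel_measurable borel" "V \<in> borel_measurable borel" "K \<in> sets borel" "K' \<in> sets borel"
    and Ui: "integrable lborel U"
    using UV K K' by (auto simp: borel_weak_gradient_def borel_compact)
  note [measurable] = borel_measurable_C1_map[OF w]
  obtain r where r: "\<And>j. 0 < r j" "r \<longlonglongrightarrow> 0"
    and good: "AE x in lborel. x \<in> K \<longrightarrow>
      (\<lambda>j. (LBINT y. indicator (ball x (r j)) y * norm (U y - (U x + V x *v (y - x)))) / (r j * measure lborel (ball x (r j)))) \<longlonglongrightarrow> 0 \<and>
      (\<lambda>j. (LBINT y. indicator (ball x (r j)) y * norm (v y - v x)) / measure lborel (ball x (r j))) \<longlonglongrightarrow> 0"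
    using vanishing_ball_averages[OF UV \<Omega> K v vi] by blast
  define g where "g k x = ennreal (indicator K' x * f x (w k x) (vk k x) (Dw k x))" for k x
  have [measurable]: "g k \<in> borel_measurable borel" for k
  proof -
    have "(\<lambda>x. indicator K' x * f x (w k x) (vk k x) (Dw k x)) \<in> borel_measurable borel"
      by (rule f_borel) (use K' in measurable)
    then show ?thesis unfolding g_def[abs_def] by measurable
  qed
  define b where "b j = measure lborel (ball (0 :: real^'N) (r j))" for j
  have b: "b j > 0" for j using content_ball_pos[OF r(1)] by (simp add: b_def)
  have bx: "measure lborel (ball x (r j)) = b j" for x :: "real^'N" and j by (simp add: b_def measure_ball_center[of x])
  \<comment> \<open>Written with the shift \<open>z\<close> in a ball around 0, so that the domain
    of the inner integral does not depend on \<open>x\<close>.\<close>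
  define A where "A k j x = ennreal (1 / b j) * (\<integral>\<^sup>+z. indicator (ball 0 (r j)) z * g k (x + z) \<partial>lborel)" for k j x
  have [measurable]: "A k j \<in> borel_measurable borel" for k j
  proof -
    have "(\<lambda>x. \<integral>\<^sup>+z. indicator (ball 0 (r j)) z * g k (x + z) \<partial>lborel) \<in> borel_measurable borel" by measurable
    then show ?thesis unfolding A_def[abs_def] by measurable
  qed
  \<comment> \<open>An exact identity, because \<open>g k\<close> is taken on the whole space and
    every point is covered by the balls with total weight 1.\<close>
  have tonelli: "(\<integral>\<^sup>+x. A k j x \<partial>lborel) = (\<integral>\<^sup>+x. g k x \<partial>lborel)" for k j
  proof -
    have "(\<integral>\<^sup>+x. A k j x \<partial>lborel)
      = ennreal (1 / b j) * (\<integral>\<^sup>+x. (\<integral>\<^sup>+z. indicator (ball 0 (r j)) z * g k (x + z) \<partial>lborel) \<partial>lborel)"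
      unfolding A_def by (rule nn_integral_cmult) measurable
    also have "(\<integral>\<^sup>+x. (\<integral>\<^sup>+z. indicator (ball 0 (r j)) z * g k (x + z) \<partial>lborel) \<partial>lborel)
      = (\<integral>\<^sup>+z. (\<integral>\<^sup>+x. indicator (ball 0 (r j)) z * g k (x + z) \<partial>lborel) \<partial>lborel)"
      by (rule lborel_pair.Fubini') measurable
    also have "\<dots> = (\<integral>\<^sup>+z. (\<integral>\<^sup>+x. g k x \<partial>lborel) * indicator (ball (0 :: real^'N) (r j)) z \<partial>lborel)"
    proof (rule nn_integral_cong)
      fix z :: "real^'N"
      have "(\<integral>\<^sup>+x. indicator (ball 0 (r j)) z * g k (x + z) \<partial>lborel) = indicator (ball 0 (r j)) z * (\<integral>\<^sup>+x. g k (x + z) \<partial>lborel)"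
        by (rule nn_integral_cmult) measurable
      then show "(\<integral>\<^sup>+x. indicator (ball 0 (r j)) z * g k (x + z) \<partial>lborel) = (\<integral>\<^sup>+x. g k x \<partial>lborel) * indicator (ball 0 (r j)) z"
        by (simp add: nn_integral_lborel_translate(1) mult.commute)
    qed
    also have "\<dots> = (\<integral>\<^sup>+x. g k x \<partial>lborel) * emeasure lborel (ball (0 :: real^'N) (r j))"
      by (rule nn_integral_cmult_indicator) simp
    also have "emeasure lborel (ball (0 :: real^'N) (r j)) = ennreal (b j)"
      unfolding b_def using emeasure_lborel_ball_finite[of "0 :: real^'N" "r j"] by (intro emeasure_eq_ennreal_measure) auto
    also have "ennreal (1 / b j) * ((\<integral>\<^sup>+x. g k x \<partial>lborel) * ennreal (b j)) = (\<integral>\<^sup>+x. g k x \<partial>lborel) * (ennreal (1 / b j) * ennreal (b j))"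
      by (simp add: mult_ac)
    also have "ennreal (1 / b j) * ennreal (b j) = 1" using b[of j] by (simp flip: ennreal_mult)
    finally show ?thesis by simp
  qed
  \<comment> \<open>Fatou's lemma, outside for \<open>j\<close> and inside for \<open>k\<close>. By
    Tonelli the bound \<open>Lim\<close> of the inner one is the same for all radii.\<close>
  define Lim where "Lim = liminf (\<lambda>k. \<integral>\<^sup>+x. g k x \<partial>lborel)"
  have "(\<integral>\<^sup>+x. liminf (\<lambda>j. liminf (\<lambda>k. A k j x)) \<partial>lborel) \<le> liminf (\<lambda>j. \<integral>\<^sup>+x. liminf (\<lambda>k. A k j x) \<partial>lborel)"
    by (rule nn_integral_liminf) measurable
  also have "\<dots> \<le> liminf (\<lambda>j. Lim)"
  proof (intro Liminf_mono always_eventually allI)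
    fix j
    have "(\<integral>\<^sup>+x. liminf (\<lambda>k. A k j x) \<partial>lborel) \<le> liminf (\<lambda>k. \<integral>\<^sup>+x. A k j x \<partial>lborel)"
      by (rule nn_integral_liminf) measurable
    then show "(\<integral>\<^sup>+x. liminf (\<lambda>k. A k j x) \<partial>lborel) \<le> Lim" by (simp add: tonelli Lim_def)
  qed
  also have "\<dots> = Lim" by (simp add: Liminf_const)
  finally have upper: "(\<integral>\<^sup>+x. liminf (\<lambda>j. liminf (\<lambda>k. A k j x)) \<partial>lborel) \<le> Lim" .
  have "AE x in lborel. ennreal (indicator K x * f x (U x) (v x) (V x)) \<le> liminf (\<lambda>j. liminf (\<lambda>k. A k j x))"
    using good
  proof eventually_elim
    case (elim x)
    show ?case
    proof (cases "x \<in> K")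
      case x: True
      then have x\<Omega>: "x \<in> \<Omega>" using K by auto
      have e1: "(\<lambda>j. (LBINT y. indicator (ball x (r j)) y * norm (U y - (U x + V x *v (y - x)))) / (r j * b j)) \<longlonglongrightarrow> 0"
        and e2: "(\<lambda>j. (LBINT y. indicator (ball x (r j)) y * norm (v y - v x)) / b j) \<longlonglongrightarrow> 0"
        using elim x by (simp_all add: bx)
      \<comment> \<open>The bound on a ball needs strict room below the value of \<open>f\<close>,
        which is recovered at the end by density.\<close>
      have "y \<le> liminf (\<lambda>j. liminf (\<lambda>k. A k j x))" if y: "y < ennreal (f x (U x) (v x) (V x))" for y
      proof -
        obtain c where c: "y = ennreal c" "0 \<le> c" using y by (cases y) auto
        then have cf: "c < f x (U x) (v x) (V x)" using y by (simp add: ennreal_less_iff)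
        obtain \<gamma> where \<gamma>: "\<gamma> > 0" and low: "\<And>r w Dw vv. 0 < r \<Longrightarrow> r < \<gamma> \<Longrightarrow> C1_map w Dw \<Longrightarrow> vv \<in> borel_measurable borel \<Longrightarrow>
            integrable lborel (\<lambda>y. indicator (ball x r) y * norm (vv y) powr p) \<Longrightarrow>
            (LBINT y. indicator (ball x r) y * norm (w y - (U x + V x *v (y - x)))) / (r * measure lborel (ball x r)) \<le> \<gamma> \<Longrightarrow>
            norm ((1 / measure lborel (ball x r)) *\<^sub>R (LBINT y. indicator (ball x r) y *\<^sub>R vv y) - v x) \<le> \<gamma> \<Longrightarrow>
            ennreal (c * measure lborel (ball x r)) \<le> (\<integral>\<^sup>+y. ennreal (indicator (ball x r) y * f y (w y) (vv y) (Dw y)) \<partial>lborel)"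
          using cell_lower_bound[OF x\<Omega> c(2) cf] by blast
        \<comment> \<open>First \<open>j\<close>, then \<open>k\<close> depending on
          \<open>j\<close>: half of \<gamma> goes to the expansion of the limit functions on the
          ball, the other half to the distance of the sequence from them.\<close>
        have "\<forall>\<^sub>F j in sequentially. r j < min \<gamma> d
           \<and> (LBINT y. indicator (ball x (r j)) y * norm (U y - (U x + V x *v (y - x)))) / (r j * b j) < \<gamma> / 2
           \<and> (LBINT y. indicator (ball x (r j)) y * norm (v y - v x)) / b j < \<gamma> / 2"
          using \<gamma> d by (intro eventually_conj order_tendstoD(2)[OF r(2)] order_tendstoD(2)[OF e1] order_tendstoD(2)[OF e2]) auto
        then have "\<forall>\<^sub>F j in sequentially. y \<le> liminf (\<lambda>k. A k j x)"
        proof eventually_elim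
          case (elim j)
          let ?B = "ball x (r j)"
          have BK: "?B \<subseteq> K'" using K'(3)[OF x] elim by force
          have iB: "integrable lborel (indicator ?B :: real^'N \<Rightarrow> real)" using emeasure_lborel_ball_finite[of x "r j"] by simp
          have iUB: "integrable lborel (\<lambda>y. indicator ?B y *\<^sub>R U y)"
            by (rule integrable_bounded_scaleR[OF Ui, where B=1]) (auto simp: indicator_def)
          have iwB: "integrable lborel (\<lambda>y. indicator ?B y *\<^sub>R w k y)" for k
          proof -
            have "integrable lborel (\<lambda>y. indicator (cball x (r j)) y *\<^sub>R w k y)"
              using C1_map_continuous(1)[OF w] by (intro borel_integrable_compact) (auto intro: continuous_on_subset)
            then have "integrable lborel (\<lambda>y. indicator ?B y *\<^sub>R (indicator (cball x (r j)) y *\<^sub>R w k y))"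
              by (rule integrable_bounded_scaleR[where B=1]) (auto simp: indicator_def)
            then show ?thesis by (rule back_subst[of "integrable lborel"]) (auto simp: indicator_def fun_eq_iff)
          qed
          have iaB: "integrable lborel (\<lambda>y. indicator ?B y *\<^sub>R (U x + V x *v (y - x)))"
          proof -
            have "continuous_on UNIV (\<lambda>y. U x + V x *v (y - x))"
              by (intro continuous_intros linear_continuous_on_compose[OF _ matrix_vector_mul_linear])
            then have "integrable lborel (\<lambda>y. indicator (cball x (r j)) y *\<^sub>R (U x + V x *v (y - x)))"
              by (intro borel_integrable_compact) (auto intro: continuous_on_subset)
            then have "integrable lborel (\<lambda>y. indicator ?B y *\<^sub>R (indicator (cball x (r j)) y *\<^sub>R (U x + V x *v (y - x))))"
              by (rule integrable_bounded_scaleR[where B=1]) (auto simp: indicator_def)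
            then show ?thesis by (rule back_subst[of "integrable lborel"]) (auto simp: indicator_def fun_eq_iff)
          qed
          have norm_diff: "integrable lborel (\<lambda>y. indicator ?B y * norm (F y - G y))"
            if "integrable lborel (\<lambda>y. indicator ?B y *\<^sub>R F y)" "integrable lborel (\<lambda>y. indicator ?B y *\<^sub>R G y)"
            for F G :: "real^'N \<Rightarrow> 'q::euclidean_space"
          proof -
            have "integrable lborel (\<lambda>y. norm (indicator ?B y *\<^sub>R F y - indicator ?B y *\<^sub>R G y))"
              using that by (intro integrable_norm Bochner_Integration.integrable_diff)
            then show ?thesis by (simp flip: scaleR_diff_right)
          qed
          have wUB: "(\<lambda>k. (LBINT y. indicator ?B y * norm (w k y - U y))) \<longlonglongrightarrow> 0"
          proof -
            have "(\<lambda>k. \<integral>\<^sup>+y. ennreal (indicator ?B y * norm (w k y - U y)) \<partial>lborel) \<longlonglongrightarrow> 0"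
            proof (rule tendsto_sandwich[OF _ _ tendsto_const wU])
              show "\<forall>\<^sub>F k in sequentially. (\<integral>\<^sup>+y. ennreal (indicator ?B y * norm (w k y - U y)) \<partial>lborel)
                \<le> (\<integral>\<^sup>+x. indicator K' x * ennreal (norm (w k x - U x)) \<partial>lborel)"
                using BK by (intro always_eventually allI nn_integral_mono) (auto simp: indicator_def)
            qed simp
            then have "(\<lambda>k. enn2real (\<integral>\<^sup>+y. ennreal (indicator ?B y * norm (w k y - U y)) \<partial>lborel)) \<longlonglongrightarrow> 0"
              using tendsto_enn2real[of _ 0] by simp
            then show ?thesis by (subst integral_eq_nn_integral) auto
          qed
          have "\<forall>\<^sub>F k in sequentially. (LBINT y. indicator ?B y * norm (w k y - U y)) < \<gamma> / 2 * (r j * b j)"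
            using \<gamma> r(1)[of j] b[of j] by (intro order_tendstoD(2)[OF wUB]) auto
          moreover have "\<forall>\<^sub>F k in sequentially. dist (LBINT y. indicator ?B y *\<^sub>R vk k y) (LBINT y. indicator ?B y *\<^sub>R v y) < \<gamma> / 2 * b j"
            using \<gamma> b[of j] by (intro tendstoD[OF weak[OF BK]]) auto
          ultimately have "\<forall>\<^sub>F k in sequentially. y \<le> A k j x"
          proof eventually_elim
            case (elim k)
            note ej = \<open>r j < min \<gamma> d \<and> _\<close>
            have 1: "(LBINT y. indicator ?B y * norm (w k y - (U x + V x *v (y - x)))) / (r j * measure lborel ?B) \<le> \<gamma>"
            proof -
              have "(LBINT y. indicator ?B y * norm (w k y - (U x + V x *v (y - x))))
                \<le> (LBINT y. indicator ?B y * norm (w k y - U y) + indicator ?B y * norm (U y - (U x + V x *v (y - x))))"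
              proof (rule integral_mono)
                fix y
                show "indicator ?B y * norm (w k y - (U x + V x *v (y - x)))
                  \<le> indicator ?B y * norm (w k y - U y) + indicator ?B y * norm (U y - (U x + V x *v (y - x)))"
                  using norm_triangle_sub[of "w k y - (U x + V x *v (y - x))" "U y - (U x + V x *v (y - x))"]
                  by (simp add: indicator_def)
              qed (intro Bochner_Integration.integrable_add norm_diff iwB iUB iaB)+
              also have "\<dots> = (LBINT y. indicator ?B y * norm (w k y - U y))
                  + (LBINT y. indicator ?B y * norm (U y - (U x + V x *v (y - x))))"
                by (intro Bochner_Integration.integral_add norm_diff iwB iUB iaB)
              also have "\<dots> \<le> \<gamma> / 2 * (r j * b j) + \<gamma> / 2 * (r j * b j)"
              proof (rule add_mono)
                show "(LBINT y. indicator ?B y * norm (U y - (U x + V x *v (y - x)))) \<le> \<gamma> / 2 * (r j * b j)"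
                  using ej r(1)[of j] b[of j] by (simp add: pos_divide_less_eq less_imp_le)
              qed (use elim in simp)
              finally show ?thesis using r(1)[of j] b[of j] by (simp add: bx pos_divide_le_eq mult.commute[of "r j"])
            qed
            have 2: "norm ((1 / measure lborel ?B) *\<^sub>R (LBINT y. indicator ?B y *\<^sub>R vk k y) - v x) \<le> \<gamma>"
            proof -
              let ?a = "\<integral>y. indicator ?B y *\<^sub>R vk k y \<partial>lborel" and ?c = "\<integral>y. indicator ?B y *\<^sub>R v y \<partial>lborel"
              have ivB: "integrable lborel (\<lambda>y. indicator ?B y *\<^sub>R v y)"
                by (rule integrable_bounded_scaleR[OF vi, where B=1]) (auto simp: indicator_def)
              have icB: "integrable lborel (\<lambda>y. indicator ?B y *\<^sub>R v x)" using iB by simp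
              have "norm (?c - b j *\<^sub>R v x) = norm (LBINT y. indicator ?B y *\<^sub>R v y - indicator ?B y *\<^sub>R v x)"
                using ivB icB iB by (simp add: bx)
              also have "\<dots> \<le> (LBINT y. norm (indicator ?B y *\<^sub>R v y - indicator ?B y *\<^sub>R v x))" by (rule integral_norm_bound)
              also have "\<dots> = (LBINT y. indicator ?B y * norm (v y - v x))" by (simp flip: scaleR_diff_right)
              also have "\<dots> \<le> \<gamma> / 2 * b j" using ej b[of j] by (simp add: pos_divide_less_eq less_imp_le)
              finally have "norm (?c - b j *\<^sub>R v x) \<le> \<gamma> / 2 * b j" .
              moreover have "norm (?a - ?c) \<le> \<gamma> / 2 * b j" using elim by (simp add: dist_norm)
              ultimately have "norm (?a - b j *\<^sub>R v x) \<le> \<gamma> * b j"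
                using norm_triangle_ineq[of "?a - ?c" "?c - b j *\<^sub>R v x"] by simp
              moreover have "(1 / b j) *\<^sub>R ?a - v x = (1 / b j) *\<^sub>R (?a - b j *\<^sub>R v x)"
                using b[of j] by (simp add: scaleR_diff_right)
              ultimately show ?thesis using b[of j] by (simp add: bx pos_divide_le_eq)
            qed
            have vkB: "integrable lborel (\<lambda>y. indicator ?B y * norm (vk k y) powr p)"
              by (rule integrable_indicator_subset[OF vki _ BK]) simp
            have "ennreal (c * b j) \<le> (\<integral>\<^sup>+y. ennreal (indicator ?B y * f y (w k y) (vk k y) (Dw k y)) \<partial>lborel)"
              using low[OF r(1) _ w vk vkB 1 2] ej by (simp add: bx)
            also have "\<dots> = (\<integral>\<^sup>+y. indicator ?B y * g k y \<partial>lborel)"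
              using BK by (intro nn_integral_cong) (auto simp: g_def indicator_def)
            also have "\<dots> = (\<integral>\<^sup>+z. indicator (ball 0 (r j)) z * g k (x + z) \<partial>lborel)"
              by (rule nn_integral_ball_shift[symmetric]) measurable
            finally have "ennreal (1 / b j) * ennreal (c * b j) \<le> A k j x"
              unfolding A_def by (rule mult_left_mono) simp
            moreover have "ennreal (1 / b j) * ennreal (c * b j) = y"
              using b[of j] c by (simp flip: ennreal_mult)
            ultimately show "y \<le> A k j x" by simp
          qed
          then show "y \<le> liminf (\<lambda>k. A k j x)" by (rule Liminf_bounded)
        qed
        then show ?thesis by (rule Liminf_bounded)
      qed
      then have "ennreal (f x (U x) (v x) (V x)) \<le> liminf (\<lambda>j. liminf (\<lambda>k. A k j x))" by (rule dense_le)
      then show ?thesis using x by simp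
    qed simp
  qed
  then have "(\<integral>\<^sup>+x. ennreal (indicator K x * f x (U x) (v x) (V x)) \<partial>lborel)
    \<le> (\<integral>\<^sup>+x. liminf (\<lambda>j. liminf (\<lambda>k. A k j x)) \<partial>lborel)" by (rule nn_integral_mono_AE)
  also note upper
  finally show ?thesis by (simp add: Lim_def g_def)
qed

text \<open>Mollified maps with L1 errors \<open>(1 / 2) ^ m\<close> converge almost everywhere
  together with their gradients, so continuity of \<open>f\<close> gives convergence of the
  integrands. The growth bound has no term in \<open>u\<close>, so the majorant involves the
  gradients and the fixed field \<open>v\<close> only.\<close>

lemma C1_energy_approximation:
  assumes UV: "borel_weak_gradient \<Omega> U V" and K: "compact K" "K \<subseteq> \<Omega>"
    and v [measurable]: "v \<in> borel_measurable borel" and vi: "integrable lborel (\<lambda>x. indicator K x * norm (v x) powr p)"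
    and e: "e > 0"
  shows "\<exists>w Dw. C1_map w Dw \<and> (\<integral>\<^sup>+x. indicator K x * ennreal (norm (w x - U x)) \<partial>lborel) \<le> ennreal e
    \<and> (\<integral>\<^sup>+x. ennreal (indicator K x * f x (w x) (v x) (Dw x)) \<partial>lborel)
       \<le> (\<integral>\<^sup>+x. ennreal (indicator K x * f x (U x) (v x) (V x)) \<partial>lborel) + ennreal e"
proof -
  have UVm [measurable]: "U \<in> borel_measurable borel" "V \<in> borel_measurable borel" "K \<in> sets borel"
    and Vi: "integrable lborel V"
    using UV K by (auto simp: borel_weak_gradient_def borel_compact)
  have "\<forall>m. \<exists>wD. C1_map (fst wD) (snd wD)
    \<and> (\<integral>\<^sup>+x. indicator K x * ennreal (norm (fst wD x - U x)) \<partial>lborel) \<le> ennreal ((1 / 2) ^ m)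
    \<and> (\<integral>\<^sup>+x. indicator K x * ennreal (norm (snd wD x - V x)) \<partial>lborel) \<le> ennreal ((1 / 2) ^ m)"
    using smooth_approximation[OF UV \<Omega> K] by simp
  from choice[OF this] obtain wD where wD: "\<forall>m. C1_map (fst (wD m)) (snd (wD m))
    \<and> (\<integral>\<^sup>+x. indicator K x * ennreal (norm (fst (wD m) x - U x)) \<partial>lborel) \<le> ennreal ((1 / 2) ^ m)
    \<and> (\<integral>\<^sup>+x. indicator K x * ennreal (norm (snd (wD m) x - V x)) \<partial>lborel) \<le> ennreal ((1 / 2) ^ m)" ..
  define w Dw where "w m = fst (wD m)" and "Dw m = snd (wD m)" for m
  have w: "C1_map (w m) (Dw m)"
    and wU: "(\<integral>\<^sup>+x. indicator K x * ennreal (norm (w m x - U x)) \<partial>lborel) \<le> ennreal ((1 / 2) ^ m)"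
    and wV: "(\<integral>\<^sup>+x. indicator K x * ennreal (norm (Dw m x - V x)) \<partial>lborel) \<le> ennreal ((1 / 2) ^ m)" for m
    using wD by (auto simp: w_def Dw_def)
  note wm [measurable] = borel_measurable_C1_map[OF w]
  have limU: "AE x in lborel. (\<lambda>m. indicator K x * ennreal (norm (w m x - U x))) \<longlonglongrightarrow> 0"
    by (rule AE_suminf_finite(2)[OF _ wU]) measurable
  have limV: "AE x in lborel. (\<lambda>m. indicator K x * ennreal (norm (Dw m x - V x))) \<longlonglongrightarrow> 0"
    by (rule AE_suminf_finite(2)[OF _ wV]) measurable
  \<comment> \<open>The sum of all gradient errors is integrable and dominates each of them, which
    gives one majorant for the whole sequence.\<close>
  define S where "S x = (\<Sum>m. indicator K x * ennreal (norm (Dw m x - V x)))" for x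
  have S: "(\<integral>\<^sup>+x. S x \<partial>lborel) < \<infinity>"
    unfolding S_def by (rule AE_suminf_finite(1)[OF _ wV]) measurable
  have [measurable]: "S \<in> borel_measurable lborel" unfolding S_def[abs_def] by measurable
  define W where "W x = ennreal C * (ennreal (indicator K x + indicator K x * norm (v x) powr p + indicator K x * norm (V x)) + S x)" for x
  have Wm [measurable]: "W \<in> borel_measurable lborel" unfolding W_def[abs_def] by measurable
  have W: "(\<integral>\<^sup>+x. W x \<partial>lborel) < \<infinity>"
  proof -
    have iK: "integrable lborel (indicator K :: real^'N \<Rightarrow> real)" using emeasure_compact_finite[OF K(1)] by simp
    have iV: "integrable lborel (\<lambda>x. indicator K x *\<^sub>R norm (V x))"
      by (rule integrable_bounded_scaleR[OF integrable_norm[OF Vi], where B=1]) (auto simp: indicator_def)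
    have i: "integrable lborel (\<lambda>x. indicator K x + indicator K x * norm (v x) powr p + indicator K x * norm (V x))"
      using iK vi iV by simp
    have "(\<integral>\<^sup>+x. ennreal (indicator K x + indicator K x * norm (v x) powr p + indicator K x * norm (V x)) \<partial>lborel) < \<infinity>"
      by (subst nn_integral_eq_integral[OF i]) auto
    then show ?thesis
      unfolding W_def using S by (subst nn_integral_cmult, measurable, subst nn_integral_add, measurable)
        (auto simp: ennreal_mult_less_top)
  qed
  have bound: "ennreal (indicator K x * f x (w m x) (v x) (Dw m x)) \<le> W x" for m x
  proof (cases "x \<in> K")
    case True
    then have "x \<in> \<Omega>" using K by auto
    have "f x (w m x) (v x) (Dw m x) \<le> C * (1 + norm (v x) powr p + norm (Dw m x))" by (rule growth) fact
    also have "\<dots> \<le> C * ((1 + norm (v x) powr p + norm (V x)) + norm (Dw m x - V x))"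
      using C norm_triangle_ineq[of "V x" "Dw m x - V x"] by (intro mult_left_mono) auto
    finally have "ennreal (f x (w m x) (v x) (Dw m x)) \<le> ennreal (C * ((1 + norm (v x) powr p + norm (V x)) + norm (Dw m x - V x)))"
      by (rule ennreal_leI)
    also have "\<dots> = ennreal C * (ennreal (1 + norm (v x) powr p + norm (V x)) + ennreal (norm (Dw m x - V x)))"
      using C by (simp add: ennreal_mult add_nonneg_nonneg)
    also have "\<dots> \<le> ennreal C * (ennreal (1 + norm (v x) powr p + norm (V x)) + S x)"
    proof (intro mult_left_mono add_left_mono)
      show "ennreal (norm (Dw m x - V x)) \<le> S x"
      proof -
        have "(\<Sum>m\<in>{m}. indicator K x * ennreal (norm (Dw m x - V x))) \<le> S x"
          unfolding S_def by (rule sum_le_suminf) auto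
        then show ?thesis using True by simp
      qed
    qed simp
    finally show ?thesis using True by (simp add: W_def)
  qed simp
  have lim: "(\<lambda>m. \<integral>\<^sup>+x. ennreal (indicator K x * f x (w m x) (v x) (Dw m x)) \<partial>lborel)
    \<longlonglongrightarrow> (\<integral>\<^sup>+x. ennreal (indicator K x * f x (U x) (v x) (V x)) \<partial>lborel)"
  proof (rule nn_integral_dominated_convergence[OF _ _ Wm _ W])
    show "(\<lambda>x. ennreal (indicator K x * f x (w m x) (v x) (Dw m x))) \<in> borel_measurable lborel" for m
      using f_borel[OF UVm(3) K(2) wm(1) v wm(2)] by simp
    show "(\<lambda>x. ennreal (indicator K x * f x (U x) (v x) (V x))) \<in> borel_measurable lborel"
      using f_borel[OF UVm(3) K(2) UVm(1) v UVm(2)] by simp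
    show "AE x in lborel. ennreal (indicator K x * f x (w m x) (v x) (Dw m x)) \<le> W x" for m
      by (intro AE_I2 bound)
    show "AE x in lborel. (\<lambda>m. ennreal (indicator K x * f x (w m x) (v x) (Dw m x))) \<longlonglongrightarrow> ennreal (indicator K x * f x (U x) (v x) (V x))"
      using limU limV
    proof eventually_elim
      case (elim x)
      show ?case
      proof (cases "x \<in> K")
        case True
        then have x: "x \<in> \<Omega>" using K by auto
        have "(\<lambda>m. ennreal (norm (w m x - U x))) \<longlonglongrightarrow> ennreal 0" using elim(1) True by simp
        from tendsto_enn2real[OF this] have 1: "(\<lambda>m. w m x) \<longlonglongrightarrow> U x" by (simp add: tendsto_norm_zero_iff LIM_zero_iff)
        have "(\<lambda>m. ennreal (norm (Dw m x - V x))) \<longlonglongrightarrow> ennreal 0" using elim(2) True by simp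
        from tendsto_enn2real[OF this] have 2: "(\<lambda>m. Dw m x) \<longlonglongrightarrow> V x" by (simp add: tendsto_norm_zero_iff LIM_zero_iff)
        have "(\<lambda>m. (\<lambda>(x, u, v, \<xi>). f x u v \<xi>) (x, w m x, v x, Dw m x)) \<longlonglongrightarrow> (\<lambda>(x, u, v, \<xi>). f x u v \<xi>) (x, U x, v x, V x)"
          by (rule continuous_on_tendsto_compose[OF f_cont]) (use x in \<open>auto intro!: tendsto_Pair 1 2\<close>)
        then show ?thesis using True by (simp add: tendsto_ennrealI)
      qed simp
    qed
  qed
  let ?E = "\<integral>\<^sup>+x. ennreal (indicator K x * f x (U x) (v x) (V x)) \<partial>lborel"
  \<comment> \<open>In \<open>ennreal\<close>, the strict inequality between \<open>?E\<close> and
    \<open>?E + ennreal e\<close> requires \<open>?E\<close> to be finite.\<close>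
  have fin: "?E < top"
  proof -
    have "\<forall>\<^sub>F m in sequentially. (\<integral>\<^sup>+x. ennreal (indicator K x * f x (w m x) (v x) (Dw m x)) \<partial>lborel) \<le> (\<integral>\<^sup>+x. W x \<partial>lborel)"
      by (intro always_eventually allI nn_integral_mono bound)
    then have "?E \<le> (\<integral>\<^sup>+x. W x \<partial>lborel)" by (rule tendsto_upperbound[OF lim]) simp
    then show ?thesis using W by auto
  qed
  have "?E < ?E + ennreal e" using fin e by (cases ?E) (auto simp: ennreal_less_iff simp flip: ennreal_plus)
  then have "\<forall>\<^sub>F m in sequentially. (\<integral>\<^sup>+x. ennreal (indicator K x * f x (w m x) (v x) (Dw m x)) \<partial>lborel) < ?E + ennreal e"
    by (rule order_tendstoD(2)[OF lim])
  moreover have "\<forall>\<^sub>F m in sequentially. (1 / 2 :: real) ^ m < e"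
    by (rule order_tendstoD(2)[OF LIMSEQ_power_zero]) (use e in auto)
  ultimately have "\<forall>\<^sub>F m in sequentially. (\<integral>\<^sup>+x. ennreal (indicator K x * f x (w m x) (v x) (Dw m x)) \<partial>lborel) < ?E + ennreal e \<and> (1 / 2 :: real) ^ m < e"
    by (rule eventually_conj)
  from eventually_happens'[OF sequentially_bot this]
  obtain m where m: "(\<integral>\<^sup>+x. ennreal (indicator K x * f x (w m x) (v x) (Dw m x)) \<partial>lborel) < ?E + ennreal e" "(1 / 2 :: real) ^ m < e"
    by (elim exE conjE)
  have "(\<integral>\<^sup>+x. indicator K x * ennreal (norm (w m x - U x)) \<partial>lborel) \<le> ennreal e"
    using wU[of m] m(2) by (meson ennreal_leI less_imp_le order_trans)
  then show ?thesis using w m(1) by (intro exI[of _ "w m"] exI[of _ "Dw m"] conjI) auto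
qed

end

subsection \<open>Passage to Borel representatives\<close>

text \<open>The space provides some integrable weak gradient, whereas the energy contains the chosen
  one; uniqueness identifies them almost everywhere.\<close>

lemma W11_representative:
  fixes u :: "real^'N::finite \<Rightarrow> real^'n::finite"
  assumes u: "u \<in> W11_space \<Omega>" and \<Omega>: "open \<Omega>"
  obtains U V where "borel_weak_gradient \<Omega> U V"
    "AE x in lborel. x \<in> \<Omega> \<longrightarrow> U x = u x" "AE x in lborel. x \<in> \<Omega> \<longrightarrow> V x = weak_gradient \<Omega> u x"
proof -
  have \<Omega>b: "\<Omega> \<in> sets borel" using \<Omega> by simp
  obtain G where G: "has_weak_gradient \<Omega> u G" "integrable (lebesgue_on \<Omega>) G" and ui: "integrable (lebesgue_on \<Omega>) u"
    using u by (auto simp: W11_space_def L1_space_def)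
  have wg: "has_weak_gradient \<Omega> u (weak_gradient \<Omega> u)"
    unfolding weak_gradient_def using G(1) by (rule someI[of "has_weak_gradient \<Omega> u"])
  obtain U V where UV: "U \<in> borel_measurable borel" "V \<in> borel_measurable borel" "integrable lborel U" "integrable lborel V"
    "AE x in lborel. x \<in> \<Omega> \<longrightarrow> U x = u x" "AE x in lborel. x \<in> \<Omega> \<longrightarrow> V x = G x"
    "\<forall>x. x \<notin> \<Omega> \<longrightarrow> U x = 0" "\<forall>x. x \<notin> \<Omega> \<longrightarrow> V x = 0"
    and ibp: "\<forall>\<phi> i j. \<phi> \<in> test_functions \<Omega> \<longrightarrow> (\<forall>x. x \<notin> \<Omega> \<longrightarrow> \<phi> x = 0 \<and> partial_deriv i \<phi> x = 0) \<longrightarrow>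
      (LBINT x. U x $ j * partial_deriv i \<phi> x) = - (LBINT x. V x $ j $ i * \<phi> x)"
    using has_weak_gradient_local_representative[OF G(1) \<Omega> \<Omega>b order_refl ui G(2)] .
  show thesis
  proof (rule that)
    show "borel_weak_gradient \<Omega> U V"
      unfolding borel_weak_gradient_def
    proof (intro conjI ballI allI UV)
      fix \<phi> i j assume \<phi>: "\<phi> \<in> test_functions \<Omega>"
      then show "(LBINT x. U x $ j * partial_deriv i \<phi> x) = - (LBINT x. V x $ j $ i * \<phi> x)"
        using ibp test_functionsD(4,5)[OF \<phi>] by blast
    qed
    show "AE x in lborel. x \<in> \<Omega> \<longrightarrow> V x = weak_gradient \<Omega> u x"
      using UV(6) weak_gradient_unique[OF G(1) wg \<Omega>] by eventually_elim simp
  qed (rule UV)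
qed

lemma Lp_representative:
  fixes v :: "'a::euclidean_space \<Rightarrow> 'b::euclidean_space"
  assumes v: "v \<in> Lp_space p \<Omega>" and \<Omega>: "\<Omega> \<in> sets borel"
  obtains v' where "v' \<in> borel_measurable borel" "AE x in lborel. x \<in> \<Omega> \<longrightarrow> v' x = v x"
    "\<forall>x. x \<notin> \<Omega> \<longrightarrow> v' x = 0" "integrable lborel (\<lambda>x. norm (v' x) powr p)"
proof -
  have vm: "v \<in> borel_measurable (lebesgue_on \<Omega>)" and vi: "integrable (lebesgue_on \<Omega>) (\<lambda>x. norm (v x) powr p)"
    using v by (auto simp: Lp_space_def)
  obtain v' where v': "v' \<in> borel_measurable borel" "AE x in lborel. x \<in> \<Omega> \<longrightarrow> v' x = v x" "\<forall>x. x \<notin> \<Omega> \<longrightarrow> v' x = 0"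
    using lebesgue_on_borel_representative[OF vm \<Omega>] .
  have "integrable lborel (\<lambda>x. indicator \<Omega> x *\<^sub>R norm (v' x) powr p)"
  proof (rule lebesgue_on_integral_representative(1)[OF _ _ \<Omega>, THEN iffD1, OF _ _ vi])
    show "(\<lambda>x. norm (v' x) powr p) \<in> borel_measurable borel" using v'(1) by measurable
    show "AE x in lborel. x \<in> \<Omega> \<longrightarrow> norm (v' x) powr p = norm (v x) powr p" using v'(2) by eventually_elim simp
  qed
  moreover have "(\<lambda>x. indicator \<Omega> x *\<^sub>R norm (v' x) powr p) = (\<lambda>x. norm (v' x) powr p)"
    using v'(3) by (auto simp: fun_eq_iff indicator_def)
  ultimately show thesis using that v' by simp
qed

text \<open>\<open>norm (v x)\<close> is at most the indicator of the bounded set plus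
  \<open>norm (v x) powr p\<close>.\<close>

lemma integrable_of_powr_integrable:
  fixes v :: "'a::euclidean_space \<Rightarrow> 'b::euclidean_space"
  assumes v: "v \<in> borel_measurable borel" "integrable lborel (\<lambda>x. norm (v x) powr p)" and p: "1 \<le> p"
    and \<Omega>: "\<Omega> \<in> sets borel" "bounded \<Omega>" "\<forall>x. x \<notin> \<Omega> \<longrightarrow> v x = 0"
  shows "integrable lborel v"
proof (rule Bochner_Integration.integrable_bound)
  show "integrable lborel (\<lambda>x. indicator \<Omega> x + norm (v x) powr p)"
    using \<Omega>(1) emeasure_bounded_finite[OF \<Omega>(2)] v(2) by (intro Bochner_Integration.integrable_add) auto
  show "AE x in lborel. norm (v x) \<le> norm (indicator \<Omega> x + norm (v x) powr p)"
  proof (rule AE_I2)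
    fix x
    show "norm (v x) \<le> norm (indicator \<Omega> x + norm (v x) powr p)"
    proof (cases "x \<in> \<Omega> \<and> norm (v x) > 1")
      case True
      then have "norm (v x) powr 1 \<le> norm (v x) powr p" using p by (intro powr_mono) auto
      then show ?thesis using True by simp
    next
      case False
      then show ?thesis using \<Omega>(3) by (cases "x \<in> \<Omega>") (auto simp: add_increasing2)
    qed
  qed
qed (use v(1) in simp)

text \<open>The indicator of a ball times a unit vector belongs to the dual space, so weak
  convergence applies to each component of the integrals over the ball.\<close>

lemma Lp_weak_convergence_on_balls:
  fixes vk :: "nat \<Rightarrow> 'a::euclidean_space \<Rightarrow> real^'m::finite"
  assumes weak: "Lp_weakly_converges p \<Omega> vk v" and p: "1 < p" and \<Omega>: "\<Omega> \<in> sets borel" and B: "ball x r \<subseteq> \<Omega>"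
    and a: "\<And>k. a k \<in> borel_measurable borel" "\<And>k. integrable lborel (a k)"
      "\<And>k. AE x in lborel. x \<in> \<Omega> \<longrightarrow> a k x = vk k x"
    and b: "b \<in> borel_measurable borel" "integrable lborel b" "AE x in lborel. x \<in> \<Omega> \<longrightarrow> b x = v x"
  shows "(\<lambda>k. \<integral>y. indicator (ball x r) y *\<^sub>R a k y \<partial>lborel) \<longlonglongrightarrow> (LBINT y. indicator (ball x r) y *\<^sub>R b y)"
proof (rule vec_tendstoI)
  fix i :: 'm
  define g :: "'a \<Rightarrow> real^'m" where "g y = indicator (ball x r) y *\<^sub>R axis i 1" for y
  have gm [measurable]: "g \<in> borel_measurable borel" unfolding g_def[abs_def] by measurable
  have q: "p / (p - 1) > 0" using p by simp
  have gp: "norm (g y) powr (p / (p - 1)) = indicator (ball x r) y" for y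
    using q by (simp add: g_def indicator_def)
  have "g \<in> Lp_space (p / (p - 1)) \<Omega>"
    unfolding Lp_space_def
  proof (intro CollectI conjI)
    show "g \<in> borel_measurable (lebesgue_on \<Omega>)"
      by (rule lebesgue_on_representative_measurable(1)[OF gm _ \<Omega>]) simp
    have "integrable lborel (indicator (ball x r) :: 'a \<Rightarrow> real)"
      using emeasure_lborel_ball_finite[of x r] by simp
    then have "integrable lborel (\<lambda>y. indicator \<Omega> y *\<^sub>R (indicator (ball x r) y :: real))"
      by (rule integrable_bounded_scaleR[where B=1]) (use \<Omega> in \<open>auto simp: indicator_def\<close>)
    then show "integrable (lebesgue_on \<Omega>) (\<lambda>y. norm (g y) powr (p / (p - 1)))"
      unfolding gp by (subst lebesgue_on_integral_representative(1)[OF _ _ \<Omega>, of "indicator (ball x r)"]) auto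
  qed
  then have lim: "(\<lambda>k. LINT y|lebesgue_on \<Omega>. vk k y \<bullet> g y) \<longlonglongrightarrow> (LINT y|lebesgue_on \<Omega>. v y \<bullet> g y)"
    using weak by (simp add: Lp_weakly_converges_def)
  have eq: "(LINT y|lebesgue_on \<Omega>. w y \<bullet> g y) = (LBINT y. indicator (ball x r) y *\<^sub>R c y) $ i"
    if c: "c \<in> borel_measurable borel" "integrable lborel c" "AE y in lborel. y \<in> \<Omega> \<longrightarrow> c y = w y" for c w
  proof -
    have "(LINT y|lebesgue_on \<Omega>. w y \<bullet> g y) = (LBINT y. indicator \<Omega> y *\<^sub>R (c y \<bullet> g y))"
    proof (rule lebesgue_on_integral_representative(2)[OF _ _ \<Omega>])
      show "(\<lambda>y. c y \<bullet> g y) \<in> borel_measurable borel" using c(1) by measurable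
      show "AE y in lborel. y \<in> \<Omega> \<longrightarrow> c y \<bullet> g y = w y \<bullet> g y" using c(3) by eventually_elim simp
    qed
    also have "\<dots> = (LBINT y. (indicator (ball x r) y *\<^sub>R c y) $ i)"
      using B by (intro Bochner_Integration.integral_cong) (auto simp: g_def indicator_def inner_axis)
    also have "\<dots> = (LBINT y. indicator (ball x r) y *\<^sub>R c y) $ i"
    proof (rule integral_bounded_linear[OF bounded_linear_vec_nth])
      show "integrable lborel (\<lambda>y. indicator (ball x r) y *\<^sub>R c y)"
        by (rule integrable_bounded_scaleR[OF c(2), where B=1]) (auto simp: indicator_def)
    qed
    finally show ?thesis .
  qed
  show "(\<lambda>k. (LBINT y. indicator (ball x r) y *\<^sub>R a k y) $ i) \<longlonglongrightarrow> (LBINT y. indicator (ball x r) y *\<^sub>R b y) $ i"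
    using lim unfolding eq[OF a] eq[OF b] .
qed

context coercive_integrand
begin

lemma energy_representative:
  assumes m: "a \<in> borel_measurable borel" "b \<in> borel_measurable borel" "c \<in> borel_measurable borel"
    and ae: "AE x in lborel. x \<in> \<Omega> \<longrightarrow> a x = u x" "AE x in lborel. x \<in> \<Omega> \<longrightarrow> b x = v x"
      "AE x in lborel. x \<in> \<Omega> \<longrightarrow> c x = weak_gradient \<Omega> u x"
  shows "energy f \<Omega> u v = (\<integral>\<^sup>+x. ennreal (indicator \<Omega> x * f x (a x) (b x) (c x)) \<partial>lborel)"
proof -
  have \<Omega>b: "\<Omega> \<in> sets borel" using \<Omega> by simp
  have "energy f \<Omega> u v = (\<integral>\<^sup>+x. ennreal (f x (u x) (v x) (weak_gradient \<Omega> u x)) * indicator \<Omega> x \<partial>lebesgue)"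
    unfolding energy_def using \<Omega>b by (subst nn_integral_restrict_space) auto
  also have "\<dots> = (\<integral>\<^sup>+x. ennreal (indicator \<Omega> x * f x (a x) (b x) (c x)) \<partial>lebesgue)"
  proof (rule nn_integral_cong_AE)
    show "AE x in lebesgue. ennreal (f x (u x) (v x) (weak_gradient \<Omega> u x)) * indicator \<Omega> x
      = ennreal (indicator \<Omega> x * f x (a x) (b x) (c x))"
      using ae[THEN AE_completion] by eventually_elim (auto simp: indicator_def)
  qed
  also have "\<dots> = (\<integral>\<^sup>+x. ennreal (indicator \<Omega> x * f x (a x) (b x) (c x)) \<partial>lborel)"
    by (rule nn_integral_completion)
  finally show ?thesis .
qed

text \<open>On each compact part of \<Omega> the maps \<open>uk k\<close> are exchanged for C1 maps
  whose errors in L1 and in energy vanish as \<open>k\<close> grows, so the liminf is not raised.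
  The bound is the same for all compact parts, and exhausting \<Omega> gives the claim.\<close>

lemma energy_lsc:
  assumes bdd: "bounded \<Omega>" and u: "u \<in> W11_space \<Omega>" and v: "v \<in> Lp_space p \<Omega>"
    and uk: "\<And>k. uk k \<in> W11_space \<Omega>" and vk: "\<And>k. vk k \<in> Lp_space p \<Omega>"
    and conv_u: "L1_converges \<Omega> uk u" and conv_v: "Lp_weakly_converges p \<Omega> vk v"
  shows "energy f \<Omega> u v \<le> liminf (\<lambda>k. energy f \<Omega> (uk k) (vk k))"
proof -
  have \<Omega>b [measurable]: "\<Omega> \<in> sets borel" using \<Omega> by simp
  obtain U V where UV: "borel_weak_gradient \<Omega> U V"
    "AE x in lborel. x \<in> \<Omega> \<longrightarrow> U x = u x" "AE x in lborel. x \<in> \<Omega> \<longrightarrow> V x = weak_gradient \<Omega> u x"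
    using W11_representative[OF u \<Omega>] .
  have "\<forall>k. \<exists>W. borel_weak_gradient \<Omega> (fst W) (snd W) \<and> (AE x in lborel. x \<in> \<Omega> \<longrightarrow> fst W x = uk k x)
    \<and> (AE x in lborel. x \<in> \<Omega> \<longrightarrow> snd W x = weak_gradient \<Omega> (uk k) x)"
  proof
    fix k
    obtain A B where "borel_weak_gradient \<Omega> A B"
      "AE x in lborel. x \<in> \<Omega> \<longrightarrow> A x = uk k x" "AE x in lborel. x \<in> \<Omega> \<longrightarrow> B x = weak_gradient \<Omega> (uk k) x"
      using W11_representative[OF uk \<Omega>] .
    then show "\<exists>W. borel_weak_gradient \<Omega> (fst W) (snd W) \<and> (AE x in lborel. x \<in> \<Omega> \<longrightarrow> fst W x = uk k x)
      \<and> (AE x in lborel. x \<in> \<Omega> \<longrightarrow> snd W x = weak_gradient \<Omega> (uk k) x)"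
      by (intro exI[of _ "(A, B)"]) simp
  qed
  from choice[OF this] obtain W where W: "\<forall>k. borel_weak_gradient \<Omega> (fst (W k)) (snd (W k))
    \<and> (AE x in lborel. x \<in> \<Omega> \<longrightarrow> fst (W k) x = uk k x)
    \<and> (AE x in lborel. x \<in> \<Omega> \<longrightarrow> snd (W k) x = weak_gradient \<Omega> (uk k) x)" ..
  define Uk Vk where "Uk k = fst (W k)" and "Vk k = snd (W k)" for k
  have UVk: "borel_weak_gradient \<Omega> (Uk k) (Vk k)"
    "AE x in lborel. x \<in> \<Omega> \<longrightarrow> Uk k x = uk k x" "AE x in lborel. x \<in> \<Omega> \<longrightarrow> Vk k x = weak_gradient \<Omega> (uk k) x" for k
    using W by (auto simp: Uk_def Vk_def)
  have m [measurable]: "U \<in> borel_measurable borel" "V \<in> borel_measurable borel"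
    "\<And>k. Uk k \<in> borel_measurable borel" "\<And>k. Vk k \<in> borel_measurable borel"
    and int: "integrable lborel U" "\<And>k. integrable lborel (Uk k)"
    using UV(1) UVk(1) by (auto simp: borel_weak_gradient_def)
  obtain b where b: "b \<in> borel_measurable borel" "AE x in lborel. x \<in> \<Omega> \<longrightarrow> b x = v x"
    "\<forall>x. x \<notin> \<Omega> \<longrightarrow> b x = 0" "integrable lborel (\<lambda>x. norm (b x) powr p)"
    using Lp_representative[OF v \<Omega>b] .
  have "\<forall>k. \<exists>a. a \<in> borel_measurable borel \<and> (AE x in lborel. x \<in> \<Omega> \<longrightarrow> a x = vk k x)
    \<and> (\<forall>x. x \<notin> \<Omega> \<longrightarrow> a x = 0) \<and> integrable lborel (\<lambda>x. norm (a x) powr p)"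
  proof
    fix k
    obtain a where "a \<in> borel_measurable borel" "AE x in lborel. x \<in> \<Omega> \<longrightarrow> a x = vk k x"
      "\<forall>x. x \<notin> \<Omega> \<longrightarrow> a x = 0" "integrable lborel (\<lambda>x. norm (a x) powr p)"
      using Lp_representative[OF vk \<Omega>b] .
    then show "\<exists>a. a \<in> borel_measurable borel \<and> (AE x in lborel. x \<in> \<Omega> \<longrightarrow> a x = vk k x)
      \<and> (\<forall>x. x \<notin> \<Omega> \<longrightarrow> a x = 0) \<and> integrable lborel (\<lambda>x. norm (a x) powr p)"
      by (intro exI[of _ a] conjI)
  qed
  from choice[OF this] obtain a where "\<forall>k. a k \<in> borel_measurable borel \<and> (AE x in lborel. x \<in> \<Omega> \<longrightarrow> a k x = vk k x)
    \<and> (\<forall>x. x \<notin> \<Omega> \<longrightarrow> a k x = 0) \<and> integrable lborel (\<lambda>x. norm (a k x) powr p)" ..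
  then have a: "\<And>k. a k \<in> borel_measurable borel" "\<And>k. AE x in lborel. x \<in> \<Omega> \<longrightarrow> a k x = vk k x"
    "\<And>k. \<forall>x. x \<notin> \<Omega> \<longrightarrow> a k x = 0" "\<And>k. integrable lborel (\<lambda>x. norm (a k x) powr p)" by auto
  have bi: "integrable lborel b" using p by (intro integrable_of_powr_integrable[OF b(1,4) _ \<Omega>b bdd b(3)]) simp
  have ai: "integrable lborel (a k)" for k using p by (intro integrable_of_powr_integrable[OF a(1,4) _ \<Omega>b bdd a(3)]) simp
  note [measurable] = b(1) a(1)
  have E: "energy f \<Omega> u v = (\<integral>\<^sup>+x. ennreal (indicator \<Omega> x * f x (U x) (b x) (V x)) \<partial>lborel)"
    by (rule energy_representative[OF m(1) b(1) m(2) UV(2) b(2) UV(3)])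
  have Ek: "energy f \<Omega> (uk k) (vk k) = (\<integral>\<^sup>+x. ennreal (indicator \<Omega> x * f x (Uk k x) (a k x) (Vk k x)) \<partial>lborel)" for k
    by (rule energy_representative[OF m(3) a(1) m(4) UVk(2) a(2) UVk(3)])
  define D where "D k = (LINT x|lebesgue_on \<Omega>. norm (uk k x - u x))" for k
  have D: "D \<longlonglongrightarrow> 0" using conv_u by (simp add: L1_converges_def D_def[abs_def])
  have D_eq: "(\<integral>\<^sup>+x. ennreal (indicator \<Omega> x * norm (Uk k x - U x)) \<partial>lborel) = ennreal (D k)" for k
  proof -
    have "D k = (LBINT x. indicator \<Omega> x *\<^sub>R norm (Uk k x - U x))"
      unfolding D_def
    proof (rule lebesgue_on_integral_representative(2)[OF _ _ \<Omega>b])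
      show "AE x in lborel. x \<in> \<Omega> \<longrightarrow> norm (Uk k x - U x) = norm (uk k x - u x)"
        using UV(2) UVk(2)[of k] by eventually_elim simp
    qed measurable
    moreover have "integrable lborel (\<lambda>x. indicator \<Omega> x *\<^sub>R norm (Uk k x - U x))"
      by (rule integrable_bounded_scaleR[where B=1]) (use int in \<open>auto simp: indicator_def\<close>)
    ultimately show ?thesis by (subst nn_integral_eq_integral) auto
  qed
  let ?L = "liminf (\<lambda>k. energy f \<Omega> (uk k) (vk k))"
  have local: "(\<integral>\<^sup>+x. ennreal (indicator K x * f x (U x) (b x) (V x)) \<partial>lborel) \<le> ?L" if K: "compact K" "K \<subseteq> \<Omega>" for K
  proof -
    obtain d where d: "d > 0" "compact (\<Union>x\<in>K. cball x d)" "(\<Union>x\<in>K. cball x d) \<subseteq> \<Omega>"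
      using compact_cball_nbhd[OF K(1) \<Omega> K(2)] .
    define K' where "K' = (\<Union>x\<in>K. cball x d)"
    have K': "compact K'" "K' \<subseteq> \<Omega>" "\<And>x. x \<in> K \<Longrightarrow> cball x d \<subseteq> K'" using d by (auto simp: K'_def)
    have [measurable]: "K' \<in> sets borel" using K' by (simp add: borel_compact)
    have aK: "integrable lborel (\<lambda>x. indicator K' x * norm (a k x) powr p)" for k
      using integrable_bounded_scaleR[OF a(4)[of k], of "indicator K'" 1] by (simp add: indicator_def)
    \<comment> \<open>One approximation for each \<open>k\<close> with tolerance
      \<open>1 / (k + 1)\<close>; the fields \<open>a k\<close> are kept, so their weak convergence
      is unaffected.\<close>
    have "\<forall>k. \<exists>wD. C1_map (fst wD) (snd wD)
      \<and> (\<integral>\<^sup>+x. indicator K' x * ennreal (norm (fst wD x - Uk k x)) \<partial>lborel) \<le> ennreal (1 / real (Suc k))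
      \<and> (\<integral>\<^sup>+x. ennreal (indicator K' x * f x (fst wD x) (a k x) (snd wD x)) \<partial>lborel)
        \<le> (\<integral>\<^sup>+x. ennreal (indicator K' x * f x (Uk k x) (a k x) (Vk k x)) \<partial>lborel) + ennreal (1 / real (Suc k))"
      using C1_energy_approximation[OF UVk(1) K'(1,2) a(1) aK] by simp
    from choice[OF this] obtain wD where wD: "\<forall>k. C1_map (fst (wD k)) (snd (wD k))
      \<and> (\<integral>\<^sup>+x. indicator K' x * ennreal (norm (fst (wD k) x - Uk k x)) \<partial>lborel) \<le> ennreal (1 / real (Suc k))
      \<and> (\<integral>\<^sup>+x. ennreal (indicator K' x * f x (fst (wD k) x) (a k x) (snd (wD k) x)) \<partial>lborel)
        \<le> (\<integral>\<^sup>+x. ennreal (indicator K' x * f x (Uk k x) (a k x) (Vk k x)) \<partial>lborel) + ennreal (1 / real (Suc k))" ..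
    define w Dw where "w k = fst (wD k)" and "Dw k = snd (wD k)" for k
    have w: "C1_map (w k) (Dw k)"
      and wU: "(\<integral>\<^sup>+x. indicator K' x * ennreal (norm (w k x - Uk k x)) \<partial>lborel) \<le> ennreal (1 / real (Suc k))"
      and wE: "(\<integral>\<^sup>+x. ennreal (indicator K' x * f x (w k x) (a k x) (Dw k x)) \<partial>lborel)
        \<le> (\<integral>\<^sup>+x. ennreal (indicator K' x * f x (Uk k x) (a k x) (Vk k x)) \<partial>lborel) + ennreal (1 / real (Suc k))" for k
      using wD by (auto simp: w_def Dw_def)
    note [measurable] = borel_measurable_C1_map[OF w]
    have null: "(\<lambda>k. 1 / real (Suc k)) \<longlonglongrightarrow> 0" by (rule LIMSEQ_Suc[OF lim_1_over_n])
    have lim: "(\<lambda>k. \<integral>\<^sup>+x. indicator K' x * ennreal (norm (w k x - U x)) \<partial>lborel) \<longlonglongrightarrow> 0"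
    proof (rule tendsto_sandwich[OF _ _ tendsto_const])
      have "(\<lambda>k. ennreal (1 / real (Suc k)) + ennreal (D k)) \<longlonglongrightarrow> ennreal 0 + ennreal 0"
        by (intro tendsto_add tendsto_ennrealI null D)
      then show "(\<lambda>k. ennreal (1 / real (Suc k)) + ennreal (D k)) \<longlonglongrightarrow> 0" by simp
      show "\<forall>\<^sub>F k in sequentially. (\<integral>\<^sup>+x. indicator K' x * ennreal (norm (w k x - U x)) \<partial>lborel)
        \<le> ennreal (1 / real (Suc k)) + ennreal (D k)"
      proof (intro always_eventually allI)
        fix k
        have "(\<integral>\<^sup>+x. indicator K' x * ennreal (norm (w k x - U x)) \<partial>lborel)
          \<le> (\<integral>\<^sup>+x. indicator K' x * ennreal (norm (w k x - Uk k x)) + ennreal (indicator \<Omega> x * norm (Uk k x - U x)) \<partial>lborel)"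
        proof (rule nn_integral_mono)
          fix x
          have "ennreal (norm (w k x - U x)) \<le> ennreal (norm (w k x - Uk k x)) + ennreal (norm (Uk k x - U x))"
            using norm_triangle_ineq[of "w k x - Uk k x" "Uk k x - U x"] by (simp add: ennreal_leI flip: ennreal_plus)
          then show "indicator K' x * ennreal (norm (w k x - U x))
            \<le> indicator K' x * ennreal (norm (w k x - Uk k x)) + ennreal (indicator \<Omega> x * norm (Uk k x - U x))"
            using K'(2) by (cases "x \<in> K'") auto
        qed
        also have "\<dots> = (\<integral>\<^sup>+x. indicator K' x * ennreal (norm (w k x - Uk k x)) \<partial>lborel)
          + (\<integral>\<^sup>+x. ennreal (indicator \<Omega> x * norm (Uk k x - U x)) \<partial>lborel)"
          by (rule nn_integral_add) measurable
        also have "\<dots> \<le> ennreal (1 / real (Suc k)) + ennreal (D k)" using wU D_eq by (intro add_mono) auto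
        finally show "(\<integral>\<^sup>+x. indicator K' x * ennreal (norm (w k x - U x)) \<partial>lborel)
          \<le> ennreal (1 / real (Suc k)) + ennreal (D k)" .
      qed
    qed simp
    have weak: "(\<lambda>k. \<integral>y. indicator (ball x r) y *\<^sub>R a k y \<partial>lborel) \<longlonglongrightarrow> (LBINT y. indicator (ball x r) y *\<^sub>R b y)"
      if "ball x r \<subseteq> K'" for x r
      using Lp_weak_convergence_on_balls[OF conv_v p \<Omega>b order_trans[OF that K'(2)] a(1) ai a(2) b(1) bi b(2)] .
    have "(\<integral>\<^sup>+x. ennreal (indicator K x * f x (U x) (b x) (V x)) \<partial>lborel)
      \<le> liminf (\<lambda>k. \<integral>\<^sup>+x. ennreal (indicator K' x * f x (w k x) (a k x) (Dw k x)) \<partial>lborel)"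
      by (rule lsc_C1[OF K d(1) K' UV(1) b(1) bi w a(1) aK lim weak])
    also have "\<dots> \<le> liminf (\<lambda>k. energy f \<Omega> (uk k) (vk k) + ennreal (1 / real (Suc k)))"
    proof (intro Liminf_mono always_eventually allI)
      fix k
      have "(\<integral>\<^sup>+x. ennreal (indicator K' x * f x (Uk k x) (a k x) (Vk k x)) \<partial>lborel) \<le> energy f \<Omega> (uk k) (vk k)"
        unfolding Ek using K'(2) by (intro nn_integral_mono) (auto simp: indicator_def)
      then show "(\<integral>\<^sup>+x. ennreal (indicator K' x * f x (w k x) (a k x) (Dw k x)) \<partial>lborel)
        \<le> energy f \<Omega> (uk k) (vk k) + ennreal (1 / real (Suc k))"
        using wE[of k] by (meson add_right_mono order_trans)
    qed
    also have "\<dots> \<le> ?L"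
      using tendsto_ennrealI[OF null] by (intro ennreal_Liminf_add_null) simp
    finally show ?thesis .
  qed
  \<comment> \<open>Increasing compact sets: each point belongs to all but finitely many of them, so
    Fatou's lemma recovers the full integral.\<close>
  obtain S :: "nat \<Rightarrow> (real^'N) set" where S: "\<forall>n. compact (S n)" "\<forall>n. S n \<subseteq> \<Omega>" "\<forall>n. S n \<subseteq> S (Suc n)" "\<Union>(range S) = \<Omega>"
    using compact_exhaustion[OF \<Omega>] by blast
  have [measurable]: "(\<lambda>x. ennreal (indicator (S n) x * f x (U x) (b x) (V x))) \<in> borel_measurable lborel" for n
    using f_borel[of "S n" U b V] S(1,2) m b(1) by (simp add: borel_compact)
  have "energy f \<Omega> u v \<le> (\<integral>\<^sup>+x. liminf (\<lambda>n. ennreal (indicator (S n) x * f x (U x) (b x) (V x))) \<partial>lborel)"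
    unfolding E
  proof (rule nn_integral_mono)
    fix x
    show "ennreal (indicator \<Omega> x * f x (U x) (b x) (V x)) \<le> liminf (\<lambda>n. ennreal (indicator (S n) x * f x (U x) (b x) (V x)))"
    proof (cases "x \<in> \<Omega>")
      case True
      then obtain N where N: "x \<in> S N" using S(4) by blast
      have "S N \<subseteq> S n" if "N \<le> n" for n
        by (rule lift_Suc_mono_le[where f=S, OF _ that]) (rule S(3)[rule_format])
      then have "\<forall>\<^sub>F n in sequentially. x \<in> S n" using N unfolding eventually_sequentially by blast
      then show ?thesis by (intro Liminf_bounded) (auto elim!: eventually_mono simp: True)
    qed simp
  qed
  also have "\<dots> \<le> liminf (\<lambda>n. \<integral>\<^sup>+x. ennreal (indicator (S n) x * f x (U x) (b x) (V x)) \<partial>lborel)"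
    by (rule nn_integral_liminf) measurable
  also have "\<dots> \<le> liminf (\<lambda>n :: nat. ?L)"
    using S(1,2) by (intro Liminf_mono always_eventually allI local) auto
  also have "\<dots> = ?L" by (simp add: Liminf_const)
  finally show ?thesis .
qed

end

section \<open>Verification of the assumptions and conclusion\<close>

text \<open>The modulus is taken on a compact product of closed balls around \<open>x0\<close> and
  \<open>u0\<close>, and the second point is frozen at the centre; continuity of the modulus at 0
  does the rest.\<close>

lemma local_modulus:
  fixes f :: "real^'N::finite \<Rightarrow> real^'n::finite \<Rightarrow> real^'m::finite \<Rightarrow> real^'N^'n \<Rightarrow> real"
  assumes \<Omega>: "open \<Omega>" and x0: "x0 \<in> \<Omega>" and \<epsilon>: "0 < \<epsilon>"
    and modulus: "\<forall>K. compact K \<and> K \<subseteq> \<Omega> \<times> (UNIV :: (real^'n) set) \<longrightarrow>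
        (\<exists>\<omega> :: real \<Rightarrow> real. continuous_on UNIV \<omega> \<and> (\<forall>t. 0 \<le> \<omega> t) \<and> \<omega> 0 = 0 \<and>
          (\<forall>(x, u)\<in>K. \<forall>(x', u')\<in>K. \<forall>v \<xi>.
            \<bar>f x u v \<xi> - f x' u' v \<xi>\<bar>
              \<le> \<omega> (norm (x - x') + norm (u - u')) * (1 + norm v powr p + norm \<xi>)))"
  shows "\<exists>\<delta>>0. \<forall>x u v \<xi>. norm (x - x0) \<le> \<delta> \<longrightarrow> norm (u - u0) \<le> \<delta> \<longrightarrow>
      \<bar>f x u v \<xi> - f x0 u0 v \<xi>\<bar> \<le> \<epsilon> * (1 + norm v powr p + norm \<xi>)"
proof -
  obtain \<rho> where \<rho>: "\<rho> > 0" "cball x0 \<rho> \<subseteq> \<Omega>" using \<Omega> x0 open_contains_cball by blast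
  let ?K = "cball x0 \<rho> \<times> cball u0 1"
  have "compact ?K \<and> ?K \<subseteq> \<Omega> \<times> UNIV" using \<rho>(2) by (auto intro: compact_Times)
  from modulus[THEN spec, THEN mp, OF this] have "\<exists>\<omega> :: real \<Rightarrow> real. continuous_on UNIV \<omega> \<and> (\<forall>t. 0 \<le> \<omega> t) \<and> \<omega> 0 = 0 \<and>
      (\<forall>(x, u)\<in>?K. \<forall>(x', u')\<in>?K. \<forall>v \<xi>.
        \<bar>f x u v \<xi> - f x' u' v \<xi>\<bar> \<le> \<omega> (norm (x - x') + norm (u - u')) * (1 + norm v powr p + norm \<xi>))"
    .
  then obtain \<omega> :: "real \<Rightarrow> real" where \<omega>: "continuous_on UNIV \<omega>" "\<omega> 0 = 0"
    and mod: "\<forall>(x, u)\<in>?K. \<forall>(x', u')\<in>?K. \<forall>v \<xi>.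
            \<bar>f x u v \<xi> - f x' u' v \<xi>\<bar> \<le> \<omega> (norm (x - x') + norm (u - u')) * (1 + norm v powr p + norm \<xi>)"
    by (elim exE conjE)
  have "isCont \<omega> 0" using \<omega>(1) by (simp add: continuous_on_eq_continuous_at)
  then obtain d where d: "d > 0" "\<And>t. dist t 0 < d \<Longrightarrow> dist (\<omega> t) (\<omega> 0) < \<epsilon>"
    using \<epsilon> unfolding continuous_at_eps_delta by blast
  \<comment> \<open>The first two bounds keep \<open>(x, u)\<close> in the compact product;
    \<open>d / 3\<close> keeps the sum of both distances below \<open>d\<close>.\<close>
  define \<delta> where "\<delta> = min (min \<rho> 1) (d / 3)"
  have \<delta>: "\<delta> > 0" "\<delta> \<le> \<rho>" "\<delta> \<le> 1" "\<delta> + \<delta> < d" using \<rho>(1) d(1) by (auto simp: \<delta>_def min_def)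
  have "\<bar>f x u v \<xi> - f x0 u0 v \<xi>\<bar> \<le> \<epsilon> * (1 + norm v powr p + norm \<xi>)"
    if x: "norm (x - x0) \<le> \<delta>" and u: "norm (u - u0) \<le> \<delta>" for x u v \<xi>
  proof -
    have "(x, u) \<in> ?K" "(x0, u0) \<in> ?K" using x u \<delta> \<rho>(1) by (auto simp: dist_norm norm_minus_commute)
    then have "\<bar>f x u v \<xi> - f x0 u0 v \<xi>\<bar> \<le> \<omega> (norm (x - x0) + norm (u - u0)) * (1 + norm v powr p + norm \<xi>)"
      using mod by blast
    also have "\<omega> (norm (x - x0) + norm (u - u0)) \<le> \<epsilon>"
      using d(2)[of "norm (x - x0) + norm (u - u0)"] x u \<delta>(4) \<omega>(2) by (auto simp: dist_real_def)
    finally show ?thesis by (simp add: mult_right_mono)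
  qed
  then show ?thesis using \<delta>(1) by blast
qed

theorem theorem11:
  fixes p :: real
    and \<Omega> :: "(real^'N::finite) set"
    and f :: "real^'N \<Rightarrow> real^'n::finite \<Rightarrow> real^'m::finite \<Rightarrow> real^'N^'n \<Rightarrow> real"
  assumes p: "1 < p"
    and Omega: "bounded \<Omega>" "open \<Omega>"
    and f_nonneg: "\<forall>x\<in>\<Omega>. \<forall>u v \<xi>. 0 \<le> f x u v \<xi>"
    and f_cont: "continuous_on (\<Omega> \<times> UNIV \<times> UNIV \<times> UNIV) (\<lambda>(x, u, v, \<xi>). f x u v \<xi>)"
    and f_cqc: "\<forall>x\<in>\<Omega>. \<forall>u. convex_quasiconvex (\<lambda>v \<xi>. f x u v \<xi>)"
    and growth: "\<exists>C>0. \<forall>x\<in>\<Omega>. \<forall>u v \<xi>.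
        1 / C * (norm v powr p + norm \<xi>) - C \<le> f x u v \<xi> \<and>
        f x u v \<xi> \<le> C * (1 + norm v powr p + norm \<xi>)"
    and modulus: "\<forall>K. compact K \<and> K \<subseteq> \<Omega> \<times> (UNIV :: (real^'n) set) \<longrightarrow>
        (\<exists>\<omega> :: real \<Rightarrow> real. continuous_on UNIV \<omega> \<and> (\<forall>t. 0 \<le> \<omega> t) \<and> \<omega> 0 = 0 \<and>
          (\<forall>(x, u)\<in>K. \<forall>(x', u')\<in>K. \<forall>v \<xi>.
            \<bar>f x u v \<xi> - f x' u' v \<xi>\<bar>
              \<le> \<omega> (norm (x - x') + norm (u - u')) * (1 + norm v powr p + norm \<xi>)))"
    and lower: "\<forall>x0\<in>\<Omega>. \<forall>\<epsilon>>0. \<exists>\<delta>>0. \<forall>x\<in>\<Omega>. norm (x - x0) \<le> \<delta> \<longrightarrow>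
        (\<forall>u v \<xi>. f x u v \<xi> - f x0 u v \<xi> \<ge> - \<epsilon> * (1 + norm v powr p + norm \<xi>))"
  shows "\<forall>u \<in> W11_space \<Omega>. \<forall>v \<in> Lp_space p \<Omega>. \<forall>uk vk.
      (\<forall>k. uk k \<in> W11_space \<Omega> \<and> vk k \<in> Lp_space p \<Omega>) \<and>
      L1_converges \<Omega> uk u \<and> Lp_weakly_converges p \<Omega> vk v \<longrightarrow>
      energy f \<Omega> u v \<le> liminf (\<lambda>k. energy f \<Omega> (uk k) (vk k))"
proof -
  obtain C where C: "C > 0" "\<forall>x\<in>\<Omega>. \<forall>u v \<xi>. 1 / C * (norm v powr p + norm \<xi>) - C \<le> f x u v \<xi> \<and>
      f x u v \<xi> \<le> C * (1 + norm v powr p + norm \<xi>)"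
    using growth by blast
  interpret coercive_integrand p C \<Omega> f
  proof unfold_locales
    show "\<exists>\<delta>>0. \<forall>x u v \<xi>. norm (x - x0) \<le> \<delta> \<longrightarrow> norm (u - u0) \<le> \<delta> \<longrightarrow>
        \<bar>f x u v \<xi> - f x0 u0 v \<xi>\<bar> \<le> \<epsilon> * (1 + norm v powr p + norm \<xi>)"
      if "x0 \<in> \<Omega>" "0 < \<epsilon>" for x0 \<epsilon> u0
      by (rule local_modulus[OF Omega(2) that modulus])
  qed (use p C Omega f_nonneg f_cont f_cqc in blast)+
  show ?thesis using energy_lsc[OF Omega(1)] by blast
qed

end
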